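(* Let $\alpha<2-\sqrt2$ and $C_1>2$. For all sufficiently small $\rho>0$ and all $\lambda$ with $C_1\sqrt{\frac1\rho\log\frac1\rho}<\lambda<\rho^{-\alpha}$, there exist points $a<\rho^2<b$ in $[0,\rho]$ (depending on $\rho,\lambda$), with $b/\rho\to0$ as $\rho\to0$, such that for every sufficiently large $\beta$ there are $h>0$ and $c>0$ for which the following holds with probability $1-O(e^{-cN})$ as $N\to\infty$ (over the randomness of $W$). Let $\mathcal I=(a,b)$. For every nearest-neighbor Markov chain on $\Sigma_N(\rho_N)$ that is reversible with respect to $\pi_\beta$, with $Q_x$ its law started from $x$, and every integer $T\ge1$, $$\int Q_x(\tau_{\mathcal I^c}\le T)\,d\pi_\beta(x\mid\mathcal I)\le Te^{-chN}.$$
   Context: Let $N\rho_N$ be the nearest integer to $N\rho$ (with $N\rho\in(N\rho_N-1/2,N\rho_N+1/2]$) and $\Sigma_N(\rho_N)=\{x\in\{0,1\}^N:\sum_ix_i=N\rho_N\}$. Let $A=\frac\lambda Nvv^T+W$ with $v\in\Sigma_N(\rho_N)$ fixed and $W$ symmetric with independent centered Gaussian entries on and above the diagonal, of variance $1/N$ off the diagonal and $2/N$ on it. For $\beta>0$, $\pi_\beta$ is the (random) probability measure on $\Sigma_N(\rho_N)$ with $\pi_\beta(\{x\})\propto\exp(\beta(x,Ax))$. Consider the graph on $\Sigma_N(\rho_N)$ in which two states are adjacent iff their Hamming distance is $2$; a nearest-neighbor Markov chain is a discrete-time chain whose transition matrix $Q$ satisfies $Q(x,y)=0$ whenever $x\ne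 y$ are not adjacent; it is reversible with respect to $\pi_\beta$ if detailed balance holds. $\mathcal I$ is identified with the set of $x$ whose overlap $\frac1N(x,v)$ lies in $\mathcal I$; $\pi_\beta(\cdot\mid\mathcal I)$ is $\pi_\beta$ conditioned on this set and $\tau_{\mathcal I^c}$ is the first time the chain's overlap with $v$ is not in $\mathcal I$. *)

theory Defs
  imports "HOL-Probability.Probability"
begin

text \<open>Vectors of length \<open>N\<close> are functions on the index set \<open>{..<N}\<close>.\<close>

text \<open>\<open>m = num_ones N \<rho>\<close> is the integer with \<open>N * \<rho> \<in> (m - 1/2, m + 1/2]\<close>.  (The library function
  \<open>round\<close> resolves ties in the other direction.)  It plays the role of \<open>N * \<rho>\<^sub>N\<close>.\<close>

definition num_ones :: "nat \<Rightarrow> real \<Rightarrow> int" where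
  "num_ones N \<rho> = \<lceil>real N * \<rho> - 1 / 2\<rceil>"

lemma num_ones_iff:
  "num_ones N \<rho> = m \<longleftrightarrow> real N * \<rho> \<in> {of_int m - 1 / 2 <.. of_int m + 1 / 2}"
  unfolding num_ones_def by (auto simp: ceiling_eq_iff)

definition slice :: "nat \<Rightarrow> real \<Rightarrow> (nat \<Rightarrow> real) set" where
  "slice N \<rho> = {x \<in> {..<N} \<rightarrow>\<^sub>E {0, 1}. (\<Sum>i<N. x i) = of_int (num_ones N \<rho>)}"

definition hamming_dist :: "nat \<Rightarrow> (nat \<Rightarrow> real) \<Rightarrow> (nat \<Rightarrow> real) \<Rightarrow> nat" where
  "hamming_dist N x y = card {i. i < N \<and> x i \<noteq> y i}"

definition overlap :: "nat \<Rightarrow> (nat \<Rightarrow> real) \<Rightarrow> (nat \<Rightarrow> real) \<Rightarrow> real" where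
  "overlap N v x = (1 / real N) * (\<Sum>i<N. x i * v i)"

text \<open>\<open>W \<omega> i j\<close> is the \<open>(i, j)\<close> entry; only \<open>i, j < N\<close> matter.\<close>

definition gaussian_symmetric_matrix ::
    "nat \<Rightarrow> 'w measure \<Rightarrow> ('w \<Rightarrow> nat \<Rightarrow> nat \<Rightarrow> real) \<Rightarrow> bool" where
  "gaussian_symmetric_matrix N M W \<longleftrightarrow>
     prob_space M \<and>
     (\<forall>\<omega>\<in>space M. \<forall>i<N. \<forall>j<N. W \<omega> i j = W \<omega> j i) \<and>
     prob_space.indep_vars M (\<lambda>_. borel) (\<lambda>(i, j) \<omega>. W \<omega> i j) {(i, j). i \<le> j \<and> j < N} \<and>
     (\<forall>i j. i \<le> j \<and> j < N \<longrightarrow>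
        distributed M lborel (\<lambda>\<omega>. W \<omega> i j)
          (normal_density 0 (sqrt ((if i = j then 2 else 1) / real N))))"

definition spiked_matrix ::
    "nat \<Rightarrow> real \<Rightarrow> (nat \<Rightarrow> real) \<Rightarrow> (nat \<Rightarrow> nat \<Rightarrow> real) \<Rightarrow> nat \<Rightarrow> nat \<Rightarrow> real" where
  "spiked_matrix N lam v W i j = lam / real N * (v i * v j) + W i j"

definition quad_form :: "nat \<Rightarrow> (nat \<Rightarrow> nat \<Rightarrow> real) \<Rightarrow> (nat \<Rightarrow> real) \<Rightarrow> real" where
  "quad_form N A x = (\<Sum>i<N. x i * (\<Sum>j<N. A i j * x j))"

text \<open>Meaningful when the slice is non-empty, which is always the case when it contains \<open>v\<close>.\<close>

definition gibbs ::
    "nat \<Rightarrow> real \<Rightarrow> real \<Rightarrow> (nat \<Rightarrow> nat \<Rightarrow> real) \<Rightarrow> (nat \<Rightarrow> real) pmf" where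
  "gibbs N \<rho> \<beta> A = embed_pmf (\<lambda>x.
     if x \<in> slice N \<rho>
     then exp (\<beta> * quad_form N A x) / (\<Sum>y\<in>slice N \<rho>. exp (\<beta> * quad_form N A y))
     else 0)"

lemma finite_slice [simp]: "finite (slice N \<rho>)"
  unfolding slice_def by (rule finite_subset[OF _ finite_PiE[of "{..<N}" "\<lambda>_. {0, 1}"]]) auto

lemma pmf_gibbs:
  assumes "slice N \<rho> \<noteq> {}"
  shows "pmf (gibbs N \<rho> \<beta> A) x =
    (if x \<in> slice N \<rho>
     then exp (\<beta> * quad_form N A x) / (\<Sum>y\<in>slice N \<rho>. exp (\<beta> * quad_form N A y))
     else 0)"
  unfolding gibbs_def
proof (rule pmf_embed_pmf)
  let ?w = "\<lambda>x. exp (\<beta> * quad_form N A x)"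
  let ?Z = "\<Sum>y\<in>slice N \<rho>. ?w y"
  have Z: "?Z > 0"
    using assms by (intro sum_pos) auto
  then show "0 \<le> (if x \<in> slice N \<rho> then ?w x / ?Z else 0)" for x
    by simp
  have "(\<integral>\<^sup>+ x. ennreal (if x \<in> slice N \<rho> then ?w x / ?Z else 0) \<partial>count_space UNIV) =
      (\<Sum>x\<in>slice N \<rho>. ennreal (?w x / ?Z))"
    by (subst nn_integral_count_space'[of "slice N \<rho>"]) (auto intro!: sum.cong)
  also have "\<dots> = ennreal (\<Sum>x\<in>slice N \<rho>. ?w x / ?Z)"
    using Z by (intro sum_ennreal) simp
  also have "(\<Sum>x\<in>slice N \<rho>. ?w x / ?Z) = 1"
    using Z by (simp flip: sum_divide_distrib)
  finally show "(\<integral>\<^sup>+ x. ennreal (if x \<in> slice N \<rho> then ?w x / ?Z else 0) \<partial>count_space UNIV) = 1"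
    by simp
qed

text \<open>A transition matrix is given by its rows \<open>Q x\<close>, so the entry \<open>Q(x, y)\<close> is \<open>pmf (Q x) y\<close>.
  The rows at points outside the slice are irrelevant.\<close>

definition nearest_neighbor_chain ::
    "nat \<Rightarrow> real \<Rightarrow> ((nat \<Rightarrow> real) \<Rightarrow> (nat \<Rightarrow> real) pmf) \<Rightarrow> bool" where
  "nearest_neighbor_chain N \<rho> Q \<longleftrightarrow>
     (\<forall>x\<in>slice N \<rho>. set_pmf (Q x) \<subseteq> slice N \<rho> \<and>
        (\<forall>y\<in>slice N \<rho>. x \<noteq> y \<and> hamming_dist N x y \<noteq> 2 \<longrightarrow> pmf (Q x) y = 0))"

definition reversible_on :: "'s set \<Rightarrow> 's pmf \<Rightarrow> ('s \<Rightarrow> 's pmf) \<Rightarrow> bool" where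
  "reversible_on S \<pi> Q \<longleftrightarrow>
     (\<forall>x\<in>S. \<forall>y\<in>S. pmf \<pi> x * pmf (Q x) y = pmf \<pi> y * pmf (Q y) x)"

text \<open>The law on trajectories \<open>nat \<Rightarrow> 's\<close> of the chain started from \<open>x\<close>, obtained from the
  Ionescu-Tulcea theorem.\<close>

definition chain_step :: "('s \<Rightarrow> 's pmf) \<Rightarrow> 's \<Rightarrow> nat \<Rightarrow> (nat \<Rightarrow> 's) \<Rightarrow> 's measure" where
  "chain_step Q x n \<omega> = measure_pmf (case n of 0 \<Rightarrow> return_pmf x | Suc m \<Rightarrow> Q (\<omega> m))"

definition chain_law :: "('s \<Rightarrow> 's pmf) \<Rightarrow> 's \<Rightarrow> (nat \<Rightarrow> 's) measure" where
  "chain_law Q x =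
     projective_family.lim UNIV
       (Ionescu_Tulcea.CI (chain_step Q x) (\<lambda>_. count_space UNIV)) (\<lambda>_. count_space UNIV)"

definition hitting_time :: "'s set \<Rightarrow> (nat \<Rightarrow> 's) \<Rightarrow> enat" where
  "hitting_time B \<omega> = Inf {enat t | t. \<omega> t \<in> B}"

lemma Ionescu_Tulcea_chain_step:
  "Ionescu_Tulcea (chain_step Q x) (\<lambda>_. count_space UNIV)"
proof (rule Ionescu_Tulcea.intro)
  fix n
  show "chain_step Q x n \<in>
      measurable (PiM {0..<n} (\<lambda>_. count_space UNIV)) (subprob_algebra (count_space UNIV))"
  proof (cases n)
    case 0
    then show ?thesis
      by (simp add: chain_step_def[abs_def] measure_pmf_in_subprob_algebra)
  next
    case (Suc m)
    have "(\<lambda>\<omega>. \<omega> m) \<in> measurable (PiM {0..<n} (\<lambda>_. count_space UNIV)) (count_space UNIV)"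
      using Suc by (intro measurable_component_singleton) simp
    then show ?thesis
      unfolding chain_step_def[abs_def] Suc nat.case
      by (rule measurable_compose) (simp add: measure_pmf_in_subprob_algebra)
  qed
qed (simp add: chain_step_def measure_pmf.prob_space_axioms)

text \<open>The law of the first \<open>n + 1\<close> states is the usual product of transition probabilities.\<close>

lemma chain_law_cylinder:
  "measure (chain_law Q x) {\<omega>. \<forall>i\<le>n. \<omega> i = z i} =
     (if z 0 = x then 1 else 0) * (\<Prod>i<n. pmf (Q (z i)) (z (Suc i)))"
proof -
  let ?U = "\<lambda>_::nat. count_space (UNIV :: 's set)"
  let ?A = "\<lambda>n. PiE {0..<n} (\<lambda>i. {z i})"
  interpret IT: Ionescu_Tulcea "chain_step Q x" ?U
    by (rule Ionescu_Tulcea_chain_step)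
  have A [measurable]: "?A m \<in> sets (PiM {0..<m} ?U)" for m
    by (intro sets_PiM_I_finite) auto
  have step: "emeasure (IT.C 0 (Suc m) (\<lambda>_. undefined)) (?A (Suc m)) =
      emeasure (chain_step Q x m z) {z m} * emeasure (IT.C 0 m (\<lambda>_. undefined)) (?A m)" for m
  proof -
    have sp: "(\<lambda>_. undefined) \<in> space (PiM {0..<0} ?U)"
      by (simp add: space_PiM)
    have "emeasure (IT.C 0 (Suc m) (\<lambda>_. undefined)) (?A (Suc m)) =
        (\<integral>\<^sup>+\<omega>. emeasure (IT.eP m \<omega>) (?A (Suc m)) \<partial>IT.C 0 m (\<lambda>_. undefined))"
      using sp IT.space_C[OF sp, of m] IT.measurable_eP[of m]
      by (simp, intro emeasure_bind[OF _ _ A])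
         (auto simp: space_PiM measurable_cong_sets[OF IT.sets_C[OF sp] refl])
    also have "\<dots> = (\<integral>\<^sup>+\<omega>. emeasure (chain_step Q x m z) {z m} * indicator (?A m) \<omega>
        \<partial>IT.C 0 m (\<lambda>_. undefined))"
    proof (rule nn_integral_cong)
      fix \<omega> assume "\<omega> \<in> space (IT.C 0 m (\<lambda>_. undefined))"
      then have \<omega>: "\<omega> \<in> space (PiM {0..<m} ?U)"
        using IT.space_C[OF sp, of m] by simp
      have "(\<lambda>y. fun_upd \<omega> m y) -` ?A (Suc m) = (if \<omega> \<in> ?A m then {z m} else {})"
        using \<omega> by (auto simp: space_PiM PiE_iff extensional_def less_Suc_eq split: if_splits)
      moreover have "\<omega> i = z i" if "\<omega> \<in> ?A m" "i < m" for i
        using that by (auto simp: PiE_iff)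
      then have "chain_step Q x m \<omega> = chain_step Q x m z" if "\<omega> \<in> ?A m"
        using that by (cases m) (auto simp: chain_step_def)
      ultimately show "emeasure (IT.eP m \<omega>) (?A (Suc m)) =
          emeasure (chain_step Q x m z) {z m} * indicator (?A m) \<omega>"
        using IT.emeasure_eP[OF \<omega> A] by (auto split: split_indicator)
    qed
    also have "\<dots> = emeasure (chain_step Q x m z) {z m} *
        emeasure (IT.C 0 m (\<lambda>_. undefined)) (?A m)"
      using IT.sets_C[OF sp, of m] A[of m] by (intro nn_integral_cmult_indicator) simp
    finally show ?thesis .
  qed
  have C: "emeasure (IT.C 0 (Suc m) (\<lambda>_. undefined)) (?A (Suc m)) =
      ennreal ((if z 0 = x then 1 else 0) * (\<Prod>i<m. pmf (Q (z i)) (z (Suc i))))" for m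
  proof (induction m)
    case 0
    have "emeasure (IT.C 0 0 (\<lambda>_. undefined)) (?A 0) = 1"
      using A[of 0] by (simp)
    then show ?case
      unfolding step[of 0] by (simp add: chain_step_def emeasure_pmf_single)
  next
    case (Suc m)
    show ?case
      unfolding step[of "Suc m"] Suc.IH
      by (simp add: chain_step_def emeasure_pmf_single mult_ac prod_nonneg flip: ennreal_mult)
  qed
  have "{\<omega>. \<forall>i\<le>n. \<omega> i = z i} = IT.PF.emb UNIV {0..<Suc n} (?A (Suc n))"
    by (auto simp: prod_emb_def PiE_iff less_Suc_eq_le)
  then have "emeasure (chain_law Q x) {\<omega>. \<forall>i\<le>n. \<omega> i = z i} = emeasure (IT.CI {0..<Suc n}) (?A (Suc n))"
    unfolding chain_law_def using IT.lim[OF _ A[of "Suc n"]] by simp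
  also have "\<dots> = emeasure (IT.C 0 (Suc n) (\<lambda>_. undefined)) (?A (Suc n))"
    using IT.emeasure_CI[of "{0..<Suc n}" "Suc n" "?A (Suc n)"] A[of "Suc n"]
      sets.sets_into_space[OF A[of "Suc n"]] by (simp add: prod_emb_id space_PiM)
  finally show ?thesis
    unfolding C by (simp add: measure_def prod_nonneg)
qed

end

theory Submission
  imports Defs "HOL-Real_Asymp.Real_Asymp"
begin

text \<open>Take the window \<open>(0, b)\<close> with \<open>b = \<rho> powr (1 + \<gamma>)\<close> and \<open>\<alpha> - 1/2 < \<gamma> < 3/2 - sqrt 2\<close>.  By
  reversibility the exit probability is at most \<open>T\<close> times the conditional weight of the two boundary
  levels, overlap \<open>1/N\<close> and overlap just below \<open>b\<close>.

  On the left no information on the ground state is needed: near overlap zero a uniformly random swap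
  costs only bounded energy, while swaps raising the overlap outnumber those lowering it, so the
  level weights grow geometrically.

  On the right, a union bound for the Gaussian energies at overlap \<open>b\<close> falls short of the maximal
  energy inside the window.  That maximum is bounded below by a truncated second moment
  argument, which succeeds only with probability \<open>exp (- \<epsilon> * N)\<close>; Gaussian concentration
  of the maximum upgrades this to probability exponentially close to one.  The precision
  needed is a factor \<open>1 - O(\<rho> powr \<theta>)\<close> with \<open>\<gamma> < \<theta> < 3/2 - sqrt 2\<close>.\<close>

section \<open>Exit times of reversible chains\<close>

text \<open>Let \<open>n\<close> be the number of ones and \<Lambda> = ln (N choose n), of order
  \<rho> ln(1/\<rho>) N. The largest energy sits near 2 n sqrt(\<Lambda>/N), of order \<rho>^(3/2) N
  up to logarithms. Forcing overlap b = \<rho>^(1+\<gamma>) destroys a fraction of order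
  \<rho>^\<gamma> of the entropy \<Lambda> and so lowers the union bound by order
  \<rho>^(3/2+\<gamma>) N, while the spike returns at most lam b^2 N < \<rho>^(2+2\<gamma>-\<alpha>)
  N: this asks for \<gamma> > \<alpha> - 1/2. The lower bound inside the window must be finer than
  the entropy loss, and the second moment works only down to relative precision \<rho>^\<theta> with
  \<theta> < 3/2 - sqrt 2. The two constraints meet at \<alpha> = 2 - sqrt 2. Truncation is
  indispensable: untilted by it, a pair of sets meeting in j points contributes exp(2 B^2 j^2 / N)
  for tilt parameter B, about exp(2 \<Lambda>) at j = n, while only a factor exp(\<Lambda>) can be
  afforded there. Truncation halves this exponent up to a fluctuation term. On the right maxima
  rather than free energies are compared, so \<beta> only has to be large enough for the energy gap
  to outweigh the number of states.\<close>

lemma sum_paths_Suc: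
  assumes "finite R"
  shows "(\<Sum>z\<in>{..Suc s} \<rightarrow>\<^sub>E R. f z) = (\<Sum>z\<in>{..s} \<rightarrow>\<^sub>E R. \<Sum>y\<in>R. f (z(Suc s := y)))"
proof -
  have "(\<Sum>z\<in>{..Suc s} \<rightarrow>\<^sub>E R. f z) = (\<Sum>(y, z)\<in>R \<times> ({..s} \<rightarrow>\<^sub>E R). f (z(Suc s := y)))"
    unfolding atMost_Suc PiE_insert_eq
    by (subst sum.reindex) (auto intro!: inj_combinator sum.cong)
  also have "\<dots> = (\<Sum>y\<in>R. \<Sum>z\<in>{..s} \<rightarrow>\<^sub>E R. f (z(Suc s := y)))"
    by (rule sum.cartesian_product[symmetric])
  also have "\<dots> = (\<Sum>z\<in>{..s} \<rightarrow>\<^sub>E R. \<Sum>y\<in>R. f (z(Suc s := y)))"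
    by (rule sum.swap)
  finally show ?thesis .
qed

lemma sum_paths_0:
  "(\<Sum>z\<in>{..0::nat} \<rightarrow>\<^sub>E R. f (z 0)) = (\<Sum>y\<in>R. f y)"
proof -
  have "{..0::nat} \<rightarrow>\<^sub>E R = (\<lambda>y. (\<lambda>_. undefined)(0 := y)) ` R"
    by (auto simp: atMost_0 PiE_insert_eq image_iff)
  moreover have "inj_on (\<lambda>y. (\<lambda>_. undefined)(0::nat := y)) R"
    by (rule inj_onI) (metis fun_upd_same)
  ultimately show ?thesis by (simp add: sum.reindex)
qed

lemma sum_paths_step:
  assumes "finite R"
  shows "(\<Sum>z\<in>{..Suc s} \<rightarrow>\<^sub>E R. a (z 0) * (\<Prod>i<Suc s. pmf (Q (z i)) (z (Suc i))) * g (z (Suc s))) =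
    (\<Sum>z\<in>{..s} \<rightarrow>\<^sub>E R. a (z 0) * (\<Prod>i<s. pmf (Q (z i)) (z (Suc i))) * (\<Sum>y\<in>R. pmf (Q (z s)) y * g y))"
  unfolding sum_paths_Suc[OF assms]
  by (intro sum.cong refl) (simp add: sum_distrib_left sum_distrib_right mult_ac)

text \<open>Detailed balance carries the weight \<open>pmf \<pi>\<close> from the first state of a
  path to its last, one step at a time, so paths confined to \<open>R\<close> end in
  \<open>y\<close> with total weight at most \<open>pmf \<pi> y\<close>. Only an inequality survives
  because mass leaving \<open>R\<close> is lost. The test function \<open>g\<close> is arbitrary
  since each induction step replaces it by its one-step average.\<close>

lemma reversible_flow_le:
  assumes "finite S" "R \<subseteq> S" "reversible_on S \<pi> Q" "\<And>y. g y \<ge> 0"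
  shows "(\<Sum>z\<in>{..s} \<rightarrow>\<^sub>E R. pmf \<pi> (z 0) * (\<Prod>i<s. pmf (Q (z i)) (z (Suc i))) * g (z s))
    \<le> (\<Sum>y\<in>R. pmf \<pi> y * g y)"
  using assms(4)
proof (induction s arbitrary: g)
  case 0
  then show ?case using sum_paths_0[of "\<lambda>y. pmf \<pi> y * g y" R] by simp
next
  case (Suc s)
  have fin: "finite R" using assms finite_subset by blast
  have "(\<Sum>z\<in>{..Suc s} \<rightarrow>\<^sub>E R. pmf \<pi> (z 0) * (\<Prod>i<Suc s. pmf (Q (z i)) (z (Suc i))) * g (z (Suc s)))
      \<le> (\<Sum>x\<in>R. pmf \<pi> x * (\<Sum>y\<in>R. pmf (Q x) y * g y))"
    unfolding sum_paths_step[OF fin] by (rule Suc.IH) (intro sum_nonneg mult_nonneg_nonneg pmf_nonneg Suc.prems)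
  also have "\<dots> = (\<Sum>x\<in>R. \<Sum>y\<in>R. pmf \<pi> y * pmf (Q y) x * g y)"
    using assms(2,3) unfolding reversible_on_def
    by (auto simp: sum_distrib_left intro!: sum.cong) (metis mult.assoc subsetD)
  also have "\<dots> = (\<Sum>y\<in>R. pmf \<pi> y * g y * (\<Sum>x\<in>R. pmf (Q y) x))"
    by (subst sum.swap) (simp add: sum_distrib_left mult_ac)
  also have "\<dots> \<le> (\<Sum>y\<in>R. pmf \<pi> y * g y * 1)"
    using fin Suc.prems
    by (intro sum_mono mult_left_mono) (auto simp: sum_pmf_eq_1 measure_measure_pmf_finite[symmetric])
  finally show ?case by simp
qed

text \<open>Conservation of mass for paths in a closed set. With \<open>a\<close> a point mass it
  shows that the chain law is carried by paths inside \<open>S\<close>, whatever the rows of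
  \<open>Q\<close> do elsewhere.\<close>

lemma sum_path_weights:
  assumes "finite S" "\<And>x. x \<in> S \<Longrightarrow> set_pmf (Q x) \<subseteq> S"
  shows "(\<Sum>z\<in>{..s} \<rightarrow>\<^sub>E S. a (z 0) * (\<Prod>i<s. pmf (Q (z i)) (z (Suc i)))) = (\<Sum>y\<in>S. a y)"
proof (induction s)
  case 0
  then show ?case using sum_paths_0[of a S] by simp
next
  case (Suc s)
  have "(\<Sum>z\<in>{..Suc s} \<rightarrow>\<^sub>E S. a (z 0) * (\<Prod>i<Suc s. pmf (Q (z i)) (z (Suc i)))) =
      (\<Sum>z\<in>{..s} \<rightarrow>\<^sub>E S. a (z 0) * (\<Prod>i<s. pmf (Q (z i)) (z (Suc i))) * (\<Sum>y\<in>S. pmf (Q (z s)) y))"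
    using sum_paths_step[OF assms(1), where g="\<lambda>_. 1"] by simp
  also have "\<dots> = (\<Sum>z\<in>{..s} \<rightarrow>\<^sub>E S. a (z 0) * (\<Prod>i<s. pmf (Q (z i)) (z (Suc i))))"
    using assms by (intro sum.cong refl) (auto simp: sum_pmf_eq_1 PiE_iff)
  finally show ?case using Suc by simp
qed

section \<open>The trajectory law on events about finitely many times\<close>

lemma space_chain_law [simp]: "space (chain_law Q x) = UNIV"
  and sets_chain_law: "sets (chain_law Q x) = sets (PiM UNIV (\<lambda>_. count_space UNIV))"
  and prob_space_chain_law: "prob_space (chain_law Q x)"
proof -
  interpret IT: Ionescu_Tulcea "chain_step Q x" "\<lambda>_. count_space UNIV"
    by (rule Ionescu_Tulcea_chain_step)
  show sp: "space (chain_law Q x) = UNIV"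
    and "sets (chain_law Q x) = sets (PiM UNIV (\<lambda>_. count_space UNIV))"
    unfolding chain_law_def by (simp_all add: space_PiM)
  \<comment> \<open>Total mass is read off from the marginal on the empty index set.\<close>
  have "prob_space (distr (chain_law Q x) (PiM {} (\<lambda>_. count_space UNIV)) (\<lambda>\<xi>. restrict \<xi> {}))"
    unfolding chain_law_def using IT.PF.prob_space_P[of "{}"] by (simp add: IT.distr_lim)
  moreover have "(\<lambda>\<xi>. restrict \<xi> {}) \<in> measurable (chain_law Q x) (PiM {} (\<lambda>_. count_space UNIV))"
    by (intro measurable_restrict) simp
  ultimately show "prob_space (chain_law Q x)"
    by (rule prob_space_distrD[rotated])
qed

lemma cylinder_in_chain_law: "{\<xi>. \<forall>i\<le>n. \<xi> i = z i} \<in> sets (chain_law Q x)"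
proof -
  let ?P = "PiM UNIV (\<lambda>_. count_space UNIV)"
  have "{\<xi>. \<forall>i\<le>n. \<xi> i = z i} = (\<Inter>i\<in>{..n}. (\<lambda>\<xi>. \<xi> i) -` {z i} \<inter> space ?P)"
    by (auto simp: space_PiM)
  also have "\<dots> \<in> sets ?P"
    by (intro sets.finite_INT measurable_sets[OF measurable_component_singleton]) auto
  finally show ?thesis by (simp add: sets_chain_law)
qed

text \<open>Reduces events about finitely many times to disjoint unions of cylinders, whose
  probabilities \<open>chain_law_cylinder\<close> gives.\<close>

lemma measure_chain_law_paths:
  assumes "finite Z" "Z \<subseteq> extensional {..n}"
  shows "{\<xi>. restrict \<xi> {..n} \<in> Z} \<in> sets (chain_law Q x)" (is ?A)
    and "measure (chain_law Q x) {\<xi>. restrict \<xi> {..n} \<in> Z} =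
      (\<Sum>z\<in>Z. (if z 0 = x then 1 else 0) * (\<Prod>i<n. pmf (Q (z i)) (z (Suc i))))" (is ?B)
proof -
  interpret prob_space "chain_law Q x" by (rule prob_space_chain_law)
  let ?C = "\<lambda>z. {\<xi>. \<forall>i\<le>n. \<xi> i = z i}"
  have eq: "{\<xi>. restrict \<xi> {..n} \<in> Z} = (\<Union>z\<in>Z. ?C z)"
  proof (intro set_eqI iffI)
    fix \<xi> assume "\<xi> \<in> (\<Union>z\<in>Z. ?C z)"
    then obtain z where z: "z \<in> Z" "\<forall>i\<le>n. \<xi> i = z i" by auto
    then have "restrict \<xi> {..n} = z" using assms(2)
      by (intro extensionalityI[of _ "{..n}"]) auto
    with z show "\<xi> \<in> {\<xi>. restrict \<xi> {..n} \<in> Z}" by simp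
  next
    fix \<xi> assume "\<xi> \<in> {\<xi>. restrict \<xi> {..n} \<in> Z}"
    moreover have "\<xi> \<in> ?C (restrict \<xi> {..n})" by simp
    ultimately show "\<xi> \<in> (\<Union>z\<in>Z. ?C z)" by blast
  qed
  have disj: "disjoint_family_on ?C Z"
  proof (unfold disjoint_family_on_def, intro ballI impI equals0I)
    fix z z' \<xi> assume z: "z \<in> Z" "z' \<in> Z" "z \<noteq> z'" "\<xi> \<in> ?C z \<inter> ?C z'"
    then have "z = z'" using assms(2)
      by (intro extensionalityI[of z "{..n}" z']) auto
    with z show False by simp
  qed
  show ?A unfolding eq using assms(1) cylinder_in_chain_law by (intro sets.finite_UN) auto
  show ?B unfolding eq
    by (subst finite_measure_finite_Union[OF assms(1) _ disj])
       (auto simp: cylinder_in_chain_law chain_law_cylinder)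
qed

lemma hitting_time_le_iff: "hitting_time B \<xi> \<le> enat T \<longleftrightarrow> (\<exists>t\<le>T. \<xi> t \<in> B)"
proof
  assume le: "hitting_time B \<xi> \<le> enat T"
  then have ne: "{enat t | t. \<xi> t \<in> B} \<noteq> {}"
    unfolding hitting_time_def by (auto simp: Inf_enat_def split: if_splits)
  then have "Inf {enat t | t. \<xi> t \<in> B} \<in> {enat t | t. \<xi> t \<in> B}"
    unfolding Inf_enat_def by (metis (mono_tags, lifting) LeastI equals0I)
  then show "\<exists>t\<le>T. \<xi> t \<in> B" using le unfolding hitting_time_def by auto
next
  assume "\<exists>t\<le>T. \<xi> t \<in> B"
  then obtain t where "t \<le> T" "\<xi> t \<in> B" by auto
  then show "hitting_time B \<xi> \<le> enat T"
    unfolding hitting_time_def by (intro order.trans[OF Inf_lower[of "enat t"]]) auto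
qed

text \<open>The first exit from \<open>I\<close> happens through \<open>D\<close> while the chain has stayed in \<open>S \<inter> I\<close>.\<close>

lemma measure_chain_law_exit_le:
  assumes S: "finite S" "\<And>x. x \<in> S \<Longrightarrow> set_pmf (Q x) \<subseteq> S"
    and D: "\<And>x y. x \<in> S \<inter> I \<Longrightarrow> y \<in> S - I \<Longrightarrow> pmf (Q x) y \<noteq> 0 \<Longrightarrow> x \<in> D"
    and x: "x \<in> S \<inter> I"
  shows "measure (chain_law Q x) {\<xi>. hitting_time (- I) \<xi> \<le> enat T} \<le>
    (\<Sum>s<T. \<Sum>z\<in>{..s} \<rightarrow>\<^sub>E (S \<inter> I). (if z 0 = x then 1 else 0) *
        (\<Prod>i<s. pmf (Q (z i)) (z (Suc i))) * indicator D (z s))"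
proof -
  interpret prob_space "chain_law Q x" by (rule prob_space_chain_law)
  define w where "w s z = (if z 0 = x then 1 else 0) * (\<Prod>i<s. pmf (Q (z i)) (z (Suc i)))"
    for s and z :: "nat \<Rightarrow> 'a"
  \<comment> \<open>\<open>G\<close> collects the trajectories that start in \<open>x\<close>, stay
    in \<open>S\<close> up to time \<open>T\<close> and use only transitions of positive
    probability. It has full measure, so the exit analysis below may take these properties for
    granted.\<close>
  define Z where "Z = {z\<in>{..T} \<rightarrow>\<^sub>E S. w T z \<noteq> 0}"
  define G where "G = {\<xi>. restrict \<xi> {..T} \<in> Z}"
  define Zs where "Zs s = {z\<in>{..s} \<rightarrow>\<^sub>E (S \<inter> I). z s \<in> D}" for s :: nat
  define Es where "Es s = {\<xi>. restrict \<xi> {..s} \<in> Zs s}" for s :: nat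
  have finP: "finite ({..s} \<rightarrow>\<^sub>E S)" "finite ({..s} \<rightarrow>\<^sub>E (S \<inter> I))" for s :: nat
    using S by (auto intro!: finite_PiE)
  have Z: "finite Z" "Z \<subseteq> extensional {..T}"
    unfolding Z_def using finP(1)[of T] by simp (auto simp: PiE_iff)
  have Zs: "finite (Zs s)" "Zs s \<subseteq> extensional {..s}" for s
    unfolding Zs_def using finP(2)[of s] by simp (auto simp: PiE_iff)
  have "prob G = (\<Sum>z\<in>Z. w T z)"
    unfolding G_def w_def by (rule measure_chain_law_paths(2)[OF Z])
  also have "\<dots> = (\<Sum>z\<in>{..T} \<rightarrow>\<^sub>E S. w T z)"
    unfolding Z_def using finP by (intro sum.mono_neutral_left) auto
  also have "\<dots> = (\<Sum>y\<in>S. if y = x then 1 else 0)"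
    unfolding w_def by (rule sum_path_weights[OF S])
  also have "\<dots> = 1" using S x by simp
  finally have pG: "prob G = 1" .
  have G: "G \<in> events" unfolding G_def by (rule measure_chain_law_paths(1)[OF Z])
  have E: "Es s \<in> events" for s unfolding Es_def by (rule measure_chain_law_paths(1)[OF Zs])
  have "AE \<xi> in chain_law Q x. \<xi> \<in> G"
    using AE_in_set_eq_1[OF G] pG by simp
  then have "AE \<xi> in chain_law Q x. \<xi> \<in> {\<xi>. hitting_time (- I) \<xi> \<le> enat T} \<longrightarrow> \<xi> \<in> (\<Union>s<T. Es s)"
  proof eventually_elim
    case (elim \<xi>)
    show ?case
    proof
      assume "\<xi> \<in> {\<xi>. hitting_time (- I) \<xi> \<le> enat T}"
      then have ex: "\<exists>t. t \<le> T \<and> \<xi> t \<notin> I" by (auto simp: hitting_time_le_iff)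
      define t where "t = (LEAST t. t \<le> T \<and> \<xi> t \<notin> I)"
      have t: "t \<le> T" "\<xi> t \<notin> I" using LeastI_ex[OF ex] unfolding t_def by auto
      have before: "\<xi> i \<in> I" if "i < t" for i
        using not_less_Least[of i] that t unfolding t_def by force
      have "restrict \<xi> {..T} \<in> Z" using elim unfolding G_def by simp
      then have inS: "\<xi> i \<in> S" if "i \<le> T" for i
        using that by (auto simp: Z_def PiE_iff)
      have nz: "w T (restrict \<xi> {..T}) \<noteq> 0" using elim unfolding G_def Z_def by simp
      then have x0: "\<xi> 0 = x" by (auto simp: w_def split: if_splits)
      have step: "pmf (Q (\<xi> i)) (\<xi> (Suc i)) \<noteq> 0" if "i < T" for i
        using nz that unfolding w_def by auto
      \<comment> \<open>Starting inside \<open>I\<close> forces a positive exit time, so there is a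
        last state before the exit.\<close>
      have "t \<noteq> 0" using t(2) x unfolding x0[symmetric] by (intro notI) simp
      then obtain s where s: "t = Suc s" by (cases t) auto
      have "\<xi> s \<in> D"
      proof (rule D)
        show "\<xi> s \<in> S \<inter> I" using s t(1) before[of s] inS[of s] by simp
        show "\<xi> t \<in> S - I" using t inS[of t] by simp
        show "pmf (Q (\<xi> s)) (\<xi> t) \<noteq> 0" using s t(1) step[of s] by simp
      qed
      then have "\<xi> \<in> Es s"
        unfolding Es_def Zs_def using s t(1) before inS by (auto simp: PiE_iff)
      then show "\<xi> \<in> (\<Union>s<T. Es s)" using s t by auto
    qed
  qed
  then have "prob {\<xi>. hitting_time (- I) \<xi> \<le> enat T} \<le> prob (\<Union>s<T. Es s)"
    using E by (intro finite_measure_mono_AE) auto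
  also have "\<dots> \<le> (\<Sum>s<T. prob (Es s))"
    using E by (intro finite_measure_subadditive_finite) auto
  also have "\<dots> = (\<Sum>s<T. \<Sum>z\<in>Zs s. w s z)"
    unfolding Es_def w_def by (intro sum.cong refl measure_chain_law_paths(2)[OF Zs])
  also have "\<dots> = (\<Sum>s<T. \<Sum>z\<in>{..s} \<rightarrow>\<^sub>E (S \<inter> I). w s z * indicator D (z s))"
    unfolding Zs_def using finP by (intro sum.cong refl sum.mono_neutral_cong_left) auto
  finally show ?thesis unfolding w_def .
qed

text \<open>Union bound over the time \<open>s < T\<close> of the last state before the exit. After
  averaging over the start with weights \<open>pmf \<pi>\<close>, each of the \<open>T\<close> times
  contributes at most the stationary weight of \<open>S \<inter> I \<inter> D\<close>, by
  \<open>reversible_flow_le\<close>; this is the source of the linear dependence on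
  \<open>T\<close>.\<close>

lemma expectation_exit_le:
  assumes S: "finite S" "set_pmf \<pi> \<subseteq> S" "\<And>x. x \<in> S \<Longrightarrow> set_pmf (Q x) \<subseteq> S"
    and rev: "reversible_on S \<pi> Q"
    and D: "\<And>x y. x \<in> S \<inter> I \<Longrightarrow> y \<in> S - I \<Longrightarrow> pmf (Q x) y \<noteq> 0 \<Longrightarrow> x \<in> D"
    and ne: "set_pmf \<pi> \<inter> I \<noteq> {}"
  shows "measure_pmf.expectation (cond_pmf \<pi> I)
      (\<lambda>x. measure (chain_law Q x) {\<xi>. hitting_time (- I) \<xi> \<le> enat T})
    \<le> real T * ((\<Sum>x\<in>S \<inter> I \<inter> D. pmf \<pi> x) / (\<Sum>x\<in>S \<inter> I. pmf \<pi> x))"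
proof -
  let ?f = "\<lambda>x. measure (chain_law Q x) {\<xi>. hitting_time (- I) \<xi> \<le> enat T}"
  let ?R = "S \<inter> I"
  have fin: "finite ?R" using S by auto
  have P: "measure (measure_pmf \<pi>) I = (\<Sum>x\<in>?R. pmf \<pi> x)"
  proof -
    have "measure (measure_pmf \<pi>) I = measure (measure_pmf \<pi>) ?R"
      using S(2) by (intro measure_pmf.finite_measure_eq_AE) (auto simp: AE_measure_pmf_iff)
    then show ?thesis using fin by (simp add: measure_measure_pmf_finite)
  qed
  have "measure_pmf.expectation (cond_pmf \<pi> I) ?f = (\<Sum>x\<in>?R. ?f x * pmf (cond_pmf \<pi> I) x)"
    using S(2) fin by (intro integral_measure_pmf_real) (auto simp: set_cond_pmf[OF ne])
  also have "\<dots> = (\<Sum>x\<in>?R. pmf \<pi> x * ?f x) / (\<Sum>x\<in>?R. pmf \<pi> x)"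
    by (simp add: pmf_cond[OF ne] P sum_divide_distrib mult_ac)
  also have "\<dots> \<le> (real T * (\<Sum>x\<in>?R \<inter> D. pmf \<pi> x)) / (\<Sum>x\<in>?R. pmf \<pi> x)"
  proof (intro divide_right_mono sum_nonneg)
    have "(\<Sum>x\<in>?R. pmf \<pi> x * ?f x) \<le> (\<Sum>x\<in>?R. pmf \<pi> x * (\<Sum>s<T. \<Sum>z\<in>{..s} \<rightarrow>\<^sub>E ?R.
        (if z 0 = x then 1 else 0) * (\<Prod>i<s. pmf (Q (z i)) (z (Suc i))) * indicator D (z s)))"
      by (intro sum_mono mult_left_mono measure_chain_law_exit_le S D) auto
    also have "\<dots> = (\<Sum>s<T. \<Sum>z\<in>{..s} \<rightarrow>\<^sub>E ?R. \<Sum>x\<in>?R. pmf \<pi> x *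
        ((if z 0 = x then 1 else 0) * (\<Prod>i<s. pmf (Q (z i)) (z (Suc i))) * indicator D (z s)))"
      unfolding sum_distrib_left
      by (subst sum.swap, intro sum.cong refl, subst sum.swap) (rule refl)
    also have "\<dots> = (\<Sum>s<T. \<Sum>z\<in>{..s} \<rightarrow>\<^sub>E ?R. pmf \<pi> (z 0) * (\<Prod>i<s. pmf (Q (z i)) (z (Suc i))) * indicator D (z s))"
    proof (intro sum.cong refl)
      fix s :: nat and z assume z: "z \<in> {..s} \<rightarrow>\<^sub>E ?R"
      have "(\<Sum>x\<in>?R. pmf \<pi> x * ((if z 0 = x then 1 else 0) * (\<Prod>i<s. pmf (Q (z i)) (z (Suc i))) * indicator D (z s)))
        = (\<Sum>x\<in>?R. if z 0 = x then pmf \<pi> x * ((\<Prod>i<s. pmf (Q (z i)) (z (Suc i))) * indicator D (z s)) else 0)"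
        by (intro sum.cong) auto
      also have "\<dots> = pmf \<pi> (z 0) * (\<Prod>i<s. pmf (Q (z i)) (z (Suc i))) * indicator D (z s)"
        using z fin by (subst sum.delta') (auto simp: PiE_iff)
      finally show "(\<Sum>x\<in>?R. pmf \<pi> x * ((if z 0 = x then 1 else 0) * (\<Prod>i<s. pmf (Q (z i)) (z (Suc i))) * indicator D (z s)))
        = pmf \<pi> (z 0) * (\<Prod>i<s. pmf (Q (z i)) (z (Suc i))) * indicator D (z s)" .
    qed
    also have "\<dots> \<le> (\<Sum>s<T. \<Sum>y\<in>?R. pmf \<pi> y * indicator D y)"
      by (intro sum_mono reversible_flow_le[OF S(1) _ rev]) auto
    also have "\<dots> = real T * (\<Sum>x\<in>?R \<inter> D. pmf \<pi> x)"
      using fin by (simp add: indicator_def if_distrib sum.inter_restrict cong: if_cong)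
    finally show "(\<Sum>x\<in>?R. pmf \<pi> x * ?f x) \<le> real T * (\<Sum>x\<in>?R \<inter> D. pmf \<pi> x)" .
  qed auto
  finally show ?thesis by simp
qed

section \<open>Gaussian moment generating functions\<close>

text \<open>Completing the square: multiplying the density by exp(c x) moves the mean to
  \<open>c * \<sigma>\<^sup>2\<close> and leaves a constant factor.\<close>

lemma nn_integral_exp_normal:
  assumes "\<sigma> > 0"
  shows "(\<integral>\<^sup>+x. ennreal (exp (c * x)) \<partial>density lborel (normal_density 0 \<sigma>)) = ennreal (exp (c\<^sup>2 * \<sigma>\<^sup>2 / 2))"
proof -
  have "(\<integral>\<^sup>+x. ennreal (exp (c * x)) \<partial>density lborel (normal_density 0 \<sigma>)) =
      (\<integral>\<^sup>+x. ennreal (normal_density 0 \<sigma> x) * ennreal (exp (c * x)) \<partial>lborel)"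
    by (subst nn_integral_density) auto
  also have "\<dots> = (\<integral>\<^sup>+x. ennreal (exp (c\<^sup>2 * \<sigma>\<^sup>2 / 2)) * ennreal (normal_density (c * \<sigma>\<^sup>2) \<sigma> x) \<partial>lborel)"
  proof (intro nn_integral_cong)
    fix x
    have "- (x - 0)\<^sup>2 / (2 * \<sigma>\<^sup>2) + c * x = c\<^sup>2 * \<sigma>\<^sup>2 / 2 + - (x - c * \<sigma>\<^sup>2)\<^sup>2 / (2 * \<sigma>\<^sup>2)"
      using assms by (simp add: field_simps power2_eq_square)
    then have "exp (- (x - 0)\<^sup>2 / (2 * \<sigma>\<^sup>2)) * exp (c * x) = exp (c\<^sup>2 * \<sigma>\<^sup>2 / 2) * exp (- (x - c * \<sigma>\<^sup>2)\<^sup>2 / (2 * \<sigma>\<^sup>2))"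
      by (simp add: exp_add[symmetric])
    then have "normal_density 0 \<sigma> x * exp (c * x) = exp (c\<^sup>2 * \<sigma>\<^sup>2 / 2) * normal_density (c * \<sigma>\<^sup>2) \<sigma> x"
      unfolding normal_density_def by (simp add: mult_ac)
    then show "ennreal (normal_density 0 \<sigma> x) * ennreal (exp (c * x)) =
        ennreal (exp (c\<^sup>2 * \<sigma>\<^sup>2 / 2)) * ennreal (normal_density (c * \<sigma>\<^sup>2) \<sigma> x)"
      by (simp add: ennreal_mult[symmetric])
  qed
  also have "\<dots> = ennreal (exp (c\<^sup>2 * \<sigma>\<^sup>2 / 2))"
    using emeasure_density[of "normal_density (c * \<sigma>\<^sup>2) \<sigma>" lborel UNIV]
      prob_space.emeasure_space_1[OF prob_space_normal_density[OF assms, of "c * \<sigma>\<^sup>2"]]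
    by (simp add: nn_integral_cmult)
  finally show ?thesis .
qed

definition upper_pairs :: "nat \<Rightarrow> (nat \<times> nat) set" where
  "upper_pairs N = {(i, j). i \<le> j \<and> j < N}"

definition entry_sd :: "nat \<Rightarrow> nat \<times> nat \<Rightarrow> real" where
  "entry_sd N = (\<lambda>(i, j). sqrt ((if i = j then 2 else 1) / real N))"

text \<open>Folds the coefficients of a full double sum onto the independent entries: an
  off-diagonal entry of a symmetric matrix is met twice, a diagonal one once.\<close>

definition upper_coeff :: "(nat \<Rightarrow> nat \<Rightarrow> real) \<Rightarrow> nat \<times> nat \<Rightarrow> real" where
  "upper_coeff C = (\<lambda>(i, j). if i = j then C i j else C i j + C j i)"

lemma finite_upper_pairs [simp]: "finite (upper_pairs N)"
  by (rule finite_subset[of _ "{..<N} \<times> {..<N}"]) (auto simp: upper_pairs_def)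

lemma entry_sd_pos: "e \<in> upper_pairs N \<Longrightarrow> entry_sd N e > 0"
  by (auto simp: upper_pairs_def entry_sd_def split: prod.splits)

lemma sum_square_eq_upper:
  fixes f :: "nat \<Rightarrow> nat \<Rightarrow> real"
  shows "(\<Sum>i<N. \<Sum>j<N. f i j) = (\<Sum>e\<in>upper_pairs N. upper_coeff f e)"
proof -
  let ?L = "{(i, j). j < i \<and> i < N}" and ?D = "{(i, j). i < j \<and> j < (N::nat)}" and ?E = "{(i, j). i = j \<and> i < N}"
  have fin: "finite ?L" "finite ?D" "finite ?E"
    by (rule finite_subset[of _ "{..<N} \<times> {..<N}"]; auto)+
  have eq: "{..<N} \<times> {..<N} = ?E \<union> (?D \<union> ?L)" "upper_pairs N = ?E \<union> ?D"
    by (auto simp: upper_pairs_def)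
  have swap: "(\<Sum>(i, j)\<in>?L. f i j) = (\<Sum>(i, j)\<in>?D. f j i)"
    by (rule sum.reindex_bij_witness[of _ "\<lambda>(i, j). (j, i)" "\<lambda>(i, j). (j, i)"]) auto
  have "(\<Sum>i<N. \<Sum>j<N. f i j) = (\<Sum>(i, j)\<in>{..<N} \<times> {..<N}. f i j)"
    by (rule sum.cartesian_product)
  also have "\<dots> = (\<Sum>(i, j)\<in>?E. f i j) + ((\<Sum>(i, j)\<in>?D. f i j) + (\<Sum>(i, j)\<in>?L. f i j))"
    unfolding eq by (subst sum.union_disjoint; use fin in auto)+
  also have "\<dots> = (\<Sum>e\<in>?E. upper_coeff f e) + (\<Sum>e\<in>?D. upper_coeff f e)"
    unfolding swap sum.distrib[symmetric]
    by (intro arg_cong2[where f="(+)"] sum.cong) (auto simp: upper_coeff_def)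
  also have "\<dots> = (\<Sum>e\<in>upper_pairs N. upper_coeff f e)"
    unfolding eq by (subst sum.union_disjoint) (use fin in auto)
  finally show ?thesis .
qed

context
  fixes N :: nat and M :: "'w measure" and W
  assumes W: "gaussian_symmetric_matrix N M W"
begin

lemma gaussian_prob_space: "prob_space M"
  using W by (simp add: gaussian_symmetric_matrix_def)

lemma gaussian_indep: "prob_space.indep_vars M (\<lambda>_. borel) (\<lambda>e \<omega>. W \<omega> (fst e) (snd e)) (upper_pairs N)"
  using W by (simp add: gaussian_symmetric_matrix_def upper_pairs_def case_prod_beta')

lemma gaussian_distributed:
  "e \<in> upper_pairs N \<Longrightarrow> distributed M lborel (\<lambda>\<omega>. W \<omega> (fst e) (snd e)) (normal_density 0 (entry_sd N e))"
proof -
  assume "e \<in> upper_pairs N"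
  then obtain i j where e: "e = (i, j)" "i \<le> j \<and> j < N" by (auto simp: upper_pairs_def)
  show ?thesis
    using W[unfolded gaussian_symmetric_matrix_def] e(2) unfolding e(1) entry_sd_def fst_conv snd_conv prod.case
    by blast
qed

lemma gaussian_sym: "\<omega> \<in> space M \<Longrightarrow> i < N \<Longrightarrow> j < N \<Longrightarrow> W \<omega> i j = W \<omega> j i"
  using W by (auto simp: gaussian_symmetric_matrix_def)

lemma gaussian_sum_eq_upper:
  assumes "\<omega> \<in> space M"
  shows "(\<Sum>i<N. \<Sum>j<N. C i j * W \<omega> i j) = (\<Sum>e\<in>upper_pairs N. upper_coeff C e * W \<omega> (fst e) (snd e))"
  unfolding sum_square_eq_upper
proof (intro sum.cong refl)
  fix e assume "e \<in> upper_pairs N"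
  then obtain i j where e: "e = (i, j)" "i \<le> j" "j < N" by (auto simp: upper_pairs_def)
  then show "upper_coeff (\<lambda>i j. C i j * W \<omega> i j) e = upper_coeff C e * W \<omega> (fst e) (snd e)"
    using gaussian_sym[OF assms, of j i] by (simp add: upper_coeff_def algebra_simps)
qed

text \<open>The diagonal variance 2/N compensates exactly for diagonal entries being met only once:
  for symmetric coefficients the variance is 2/N times the squared Frobenius norm. In general (a +
  b)^2 \<le> 2 (a^2 + b^2) gives the inequality that suffices for tail bounds.\<close>

lemma upper_coeff_variance:
  "(\<Sum>e\<in>upper_pairs N. (upper_coeff C e * entry_sd N e)\<^sup>2) \<le> 2 * (\<Sum>i<N. \<Sum>j<N. (C i j)\<^sup>2) / real N"
  "(\<And>i j. C i j = C j i) \<Longrightarrow>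
    (\<Sum>e\<in>upper_pairs N. (upper_coeff C e * entry_sd N e)\<^sup>2) = 2 * (\<Sum>i<N. \<Sum>j<N. (C i j)\<^sup>2) / real N"
proof -
  have R: "2 * (\<Sum>i<N. \<Sum>j<N. (C i j)\<^sup>2) / real N = (\<Sum>e\<in>upper_pairs N. 2 * upper_coeff (\<lambda>i j. (C i j)\<^sup>2) e / real N)"
    unfolding sum_square_eq_upper by (simp add: sum_distrib_left sum_divide_distrib)
  have sd: "(upper_coeff C e * entry_sd N e)\<^sup>2 = (case e of (i, j) \<Rightarrow> (if i = j then 2 * (C i j)\<^sup>2 else (C i j + C j i)\<^sup>2) / real N)" for e
    by (auto simp: upper_coeff_def entry_sd_def power_mult_distrib split: prod.splits)
  have "(a + b)\<^sup>2 \<le> 2 * (a\<^sup>2 + b\<^sup>2)" for a b :: real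
    using sum_squares_ge_zero[of "a - b" 0] by (simp add: power2_eq_square algebra_simps)
  then show "(\<Sum>e\<in>upper_pairs N. (upper_coeff C e * entry_sd N e)\<^sup>2) \<le> 2 * (\<Sum>i<N. \<Sum>j<N. (C i j)\<^sup>2) / real N"
    unfolding R sd by (intro sum_mono) (auto simp: upper_coeff_def intro!: divide_right_mono split: prod.splits)
  show "(\<Sum>e\<in>upper_pairs N. (upper_coeff C e * entry_sd N e)\<^sup>2) = 2 * (\<Sum>i<N. \<Sum>j<N. (C i j)\<^sup>2) / real N"
    if "\<And>i j. C i j = C j i"
    unfolding R sd
  proof (intro sum.cong refl)
    fix e show "(case e of (i, j) \<Rightarrow> (if i = j then 2 * (C i j)\<^sup>2 else (C i j + C j i)\<^sup>2) / real N) =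
      2 * upper_coeff (\<lambda>i j. (C i j)\<^sup>2) e / real N"
      using that[of "snd e" "fst e"] by (cases e) (auto simp: upper_coeff_def power2_eq_square algebra_simps)
  qed
qed

lemma measurable_gaussian_sum [measurable]:
  "(\<lambda>\<omega>. \<Sum>i<N. \<Sum>j<N. C i j * W \<omega> i j) \<in> borel_measurable M"
proof -
  have "(\<lambda>\<omega>. \<Sum>e\<in>upper_pairs N. upper_coeff C e * W \<omega> (fst e) (snd e)) \<in> borel_measurable M"
    using distributed_measurable[OF gaussian_distributed]
    by (intro borel_measurable_sum borel_measurable_times) auto
  then show ?thesis by (subst measurable_cong[OF gaussian_sum_eq_upper])
qed

lemma nn_integral_exp_gaussian_sum:
  "(\<integral>\<^sup>+\<omega>. ennreal (exp (\<Sum>i<N. \<Sum>j<N. C i j * W \<omega> i j)) \<partial>M) =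
    ennreal (exp ((\<Sum>e\<in>upper_pairs N. (upper_coeff C e * entry_sd N e)\<^sup>2) / 2))"
proof -
  interpret prob_space M by (rule gaussian_prob_space)
  let ?J = "upper_pairs N" and ?w = "\<lambda>e \<omega>. W \<omega> (fst e) (snd e)"
  have "(\<integral>\<^sup>+\<omega>. ennreal (exp (\<Sum>i<N. \<Sum>j<N. C i j * W \<omega> i j)) \<partial>M) =
      (\<integral>\<^sup>+\<omega>. (\<Prod>e\<in>?J. ennreal (exp (upper_coeff C e * ?w e \<omega>))) \<partial>M)"
    by (intro nn_integral_cong) (simp add: gaussian_sum_eq_upper exp_sum prod_ennreal)
  also have "\<dots> = (\<Prod>e\<in>?J. \<integral>\<^sup>+\<omega>. ennreal (exp (upper_coeff C e * ?w e \<omega>)) \<partial>M)"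
    by (intro indep_vars_nn_integral indep_vars_compose2[OF gaussian_indep]) auto
  also have "\<dots> = (\<Prod>e\<in>?J. ennreal (exp ((upper_coeff C e * entry_sd N e)\<^sup>2 / 2)))"
  proof (intro prod.cong refl)
    fix e assume e: "e \<in> ?J"
    have "(\<integral>\<^sup>+\<omega>. ennreal (exp (upper_coeff C e * ?w e \<omega>)) \<partial>M) =
        (\<integral>\<^sup>+x. ennreal (exp (upper_coeff C e * x)) \<partial>distr M lborel (?w e))"
      using distributed_measurable[OF gaussian_distributed[OF e]] by (subst nn_integral_distr) auto
    also have "\<dots> = ennreal (exp ((upper_coeff C e * entry_sd N e)\<^sup>2 / 2))"
      unfolding distributed_distr_eq_density[OF gaussian_distributed[OF e]]
      using nn_integral_exp_normal[OF entry_sd_pos[OF e]] by (simp add: power_mult_distrib)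
    finally show "(\<integral>\<^sup>+\<omega>. ennreal (exp (upper_coeff C e * ?w e \<omega>)) \<partial>M) = \<dots>" .
  qed
  also have "\<dots> = ennreal (exp ((\<Sum>e\<in>?J. (upper_coeff C e * entry_sd N e)\<^sup>2) / 2))"
    by (simp add: prod_ennreal exp_sum sum_divide_distrib)
  finally show ?thesis .
qed

lemma integrable_exp_gaussian_sum:
  "integrable M (\<lambda>\<omega>. exp (\<Sum>i<N. \<Sum>j<N. C i j * W \<omega> i j))"
  by (intro integrableI_nonneg) (auto simp: nn_integral_exp_gaussian_sum)

lemma expectation_exp_gaussian_sum_le:
  "(\<integral>\<omega>. exp (\<Sum>i<N. \<Sum>j<N. C i j * W \<omega> i j) \<partial>M) \<le> exp ((\<Sum>i<N. \<Sum>j<N. (C i j)\<^sup>2) / real N)"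
  using upper_coeff_variance(1)[of C]
  by (subst integral_eq_nn_integral) (auto simp: nn_integral_exp_gaussian_sum mult.commute)

lemma expectation_exp_gaussian_sum:
  assumes "\<And>i j. C i j = C j i"
  shows "(\<integral>\<omega>. exp (\<Sum>i<N. \<Sum>j<N. C i j * W \<omega> i j) \<partial>M) = exp ((\<Sum>i<N. \<Sum>j<N. (C i j)\<^sup>2) / real N)"
  using upper_coeff_variance(2)[of C, OF assms]
  by (subst integral_eq_nn_integral) (auto simp: nn_integral_exp_gaussian_sum)

lemma gaussian_sum_tail:
  assumes "(\<Sum>i<N. \<Sum>j<N. (C i j)\<^sup>2) \<le> V" "V > 0" "t \<ge> 0" "N > 0"
  shows "measure M {\<omega>\<in>space M. (\<Sum>i<N. \<Sum>j<N. C i j * W \<omega> i j) \<ge> t} \<le> exp (- t\<^sup>2 * real N / (4 * V))"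
proof -
  interpret prob_space M by (rule gaussian_prob_space)
  \<comment> \<open>Minimiser of the Chernoff exponent
    \<open>m\<^sup>2 * V / real N - m * t\<close>.\<close>
  define m where "m = t * real N / (2 * V)"
  have m: "m \<ge> 0" using assms by (simp add: m_def)
  let ?X = "\<lambda>\<omega>. \<Sum>i<N. \<Sum>j<N. C i j * W \<omega> i j"
  have X: "m * ?X \<omega> = (\<Sum>i<N. \<Sum>j<N. (m * C i j) * W \<omega> i j)" for \<omega>
    by (simp add: sum_distrib_left mult_ac)
  have "measure M {\<omega>\<in>space M. ?X \<omega> \<ge> t} \<le> measure M {\<omega>\<in>space M. exp (m * ?X \<omega>) \<ge> exp (m * t)}"
    using m by (intro finite_measure_mono) (auto intro: mult_left_mono)
  also have "\<dots> \<le> expectation (\<lambda>\<omega>. exp (m * ?X \<omega>)) / exp (m * t)"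
    unfolding X by (intro integral_Markov_inequality_measure[where A="{}", THEN order.trans] integrable_exp_gaussian_sum) auto
  also have "\<dots> \<le> exp ((\<Sum>i<N. \<Sum>j<N. (m * C i j)\<^sup>2) / real N) / exp (m * t)"
    unfolding X by (intro divide_right_mono expectation_exp_gaussian_sum_le) auto
  also have "\<dots> = exp (m\<^sup>2 * (\<Sum>i<N. \<Sum>j<N. (C i j)\<^sup>2) / real N - m * t)"
    by (simp add: exp_diff power_mult_distrib sum_distrib_left)
  also have "\<dots> \<le> exp (m\<^sup>2 * V / real N - m * t)"
    using assms by (auto intro!: divide_right_mono mult_left_mono)
  also have "m\<^sup>2 * V / real N - m * t = - t\<^sup>2 * real N / (4 * V)"
    using assms by (simp add: m_def field_simps power2_eq_square)
  finally show ?thesis .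
qed

end

section \<open>Gaussian concentration of maxima of linear forms\<close>

text \<open>Fubini, and translation invariance of Lebesgue measure on each line.\<close>

lemma nn_integral_shear:
  assumes [measurable]: "f \<in> borel_measurable (borel \<Otimes>\<^sub>M borel)"
  shows "(\<integral>\<^sup>+p. f (fst p + a * snd p, snd p) \<partial>(lborel \<Otimes>\<^sub>M lborel)) =
      (\<integral>\<^sup>+p. f p \<partial>((lborel :: real measure) \<Otimes>\<^sub>M (lborel :: real measure)))"
    and "(\<integral>\<^sup>+p. f (fst p, snd p + a * fst p) \<partial>(lborel \<Otimes>\<^sub>M lborel)) =
      (\<integral>\<^sup>+p. f p \<partial>((lborel :: real measure) \<Otimes>\<^sub>M (lborel :: real measure)))"
proof -
  have "(\<integral>\<^sup>+p. f (fst p + a * snd p, snd p) \<partial>(lborel \<Otimes>\<^sub>M lborel)) =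
      (\<integral>\<^sup>+y. \<integral>\<^sup>+x. f (x + a * y, y) \<partial>lborel \<partial>lborel)"
    using lborel_pair.nn_integral_snd[of "\<lambda>p. f (fst p + a * snd p, snd p)"] by simp
  also have "\<dots> = (\<integral>\<^sup>+y. \<integral>\<^sup>+x. f (x, y) \<partial>lborel \<partial>lborel)"
  proof (rule nn_integral_cong)
    fix y :: real
    show "(\<integral>\<^sup>+x. f (x + a * y, y) \<partial>lborel) = (\<integral>\<^sup>+x. f (x, y) \<partial>lborel)"
      using nn_integral_real_affine[of "\<lambda>x. f (x, y)" 1 "a * y"] by (simp add: add.commute)
  qed
  also have "\<dots> = (\<integral>\<^sup>+p. f p \<partial>(lborel \<Otimes>\<^sub>M lborel))"
    by (rule lborel_pair.nn_integral_snd) auto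
  finally show "(\<integral>\<^sup>+p. f (fst p + a * snd p, snd p) \<partial>(lborel \<Otimes>\<^sub>M lborel)) = \<dots>" .
  have "(\<integral>\<^sup>+p. f (fst p, snd p + a * fst p) \<partial>(lborel \<Otimes>\<^sub>M lborel)) =
      (\<integral>\<^sup>+x. \<integral>\<^sup>+y. f (x, y + a * x) \<partial>lborel \<partial>lborel)"
    using lborel.nn_integral_fst[of "\<lambda>p. f (fst p, snd p + a * fst p)" lborel] by simp
  also have "\<dots> = (\<integral>\<^sup>+x. \<integral>\<^sup>+y. f (x, y) \<partial>lborel \<partial>lborel)"
  proof (rule nn_integral_cong)
    fix x :: real
    show "(\<integral>\<^sup>+y. f (x, y + a * x) \<partial>lborel) = (\<integral>\<^sup>+y. f (x, y) \<partial>lborel)"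
      using nn_integral_real_affine[of "\<lambda>y. f (x, y)" 1 "a * x"] by (simp add: add.commute)
  qed
  also have "\<dots> = (\<integral>\<^sup>+p. f p \<partial>(lborel \<Otimes>\<^sub>M lborel))"
    by (rule lborel.nn_integral_fst) auto
  finally show "(\<integral>\<^sup>+p. f (fst p, snd p + a * fst p) \<partial>(lborel \<Otimes>\<^sub>M lborel)) = \<dots>" .
qed

definition rot :: "real \<Rightarrow> real \<times> real \<Rightarrow> real \<times> real" where
  "rot t p = (cos t * fst p + sin t * snd p, - sin t * fst p + cos t * snd p)"

lemma measurable_rot [measurable]: "rot t \<in> measurable (borel \<Otimes>\<^sub>M borel) (borel \<Otimes>\<^sub>M borel)"
  unfolding rot_def[abs_def] by measurable

text \<open>A rotation is a product of three shears.\<close>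

lemma nn_integral_rot:
  assumes [measurable]: "f \<in> borel_measurable (borel \<Otimes>\<^sub>M borel)" and t: "1 + cos t \<noteq> 0"
  shows "(\<integral>\<^sup>+p. f (rot t p) \<partial>(lborel \<Otimes>\<^sub>M lborel)) = (\<integral>\<^sup>+p. f p \<partial>(lborel \<Otimes>\<^sub>M lborel))"
proof -
  \<comment> \<open>This is tan(t/2): the rotation is a horizontal shear by \<open>a\<close>, a
    vertical one by \<open>- sin t\<close>, and a horizontal one by \<open>a\<close> again. The
    condition on \<open>cos t\<close> keeps the half-angle tangent finite.\<close>
  define a where "a = sin t / (1 + cos t)"
  have "(sin t)\<^sup>2 = (1 - cos t) * (1 + cos t)"
    by (simp add: sin_squared_eq power2_eq_square algebra_simps)
  then have a: "a * sin t = 1 - cos t" "a * (1 + cos t) = sin t"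
    using t by (simp_all add: a_def power2_eq_square)
  define g where "g p = f (fst p + a * snd p, snd p)" for p
  define h where "h p = g (fst p, snd p + (- sin t) * fst p)" for p
  have [measurable]: "g \<in> borel_measurable (borel \<Otimes>\<^sub>M borel)" "h \<in> borel_measurable (borel \<Otimes>\<^sub>M borel)"
    unfolding g_def[abs_def] h_def[abs_def] by measurable
  have "f (rot t p) = h (fst p + a * snd p, snd p)" for p
  proof -
    obtain x y where p: "p = (x, y)" by (cases p)
    have 1: "y - sin t * (x + a * y) = - sin t * x + cos t * y"
      using arg_cong[OF a(1), of "\<lambda>z. z * y"] by (simp add: algebra_simps)
    have 2: "x + a * y + a * (- sin t * x + cos t * y) = cos t * x + sin t * y"
      using arg_cong[OF a(1), of "\<lambda>z. z * x"] arg_cong[OF a(2), of "\<lambda>z. z * y"]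
      by (simp add: algebra_simps)
    show ?thesis unfolding p rot_def h_def g_def using 1 2 by simp
  qed
  then have "(\<integral>\<^sup>+p. f (rot t p) \<partial>(lborel \<Otimes>\<^sub>M lborel)) = (\<integral>\<^sup>+p. h p \<partial>(lborel \<Otimes>\<^sub>M lborel))"
    using nn_integral_shear(1)[of h a] by simp
  also have "\<dots> = (\<integral>\<^sup>+p. g p \<partial>(lborel \<Otimes>\<^sub>M lborel))"
    unfolding h_def by (rule nn_integral_shear(2)) measurable
  also have "\<dots> = (\<integral>\<^sup>+p. f p \<partial>(lborel \<Otimes>\<^sub>M lborel))"
    unfolding g_def by (rule nn_integral_shear(1)) measurable
  finally show ?thesis .
qed

abbreviation gauss :: "real \<Rightarrow> real measure" where
  "gauss \<sigma> \<equiv> density lborel (normal_density 0 \<sigma>)"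

text \<open>The density of two independent Gaussians with the same deviation depends only on x^2 +
  y^2, so the invariance of Lebesgue measure carries over.\<close>

lemma nn_integral_gauss_rot:
  assumes f [measurable]: "f \<in> borel_measurable (borel \<Otimes>\<^sub>M borel)" and t: "1 + cos t \<noteq> 0" and s: "\<sigma> > 0"
  shows "(\<integral>\<^sup>+p. f (rot t p) \<partial>(gauss \<sigma> \<Otimes>\<^sub>M gauss \<sigma>)) = (\<integral>\<^sup>+p. f p \<partial>(gauss \<sigma> \<Otimes>\<^sub>M gauss \<sigma>))"
proof -
  let ?n = "normal_density 0 \<sigma>"
  define d where "d p = ennreal (?n (fst p) * ?n (snd p))" for p
  have [measurable]: "d \<in> borel_measurable (borel \<Otimes>\<^sub>M borel)" unfolding d_def[abs_def] by measurable
  have dens: "(\<integral>\<^sup>+p. g p \<partial>(gauss \<sigma> \<Otimes>\<^sub>M gauss \<sigma>)) = (\<integral>\<^sup>+p. d p * g p \<partial>(lborel \<Otimes>\<^sub>M lborel))"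
    if [measurable]: "g \<in> borel_measurable (borel \<Otimes>\<^sub>M borel)" for g
  proof -
    interpret prob_space "gauss \<sigma>" by (rule prob_space_normal_density[OF s])
    have "gauss \<sigma> \<Otimes>\<^sub>M gauss \<sigma> = density (lborel \<Otimes>\<^sub>M lborel) (\<lambda>(x, y). ennreal (?n x) * ennreal (?n y))"
      by (rule pair_measure_density) (auto simp: sigma_finite_measure_axioms lborel.sigma_finite_measure_axioms)
    then show ?thesis
      by (subst \<open>gauss \<sigma> \<Otimes>\<^sub>M gauss \<sigma> = _\<close>, subst nn_integral_density)
        (auto simp: d_def case_prod_beta' ennreal_mult)
  qed
  have inv: "d (rot t p) = d p" for p
  proof -
    obtain x y where p: "p = (x, y)" by (cases p)
    have "(cos t * x + sin t * y)\<^sup>2 + (- sin t * x + cos t * y)\<^sup>2 = ((sin t)\<^sup>2 + (cos t)\<^sup>2) * (x\<^sup>2 + y\<^sup>2)"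
      by algebra
    then have "(cos t * x + sin t * y)\<^sup>2 + (- sin t * x + cos t * y)\<^sup>2 = x\<^sup>2 + y\<^sup>2" by simp
    then have "- (cos t * x + sin t * y)\<^sup>2 / (2 * \<sigma>\<^sup>2) + - (- sin t * x + cos t * y)\<^sup>2 / (2 * \<sigma>\<^sup>2) =
        - x\<^sup>2 / (2 * \<sigma>\<^sup>2) + - y\<^sup>2 / (2 * \<sigma>\<^sup>2)"
      by (simp only: add_divide_distrib[symmetric] minus_add_distrib[symmetric])
    then show ?thesis unfolding p d_def rot_def normal_density_def
      by (simp add: mult_ac exp_add[symmetric])
  qed
  have "(\<integral>\<^sup>+p. f (rot t p) \<partial>(gauss \<sigma> \<Otimes>\<^sub>M gauss \<sigma>)) = (\<integral>\<^sup>+p. d (rot t p) * f (rot t p) \<partial>(lborel \<Otimes>\<^sub>M lborel))"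
    unfolding inv by (rule dens) measurable
  also have "\<dots> = (\<integral>\<^sup>+p. d p * f p \<partial>(lborel \<Otimes>\<^sub>M lborel))"
    by (rule nn_integral_rot[where f="\<lambda>p. d p * f p", OF _ t]) measurable
  finally show ?thesis using dens[OF f] by simp
qed


text \<open>Positivity of \<open>\<sigma>\<close> is demanded at every index, inside
  \<open>J\<close> or not, so that each factor is a probability measure, as the product space
  locales require.\<close>

locale gauss_family =
  fixes J :: "'e set" and \<sigma> :: "'e \<Rightarrow> real"
  assumes fin_J [simp]: "finite J" and \<sigma>_pos [simp]: "\<And>e. \<sigma> e > 0"
begin

definition "gauss_vec = PiM J (\<lambda>e. gauss (\<sigma> e))"

definition lin :: "('e \<Rightarrow> real) \<Rightarrow> ('e \<Rightarrow> real) \<Rightarrow> real" where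
  "lin c w = (\<Sum>e\<in>J. c e * w e)"

lemma prob_space_gauss_vec: "prob_space gauss_vec"
  unfolding gauss_vec_def by (intro prob_space_PiM prob_space_normal_density) simp

lemma space_gauss_vec: "space gauss_vec = extensional J"
  by (auto simp: gauss_vec_def space_PiM PiE_def)

lemma measurable_gauss_vec_component [measurable]:
  "e \<in> J \<Longrightarrow> (\<lambda>w. w e) \<in> borel_measurable gauss_vec"
  using measurable_component_singleton[of e J "\<lambda>e. gauss (\<sigma> e)"] by (simp add: gauss_vec_def)

lemma measurable_lin [measurable]: "lin c \<in> borel_measurable gauss_vec"
  unfolding lin_def[abs_def] by (intro borel_measurable_sum borel_measurable_times) auto

text \<open>A map of the plane that preserves each two-dimensional Gaussian, applied coordinatewise,
  preserves the law of a pair of independent vectors. It is checked on rectangles, where the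
  iterated integral over the two vectors factorises over \<open>J\<close>. The target groups the
  coordinates in pairs, so it is a product of planes instead of a pair of products.\<close>

lemma distr_gauss_vec_pairs:
  assumes r [measurable]: "r \<in> measurable (borel \<Otimes>\<^sub>M borel) (borel \<Otimes>\<^sub>M borel)"
    and inv: "\<And>e f. f \<in> borel_measurable (borel \<Otimes>\<^sub>M borel) \<Longrightarrow>
      (\<integral>\<^sup>+p. f (r p) \<partial>(gauss (\<sigma> e) \<Otimes>\<^sub>M gauss (\<sigma> e))) = (\<integral>\<^sup>+p. f p \<partial>(gauss (\<sigma> e) \<Otimes>\<^sub>M gauss (\<sigma> e)))"
  shows "distr (gauss_vec \<Otimes>\<^sub>M gauss_vec) (PiM J (\<lambda>e. gauss (\<sigma> e) \<Otimes>\<^sub>M gauss (\<sigma> e)))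
      (\<lambda>p. \<lambda>e\<in>J. r (fst p e, snd p e)) = PiM J (\<lambda>e. gauss (\<sigma> e) \<Otimes>\<^sub>M gauss (\<sigma> e))"
proof -
  interpret G: product_prob_space "\<lambda>e. gauss (\<sigma> e)" J
    by (intro product_prob_spaceI prob_space_normal_density) simp
  interpret V: prob_space gauss_vec by (rule prob_space_gauss_vec)
  interpret g: prob_space "gauss (\<sigma> e)" for e by (intro prob_space_normal_density) simp
  interpret gg: pair_prob_space "gauss (\<sigma> e)" "gauss (\<sigma> e)" for e ..
  interpret P: product_prob_space "\<lambda>e. gauss (\<sigma> e) \<Otimes>\<^sub>M gauss (\<sigma> e)" J ..
  let ?z = "\<lambda>p. \<lambda>e\<in>J. r (fst p e, snd p e)"
  have z [measurable]: "?z \<in> measurable (gauss_vec \<Otimes>\<^sub>M gauss_vec) (PiM J (\<lambda>e. gauss (\<sigma> e) \<Otimes>\<^sub>M gauss (\<sigma> e)))"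
  proof (intro measurable_restrict)
    fix e assume [measurable]: "e \<in> J"
    have "(\<lambda>p. r (fst p e, snd p e)) \<in> measurable (gauss_vec \<Otimes>\<^sub>M gauss_vec) (borel \<Otimes>\<^sub>M borel)"
      by measurable
    then show "(\<lambda>p. r (fst p e, snd p e)) \<in> measurable (gauss_vec \<Otimes>\<^sub>M gauss_vec) (gauss (\<sigma> e) \<Otimes>\<^sub>M gauss (\<sigma> e))"
      by (simp cong: measurable_cong_sets)
  qed
  show ?thesis
  proof (rule P.PiM_eqI)
    fix A assume A: "\<And>e. e \<in> J \<Longrightarrow> A e \<in> sets (gauss (\<sigma> e) \<Otimes>\<^sub>M gauss (\<sigma> e))"
    then have A' [measurable]: "e \<in> J \<Longrightarrow> A e \<in> sets (borel \<Otimes>\<^sub>M borel)" for e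
      by (simp cong: sets_pair_measure_cong)
    define g where "g e x = (\<integral>\<^sup>+y. indicator (A e) (r (x, y)) \<partial>gauss (\<sigma> e))" for e x
    have PiA: "PiE J A \<in> sets (PiM J (\<lambda>e. gauss (\<sigma> e) \<Otimes>\<^sub>M gauss (\<sigma> e)))"
      using A by (intro sets_PiM_I_finite) auto
    have "emeasure (distr (gauss_vec \<Otimes>\<^sub>M gauss_vec) (PiM J (\<lambda>e. gauss (\<sigma> e) \<Otimes>\<^sub>M gauss (\<sigma> e))) ?z) (PiE J A) =
        (\<integral>\<^sup>+p. indicator (PiE J A) (?z p) \<partial>(gauss_vec \<Otimes>\<^sub>M gauss_vec))"
      using PiA by (subst nn_integral_indicator[symmetric], simp, subst nn_integral_distr) auto
    also have "\<dots> = (\<integral>\<^sup>+p. (\<Prod>e\<in>J. indicator (A e) (r (fst p e, snd p e))) \<partial>(gauss_vec \<Otimes>\<^sub>M gauss_vec))"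
      by (intro nn_integral_cong) (auto simp: indicator_def PiE_iff)
    also have "\<dots> = (\<integral>\<^sup>+w. \<integral>\<^sup>+w'. (\<Prod>e\<in>J. indicator (A e) (r (w e, w' e))) \<partial>gauss_vec \<partial>gauss_vec)"
      by (subst V.nn_integral_fst[symmetric]) (auto intro!: borel_measurable_prod_ennreal)
    also have "\<dots> = (\<integral>\<^sup>+w. (\<Prod>e\<in>J. g e (w e)) \<partial>gauss_vec)"
      unfolding gauss_vec_def g_def by (intro nn_integral_cong G.product_nn_integral_prod) auto
    also have "\<dots> = (\<Prod>e\<in>J. \<integral>\<^sup>+x. g e x \<partial>gauss (\<sigma> e))"
      unfolding gauss_vec_def
    proof (intro G.product_nn_integral_prod)
      fix e assume [measurable]: "e \<in> J"
      show "g e \<in> borel_measurable (gauss (\<sigma> e))"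
        unfolding g_def[abs_def] by measurable
    qed simp
    also have "\<dots> = (\<Prod>e\<in>J. emeasure (gauss (\<sigma> e) \<Otimes>\<^sub>M gauss (\<sigma> e)) (A e))"
    proof (intro prod.cong refl)
      fix e assume e [measurable]: "e \<in> J"
      have "(\<integral>\<^sup>+x. g e x \<partial>gauss (\<sigma> e)) = (\<integral>\<^sup>+p. indicator (A e) (r p) \<partial>(gauss (\<sigma> e) \<Otimes>\<^sub>M gauss (\<sigma> e)))"
        unfolding g_def
        by (subst sigma_finite_measure.nn_integral_fst[OF prob_space_imp_sigma_finite[OF prob_space_normal_density[OF \<sigma>_pos]], symmetric]) auto
      also have "\<dots> = (\<integral>\<^sup>+p. indicator (A e) p \<partial>(gauss (\<sigma> e) \<Otimes>\<^sub>M gauss (\<sigma> e)))"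
        by (rule inv) measurable
      finally show "(\<integral>\<^sup>+x. g e x \<partial>gauss (\<sigma> e)) = emeasure (gauss (\<sigma> e) \<Otimes>\<^sub>M gauss (\<sigma> e)) (A e)"
        using A[OF e] by simp
    qed
    finally show "emeasure (distr (gauss_vec \<Otimes>\<^sub>M gauss_vec) (PiM J (\<lambda>e. gauss (\<sigma> e) \<Otimes>\<^sub>M gauss (\<sigma> e))) ?z) (PiE J A) = \<dots>" .
  qed simp_all
qed

definition "rotX t p = (\<lambda>e\<in>J. cos t * fst p e + sin t * snd p e)"
definition "rotY t p = (\<lambda>e\<in>J. - sin t * fst p e + cos t * snd p e)"

lemma measurable_rotXY [measurable]:
  "rotX t \<in> measurable (gauss_vec \<Otimes>\<^sub>M gauss_vec) gauss_vec"
  "rotY t \<in> measurable (gauss_vec \<Otimes>\<^sub>M gauss_vec) gauss_vec"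
proof -
  have *: "h \<in> measurable A gauss_vec \<longleftrightarrow> h \<in> measurable A (PiM J (\<lambda>_. borel))" for h A
    unfolding gauss_vec_def by (intro iffI; simp cong: measurable_cong_sets sets_PiM_cong)
  show "rotX t \<in> measurable (gauss_vec \<Otimes>\<^sub>M gauss_vec) gauss_vec"
    "rotY t \<in> measurable (gauss_vec \<Otimes>\<^sub>M gauss_vec) gauss_vec"
    unfolding * rotX_def[abs_def] rotY_def[abs_def] by (intro measurable_restrict; measurable)+
qed

text \<open>Angles \<open>t\<close> and 0 push the pair of vectors to the same product of planes.
  Unpairing with \<open>u\<close> turns the first into the rotated pair and the second into the
  original pair, so angle 0 also supplies the identification of the two product spaces.\<close>

lemma nn_integral_gauss_vec_rot:
  assumes f [measurable]: "f \<in> borel_measurable (gauss_vec \<Otimes>\<^sub>M gauss_vec)" and t: "1 + cos t \<noteq> 0"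
  shows "(\<integral>\<^sup>+p. f (rotX t p, rotY t p) \<partial>(gauss_vec \<Otimes>\<^sub>M gauss_vec)) =
    (\<integral>\<^sup>+p. f p \<partial>(gauss_vec \<Otimes>\<^sub>M gauss_vec))"
proof -
  let ?GG = "gauss_vec \<Otimes>\<^sub>M gauss_vec"
  let ?P = "PiM J (\<lambda>e. gauss (\<sigma> e) \<Otimes>\<^sub>M gauss (\<sigma> e))"
  define z where "z t p = (\<lambda>e\<in>J. rot t (fst p e, snd p e))" for t and p :: "('e \<Rightarrow> real) \<times> ('e \<Rightarrow> real)"
  define u where "u q = (\<lambda>e\<in>J. fst (q e), \<lambda>e\<in>J. snd (q e))" for q :: "'e \<Rightarrow> real \<times> real"
  have fin: "finite J" by simp
  have d: "distr ?GG ?P (z t) = ?P" "distr ?GG ?P (z 0) = ?P"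
    unfolding z_def using t by (intro distr_gauss_vec_pairs nn_integral_gauss_rot; simp)+
  have zm [measurable]: "z t \<in> measurable ?GG ?P" for t
    unfolding z_def[abs_def]
  proof (intro measurable_restrict)
    fix e assume [measurable]: "e \<in> J"
    have "(\<lambda>p. rot t (fst p e, snd p e)) \<in> measurable ?GG (borel \<Otimes>\<^sub>M borel)"
      by measurable
    then show "(\<lambda>p. rot t (fst p e, snd p e)) \<in> measurable ?GG (gauss (\<sigma> e) \<Otimes>\<^sub>M gauss (\<sigma> e))"
      by (simp cong: measurable_cong_sets)
  qed
  have um [measurable]: "u \<in> measurable ?P ?GG"
    unfolding u_def[abs_def] gauss_vec_def
  proof (intro measurable_Pair measurable_restrict)
    fix e assume "e \<in> J"
    then have comp: "(\<lambda>q. q e) \<in> measurable ?P (gauss (\<sigma> e) \<Otimes>\<^sub>M gauss (\<sigma> e))"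
      by (rule measurable_component_singleton)
    show "(\<lambda>q. fst (q e)) \<in> measurable ?P (gauss (\<sigma> e))" "(\<lambda>q. snd (q e)) \<in> measurable ?P (gauss (\<sigma> e))"
      using measurable_compose[OF comp measurable_fst] measurable_compose[OF comp measurable_snd] by simp_all
  qed
  have uz: "u (z t p) = (rotX t p, rotY t p)" for t p
    by (auto simp: u_def z_def rot_def rotX_def rotY_def)
  have u0: "u (z 0 p) = p" if "p \<in> space ?GG" for p
    using that unfolding uz rotX_def rotY_def space_pair_measure space_gauss_vec
    by (cases p) (auto simp: extensional_restrict)
  have "(\<integral>\<^sup>+p. f (rotX t p, rotY t p) \<partial>?GG) = (\<integral>\<^sup>+q. f (u q) \<partial>distr ?GG ?P (z t))"
    by (subst nn_integral_distr) (auto simp: uz)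
  also have "\<dots> = (\<integral>\<^sup>+q. f (u q) \<partial>distr ?GG ?P (z 0))" unfolding d ..
  also have "\<dots> = (\<integral>\<^sup>+p. f (u (z 0 p)) \<partial>?GG)"
    by (subst nn_integral_distr) auto
  also have "\<dots> = (\<integral>\<^sup>+p. f p \<partial>?GG)"
    by (intro nn_integral_cong) (simp add: u0)
  finally show ?thesis .
qed

lemma nn_integral_exp_lin:
  "(\<integral>\<^sup>+w. ennreal (exp (c * lin a w)) \<partial>gauss_vec) = ennreal (exp (c\<^sup>2 * (\<Sum>e\<in>J. (a e * \<sigma> e)\<^sup>2) / 2))"
proof -
  interpret G: product_prob_space "\<lambda>e. gauss (\<sigma> e)" J
    by (intro product_prob_spaceI prob_space_normal_density) simp
  have "(\<integral>\<^sup>+w. ennreal (exp (c * lin a w)) \<partial>gauss_vec) =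
      (\<integral>\<^sup>+w. (\<Prod>e\<in>J. ennreal (exp (c * a e * w e))) \<partial>gauss_vec)"
    by (intro nn_integral_cong) (simp add: lin_def sum_distrib_left exp_sum prod_ennreal mult.assoc)
  also have "\<dots> = (\<Prod>e\<in>J. \<integral>\<^sup>+x. ennreal (exp (c * a e * x)) \<partial>gauss (\<sigma> e))"
    unfolding gauss_vec_def by (rule G.product_nn_integral_prod) auto
  also have "\<dots> = ennreal (exp (c\<^sup>2 * (\<Sum>e\<in>J. (a e * \<sigma> e)\<^sup>2) / 2))"
    unfolding nn_integral_exp_normal[OF \<sigma>_pos]
    by (simp add: prod_ennreal exp_sum[symmetric] power_mult_distrib
        sum_distrib_left sum_divide_distrib mult.assoc)
  finally show ?thesis .
qed



end

section \<open>Concentration of the maximum by interpolation along a rotation\<close>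

context gauss_family
begin

definition lin_max :: "(nat \<Rightarrow> 'e \<Rightarrow> real) \<Rightarrow> nat \<Rightarrow> ('e \<Rightarrow> real) \<Rightarrow> real" where
  "lin_max a m w = Max ((\<lambda>x. lin (a x) w) ` {..<m})"

text \<open>Taking the least maximiser makes the choice a measurable map into a countable space, so
  that it can be substituted into the family of linear forms without losing measurability.\<close>

definition lin_argmax :: "(nat \<Rightarrow> 'e \<Rightarrow> real) \<Rightarrow> nat \<Rightarrow> ('e \<Rightarrow> real) \<Rightarrow> nat" where
  "lin_argmax a m w = (LEAST x. x < m \<and> lin (a x) w = lin_max a m w)"

lemma measurable_lin_max [measurable]: "lin_max a m \<in> borel_measurable gauss_vec"
  unfolding lin_max_def[abs_def] by (rule borel_measurable_Max[OF finite_lessThan measurable_lin])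

lemma measurable_lin_argmax [measurable]: "lin_argmax a m \<in> measurable gauss_vec (count_space UNIV)"
  unfolding lin_argmax_def[abs_def]
proof (rule measurable_Least)
  fix x
  have "{w \<in> space gauss_vec. lin (a x) w = lin_max a m w} \<in> sets gauss_vec"
    by (rule borel_measurable_eq[OF measurable_lin measurable_lin_max])
  then have [measurable]: "Measurable.pred gauss_vec (\<lambda>w. lin (a x) w = lin_max a m w)"
    by (simp add: pred_def)
  show "Measurable.pred gauss_vec (\<lambda>w. x < m \<and> lin (a x) w = lin_max a m w)"
    by measurable
qed

lemma lin_argmax:
  assumes "m > 0"
  shows "lin_argmax a m w < m" "lin (a (lin_argmax a m w)) w = lin_max a m w"
proof -
  have "lin_max a m w \<in> (\<lambda>x. lin (a x) w) ` {..<m}"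
    unfolding lin_max_def using assms by (intro Max_in) auto
  then have "\<exists>x. x < m \<and> lin (a x) w = lin_max a m w" by auto
  from LeastI_ex[OF this] show "lin_argmax a m w < m" "lin (a (lin_argmax a m w)) w = lin_max a m w"
    unfolding lin_argmax_def by auto
qed

lemma lin_max_ge: "x < m \<Longrightarrow> lin (a x) w \<le> lin_max a m w"
  unfolding lin_max_def by (intro Max_ge) auto

lemma lin_rotX_add:
  "lin c (rotX (t + s) p) = cos s * lin c (rotX t p) + sin s * lin c (rotY t p)"
proof -
  have "lin c (rotX (t + s) p) = (\<Sum>e\<in>J. cos s * (c e * rotX t p e) + sin s * (c e * rotY t p e))"
    unfolding lin_def by (intro sum.cong refl) (simp add: rotX_def rotY_def cos_add sin_add algebra_simps)
  then show ?thesis by (simp add: lin_def sum.distrib sum_distrib_left)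
qed

text \<open>A discrete form of the Maurey--Pisier argument: interpolate between two independent copies
  along a rotation in \<open>k\<close> steps.  In each step the maximum decreases by at most the decrease of the
  currently maximal linear form, whose coefficients are independent of the direction of the step.\<close>

lemma lin_max_rot_step:
  assumes "m > 0"
  shows "lin_max a m (rotX t p) - lin_max a m (rotX (t + s) p) \<le>
    (1 - cos s) * lin_max a m (rotX t p) - sin s * lin (a (lin_argmax a m (rotX t p))) (rotY t p)"
proof -
  let ?x = "lin_argmax a m (rotX t p)"
  have "lin (a ?x) (rotX (t + s) p) \<le> lin_max a m (rotX (t + s) p)"
    by (intro lin_max_ge lin_argmax assms)
  then show ?thesis unfolding lin_rotX_add lin_argmax(2)[OF assms] by (simp add: algebra_simps)
qed

text \<open>Convexity in place of independence: the steps of the interpolation are dependent, so the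
  exponential of their sum is bounded by an average of exponentials of \<open>k\<close> times a
  single step. A step has angle of order 1/k, which pays for the factor \<open>k\<close>.\<close>

lemma exp_sum_le:
  fixes t :: "nat \<Rightarrow> real"
  assumes "k > 0"
  shows "exp (\<Sum>i<k. t i) \<le> (\<Sum>i<k. exp (real k * t i)) / real k"
proof -
  have "exp (\<Sum>i<k. (1 / real k) *\<^sub>R (real k * t i)) \<le> (\<Sum>i<k. (1 / real k) * exp (real k * t i))"
    using assms by (intro convex_on_sum[OF _ _ exp_convex]) auto
  then show ?thesis using assms by (simp add: sum_divide_distrib)
qed

context
  fixes a :: "nat \<Rightarrow> 'e \<Rightarrow> real" and m :: nat and V :: real
  assumes m: "m > 0" and V: "\<And>x. x < m \<Longrightarrow> (\<Sum>e\<in>J. (a x e * \<sigma> e)\<^sup>2) \<le> V"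
begin

lemma V_nonneg: "V \<ge> 0"
  using V[OF m] by (rule order.trans[rotated]) (auto intro: sum_nonneg)

text \<open>A crude bound. Only its linear dependence on \<open>d\<close> matters: \<open>d\<close>
  will be of order 1/k, so this term disappears in the limit however large \<open>m\<close>
  is.\<close>

lemma nn_integral_exp_lin_max_le:
  assumes "d \<ge> 0" "d \<le> 1"
  shows "(\<integral>\<^sup>+w. ennreal (exp (d * lin_max a m w)) \<partial>gauss_vec) \<le> ennreal (1 + d * (real m * exp (V / 2)))"
proof -
  interpret prob_space gauss_vec by (rule prob_space_gauss_vec)
  have "exp (d * y) \<le> 1 + d * exp y" for y :: real
  proof -
    have "exp ((1 - d) *\<^sub>R 0 + d *\<^sub>R y) \<le> (1 - d) * exp 0 + d * exp y"
      using assms by (intro convex_onD[OF exp_convex]) auto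
    then show ?thesis using assms by simp
  qed
  moreover have "exp (lin_max a m w) \<le> (\<Sum>x<m. exp (lin (a x) w))" for w
    unfolding lin_argmax(2)[OF m, symmetric]
    by (intro member_le_sum[of _ "{..<m}" "\<lambda>x. exp (lin (a x) w)"]) (auto simp: lin_argmax m)
  ultimately have "exp (d * lin_max a m w) \<le> 1 + d * (\<Sum>x<m. exp (lin (a x) w))" for w
    using assms by (meson add_left_mono mult_left_mono order.trans)
  then have "(\<integral>\<^sup>+w. ennreal (exp (d * lin_max a m w)) \<partial>gauss_vec) \<le>
      (\<integral>\<^sup>+w. 1 + ennreal d * (\<Sum>x<m. ennreal (exp (1 * lin (a x) w))) \<partial>gauss_vec)"
    using assms
    by (intro nn_integral_mono) (simp add: ennreal_plus[symmetric] ennreal_mult[symmetric] sum_nonneg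
        del: ennreal_plus flip: ennreal_1)
  also have "\<dots> = 1 + ennreal d * (\<Sum>x<m. (\<integral>\<^sup>+w. ennreal (exp (1 * lin (a x) w)) \<partial>gauss_vec))"
    by (simp add: nn_integral_add nn_integral_cmult nn_integral_sum emeasure_space_1 del: mult_1 sum_ennreal)
  also have "\<dots> \<le> 1 + ennreal d * (\<Sum>x<m. ennreal (exp (V / 2)))"
    unfolding nn_integral_exp_lin using V
    by (intro add_mono mult_left_mono sum_mono) auto
  also have "\<dots> = ennreal (1 + d * (real m * exp (V / 2)))"
    using assms by (simp add: ennreal_mult ennreal_of_nat_eq_real_of_nat)
  finally show ?thesis .
qed

text \<open>Given the first vector the maximising index is fixed, and the second vector is
  independent of it, so the inner integral is the exponential moment of a single Gaussian of
  variance at most \<open>V\<close>.\<close>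

lemma nn_integral_exp_step_le:
  assumes "d \<ge> 0" "d \<le> 1"
  shows "(\<integral>\<^sup>+p. ennreal (exp (d * lin_max a m (fst p) + c * lin (a (lin_argmax a m (fst p))) (snd p)))
      \<partial>(gauss_vec \<Otimes>\<^sub>M gauss_vec)) \<le> ennreal (exp (c\<^sup>2 * V / 2) * (1 + d * (real m * exp (V / 2))))"
proof -
  interpret prob_space gauss_vec by (rule prob_space_gauss_vec)
  have [measurable]: "(\<lambda>p. lin (a (lin_argmax a m (fst p))) (snd p)) \<in> borel_measurable (gauss_vec \<Otimes>\<^sub>M gauss_vec)"
    by (rule measurable_compose_countable[where f="\<lambda>x p. lin (a x) (snd p)"]) measurable
  have "(\<integral>\<^sup>+p. ennreal (exp (d * lin_max a m (fst p) + c * lin (a (lin_argmax a m (fst p))) (snd p)))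
      \<partial>(gauss_vec \<Otimes>\<^sub>M gauss_vec)) =
    (\<integral>\<^sup>+w. \<integral>\<^sup>+w'. ennreal (exp (d * lin_max a m w)) * ennreal (exp (c * lin (a (lin_argmax a m w)) w')) \<partial>gauss_vec \<partial>gauss_vec)"
    by (subst nn_integral_fst[symmetric]) (auto simp: exp_add ennreal_mult)
  also have "\<dots> = (\<integral>\<^sup>+w. ennreal (exp (d * lin_max a m w)) *
      ennreal (exp (c\<^sup>2 * (\<Sum>e\<in>J. (a (lin_argmax a m w) e * \<sigma> e)\<^sup>2) / 2)) \<partial>gauss_vec)"
    by (subst nn_integral_cmult) (auto simp: nn_integral_exp_lin)
  also have "\<dots> \<le> (\<integral>\<^sup>+w. ennreal (exp (d * lin_max a m w)) * ennreal (exp (c\<^sup>2 * V / 2)) \<partial>gauss_vec)"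
    using V lin_argmax(1)[OF m] by (intro nn_integral_mono mult_left_mono) (auto intro!: mult_left_mono)
  also have "\<dots> = (\<integral>\<^sup>+w. ennreal (exp (d * lin_max a m w)) \<partial>gauss_vec) * ennreal (exp (c\<^sup>2 * V / 2))"
    by (rule nn_integral_multc) measurable
  also have "\<dots> \<le> ennreal (1 + d * (real m * exp (V / 2))) * ennreal (exp (c\<^sup>2 * V / 2))"
    by (intro mult_right_mono nn_integral_exp_lin_max_le assms) auto
  also have "\<dots> = ennreal (exp (c\<^sup>2 * V / 2) * (1 + d * (real m * exp (V / 2))))"
    using assms by (subst ennreal_mult[symmetric]) (auto simp: mult.commute)
  finally show ?thesis .
qed

lemma nn_integral_exp_lin_max_diff_steps:
  assumes mu: "\<mu> \<ge> 0" and k: "k > 0" "\<mu> * pi\<^sup>2 / (8 * real k) \<le> 1"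
  shows "(\<integral>\<^sup>+p. ennreal (exp (\<mu> * (lin_max a m (fst p) - lin_max a m (snd p)))) \<partial>(gauss_vec \<Otimes>\<^sub>M gauss_vec))
    \<le> ennreal (exp (\<mu>\<^sup>2 * pi\<^sup>2 * V / 8) * (1 + \<mu> * pi\<^sup>2 / (8 * real k) * (real m * exp (V / 2))))"
proof -
  let ?GG = "gauss_vec \<Otimes>\<^sub>M gauss_vec"
  define \<epsilon> where "\<epsilon> = pi / (2 * real k)"
  have \<epsilon>: "\<epsilon> > 0" "\<epsilon> \<le> pi / 2" using k by (auto simp: \<epsilon>_def field_simps)
  \<comment> \<open>\<open>1 - cos \<epsilon>\<close> is of second order in the step, so the
    coefficient \<open>d\<close> of the maximum is O(1/k), while the fluctuation coefficient
    \<open>c\<close> stays bounded by \<mu> pi / 2 in absolute value.\<close>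
  define d where "d = \<mu> * real k * (1 - cos \<epsilon>)"
  define c where "c = - \<mu> * real k * sin \<epsilon>"
  have "1 - cos \<epsilon> \<le> \<epsilon>\<^sup>2 / 2"
  proof -
    have "1 - cos \<epsilon> = 2 * (sin (\<epsilon> / 2))\<^sup>2"
      using cos_double_sin[of "\<epsilon> / 2"] by simp
    also have "(sin (\<epsilon> / 2))\<^sup>2 \<le> (\<epsilon> / 2)\<^sup>2"
      using \<epsilon> by (intro power_mono sin_x_le_x sin_ge_zero) auto
    finally show ?thesis by (simp add: power2_eq_square)
  qed
  then have "d \<le> \<mu> * real k * (\<epsilon>\<^sup>2 / 2)"
    unfolding d_def using mu by (intro mult_left_mono) auto
  also have "\<dots> = \<mu> * pi\<^sup>2 / (8 * real k)"
    using k by (simp add: \<epsilon>_def power2_eq_square field_simps)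
  finally have d: "d \<le> \<mu> * pi\<^sup>2 / (8 * real k)" .
  have d0: "d \<ge> 0" "d \<le> 1"
    using mu order.trans[OF d k(2)] by (simp_all add: d_def)
  have "c\<^sup>2 \<le> (\<mu> * pi / 2)\<^sup>2"
  proof -
    have "0 \<le> sin \<epsilon>" "sin \<epsilon> \<le> \<epsilon>" using \<epsilon> by (auto intro!: sin_ge_zero sin_x_le_x)
    then have "\<mu> * real k * sin \<epsilon> \<le> \<mu> * real k * \<epsilon>" "0 \<le> \<mu> * real k * sin \<epsilon>"
      using mu by (auto intro!: mult_left_mono)
    then have "(\<mu> * real k * sin \<epsilon>)\<^sup>2 \<le> (\<mu> * real k * \<epsilon>)\<^sup>2" by (intro power_mono)
    then show ?thesis using k by (simp add: c_def \<epsilon>_def)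
  qed
  then have c: "c\<^sup>2 * V / 2 \<le> \<mu>\<^sup>2 * pi\<^sup>2 * V / 8"
    using mult_right_mono[OF _ V_nonneg, of "c\<^sup>2" "(\<mu> * pi / 2)\<^sup>2"] by (simp add: power2_eq_square algebra_simps)
  define s where "s p = d * lin_max a m (fst p) + c * lin (a (lin_argmax a m (fst p))) (snd p)" for p
  define R where "R i p = (rotX (real i * \<epsilon>) p, rotY (real i * \<epsilon>) p)" for i :: nat and p
  have [measurable]: "s \<in> borel_measurable ?GG"
  proof -
    have [measurable]: "(\<lambda>p. lin (a (lin_argmax a m (fst p))) (snd p)) \<in> borel_measurable ?GG"
      by (rule measurable_compose_countable[where f="\<lambda>x p. lin (a x) (snd p)"]) measurable
    show ?thesis unfolding s_def[abs_def] by measurable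
  qed
  have ptw: "exp (\<mu> * (lin_max a m (fst p) - lin_max a m (snd p))) \<le> (\<Sum>i<k. exp (s (R i p))) / real k"
    if p: "p \<in> space ?GG" for p
  proof -
    let ?F = "\<lambda>i. lin_max a m (rotX (real i * \<epsilon>) p)"
    have "rotX 0 p = fst p" "rotX (real k * \<epsilon>) p = snd p"
      using p k unfolding rotX_def \<epsilon>_def space_pair_measure space_gauss_vec
      by (cases p; auto simp: extensional_restrict)+
    then have "\<mu> * (lin_max a m (fst p) - lin_max a m (snd p)) = \<mu> * (\<Sum>i<k. ?F i - ?F (Suc i))"
      by (subst sum_lessThan_telescope') simp
    also have "\<dots> = (\<Sum>i<k. \<mu> * (?F i - ?F (Suc i)))" by (simp add: sum_distrib_left)
    also have "exp \<dots> \<le> (\<Sum>i<k. exp (real k * (\<mu> * (?F i - ?F (Suc i))))) / real k"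
      using k by (intro exp_sum_le)
    also have "\<dots> \<le> (\<Sum>i<k. exp (s (R i p))) / real k"
    proof (intro divide_right_mono sum_mono, unfold exp_le_cancel_iff)
      fix i
      have "real (Suc i) * \<epsilon> = real i * \<epsilon> + \<epsilon>" by (simp add: algebra_simps)
      then have "?F i - ?F (Suc i) \<le> (1 - cos \<epsilon>) * ?F i - sin \<epsilon> * lin (a (lin_argmax a m (fst (R i p)))) (snd (R i p))"
        using lin_max_rot_step[OF m, of a "real i * \<epsilon>" p \<epsilon>] by (simp add: R_def)
      then have "real k * \<mu> * (?F i - ?F (Suc i)) \<le> real k * \<mu> * ((1 - cos \<epsilon>) * ?F i - sin \<epsilon> * lin (a (lin_argmax a m (fst (R i p)))) (snd (R i p)))"
        using mu by (intro mult_left_mono) auto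
      then show "real k * (\<mu> * (?F i - ?F (Suc i))) \<le> s (R i p)"
        by (simp add: s_def d_def c_def R_def algebra_simps)
    qed simp
    finally show ?thesis by simp
  qed
  have "(\<integral>\<^sup>+p. ennreal (exp (\<mu> * (lin_max a m (fst p) - lin_max a m (snd p)))) \<partial>?GG)
    \<le> (\<integral>\<^sup>+p. (\<Sum>i<k. ennreal (exp (s (R i p)))) * ennreal (1 / real k) \<partial>?GG)"
    using ptw by (intro nn_integral_mono) (simp add: sum_nonneg ennreal_mult[symmetric])
  also have "\<dots> = (\<Sum>i<k. \<integral>\<^sup>+p. ennreal (exp (s (R i p))) \<partial>?GG) * ennreal (1 / real k)"
    unfolding R_def by (simp add: nn_integral_multc nn_integral_sum del: sum_ennreal)
  \<comment> \<open>Each rotated pair has the law of the original pair. The angles stay in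
    [0, pi/2], where \<open>1 + cos\<close> does not vanish.\<close>
  also have "\<dots> = (\<Sum>i<k. \<integral>\<^sup>+p. ennreal (exp (s p)) \<partial>?GG) * ennreal (1 / real k)"
  proof (intro arg_cong2[where f="(*)"] sum.cong refl)
    fix i assume "i \<in> {..<k}"
    then have "0 \<le> real i * \<epsilon>" "real i * \<epsilon> \<le> real k * \<epsilon>" using \<epsilon> by (auto intro!: mult_right_mono)
    moreover have "real k * \<epsilon> = pi / 2" using k by (simp add: \<epsilon>_def)
    ultimately have "cos (real i * \<epsilon>) \<ge> 0" by (intro cos_ge_zero) auto
    then have "1 + cos (real i * \<epsilon>) \<noteq> 0" by linarith
    then show "(\<integral>\<^sup>+p. ennreal (exp (s (R i p))) \<partial>?GG) = (\<integral>\<^sup>+p. ennreal (exp (s p)) \<partial>?GG)"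
      unfolding R_def by (intro nn_integral_gauss_vec_rot) measurable
  qed
  also have "\<dots> = (\<integral>\<^sup>+p. ennreal (exp (s p)) \<partial>?GG)"
  proof -
    have "of_nat k * ennreal (1 / real k) = 1"
      using k by (simp add: ennreal_of_nat_eq_real_of_nat ennreal_mult[symmetric])
    moreover have "(\<Sum>i<k. x) * y = of_nat k * y * x" for x y :: ennreal
      by (simp add: mult_ac)
    ultimately show ?thesis by (metis mult_1)
  qed
  also have "\<dots> \<le> ennreal (exp (c\<^sup>2 * V / 2) * (1 + d * (real m * exp (V / 2))))"
    unfolding s_def by (rule nn_integral_exp_step_le[OF d0])
  also have "\<dots> \<le> ennreal (exp (\<mu>\<^sup>2 * pi\<^sup>2 * V / 8) * (1 + \<mu> * pi\<^sup>2 / (8 * real k) * (real m * exp (V / 2))))"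
    using c d d0 by (intro ennreal_leI mult_mono add_mono mult_right_mono) auto
  finally show ?thesis .
qed

text \<open>Letting \<open>k\<close> tend to infinity removes the term that carries
  \<open>m\<close>, which makes the bound independent of the number of linear forms.\<close>

lemma nn_integral_exp_lin_max_diff:
  assumes mu: "\<mu> \<ge> 0"
  shows "(\<integral>\<^sup>+p. ennreal (exp (\<mu> * (lin_max a m (fst p) - lin_max a m (snd p)))) \<partial>(gauss_vec \<Otimes>\<^sub>M gauss_vec))
    \<le> ennreal (exp (\<mu>\<^sup>2 * pi\<^sup>2 * V / 8))"
proof (rule tendsto_lowerbound)
  have "(\<lambda>k. exp (\<mu>\<^sup>2 * pi\<^sup>2 * V / 8) * (1 + \<mu> * pi\<^sup>2 / 8 * (1 / real k) * (real m * exp (V / 2))))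
      \<longlonglongrightarrow> exp (\<mu>\<^sup>2 * pi\<^sup>2 * V / 8) * (1 + \<mu> * pi\<^sup>2 / 8 * 0 * (real m * exp (V / 2)))"
    by (intro tendsto_intros lim_1_over_n)
  then show "(\<lambda>k. ennreal (exp (\<mu>\<^sup>2 * pi\<^sup>2 * V / 8) * (1 + \<mu> * pi\<^sup>2 / (8 * real k) * (real m * exp (V / 2)))))
      \<longlonglongrightarrow> ennreal (exp (\<mu>\<^sup>2 * pi\<^sup>2 * V / 8))"
    by (intro tendsto_ennrealI) (simp add: divide_simps)
  have "\<forall>\<^sub>F k in sequentially. k > 0 \<and> real k \<ge> \<mu> * pi\<^sup>2 / 8"
    by (intro eventually_conj eventually_gt_at_top
        filterlim_at_top[THEN iffD1, rule_format, OF filterlim_real_sequentially])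
  then show "\<forall>\<^sub>F k in sequentially.
      (\<integral>\<^sup>+p. ennreal (exp (\<mu> * (lin_max a m (fst p) - lin_max a m (snd p)))) \<partial>(gauss_vec \<Otimes>\<^sub>M gauss_vec))
      \<le> ennreal (exp (\<mu>\<^sup>2 * pi\<^sup>2 * V / 8) * (1 + \<mu> * pi\<^sup>2 / (8 * real k) * (real m * exp (V / 2))))"
    by eventually_elim (intro nn_integral_exp_lin_max_diff_steps mu, auto simp: field_simps)
qed simp

text \<open>Markov's inequality for two independent copies, one with a high and one with a low
  maximum. The product form involves neither mean nor median: any lower bound for the first factor,
  even an exponentially small one, is converted into an upper bound for the second.\<close>

lemma gauss_vec_concentration:
  assumes r: "r \<ge> 0" and "V > 0"
  shows "measure gauss_vec {w\<in>space gauss_vec. lin_max a m w \<ge> u} *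
      measure gauss_vec {w\<in>space gauss_vec. lin_max a m w \<le> u - r} \<le> exp (- 2 * r\<^sup>2 / (pi\<^sup>2 * V))"
proof -
  interpret prob_space gauss_vec by (rule prob_space_gauss_vec)
  interpret GG: pair_prob_space gauss_vec gauss_vec ..
  let ?GG = "gauss_vec \<Otimes>\<^sub>M gauss_vec"
  let ?A = "{w\<in>space gauss_vec. lin_max a m w \<ge> u}" and ?B = "{w\<in>space gauss_vec. lin_max a m w \<le> u - r}"
  \<comment> \<open>Minimiser of the exponent \<mu>^2 pi^2 V / 8 - \<mu> r.\<close>
  define \<mu> where "\<mu> = 4 * r / (pi\<^sup>2 * V)"
  have mu: "\<mu> \<ge> 0" using assms by (simp add: \<mu>_def)
  have "ennreal (exp (\<mu> * r)) * (emeasure gauss_vec ?A * emeasure gauss_vec ?B) =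
      ennreal (exp (\<mu> * r)) * emeasure ?GG (?A \<times> ?B)"
    by (subst emeasure_pair_measure_Times) auto
  also have "\<dots> = (\<integral>\<^sup>+p. ennreal (exp (\<mu> * r)) * indicator (?A \<times> ?B) p \<partial>?GG)"
    by (subst nn_integral_cmult_indicator) auto
  also have "\<dots> \<le> (\<integral>\<^sup>+p. ennreal (exp (\<mu> * (lin_max a m (fst p) - lin_max a m (snd p)))) \<partial>?GG)"
    using mu by (intro nn_integral_mono) (auto split: split_indicator intro!: mult_left_mono)
  also have "\<dots> \<le> ennreal (exp (\<mu>\<^sup>2 * pi\<^sup>2 * V / 8))"
    by (rule nn_integral_exp_lin_max_diff[OF mu])
  finally have "exp (\<mu> * r) * (measure gauss_vec ?A * measure gauss_vec ?B) \<le> exp (\<mu>\<^sup>2 * pi\<^sup>2 * V / 8)"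
    by (simp add: emeasure_eq_measure ennreal_mult[symmetric])
  then have "measure gauss_vec ?A * measure gauss_vec ?B \<le> exp (\<mu>\<^sup>2 * pi\<^sup>2 * V / 8 - \<mu> * r)"
    unfolding exp_diff by (subst pos_le_divide_eq) (simp_all add: mult_ac)
  also have "\<mu>\<^sup>2 * pi\<^sup>2 * V / 8 - \<mu> * r = - 2 * r\<^sup>2 / (pi\<^sup>2 * V)"
    using assms by (simp add: \<mu>_def field_simps power2_eq_square)
  finally show ?thesis .
qed

end

end

section \<open>Energies of index sets as Gaussian linear forms\<close>

definition energy :: "(nat \<Rightarrow> nat \<Rightarrow> real) \<Rightarrow> nat set \<Rightarrow> real" where
  "energy w X = (\<Sum>i\<in>X. \<Sum>j\<in>X. w i j)"

definition sq_ind :: "nat set \<Rightarrow> nat \<Rightarrow> nat \<Rightarrow> real" where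
  "sq_ind X i j = of_bool (i \<in> X \<and> j \<in> X)"

lemma sum_sq_ind:
  fixes f :: "nat \<Rightarrow> nat \<Rightarrow> real"
  assumes "X \<subseteq> {..<N}"
  shows "(\<Sum>i<N. \<Sum>j<N. sq_ind X i j * f i j) = (\<Sum>i\<in>X. \<Sum>j\<in>X. f i j)"
proof -
  have "(\<Sum>i\<in>X. \<Sum>j\<in>X. f i j) = (\<Sum>i\<in>X. \<Sum>j<N. sq_ind X i j * f i j)"
    using assms by (intro sum.cong refl sum.mono_neutral_cong_left) (auto simp: sq_ind_def)
  also have "\<dots> = (\<Sum>i<N. \<Sum>j<N. sq_ind X i j * f i j)"
    using assms by (intro sum.mono_neutral_cong_left) (auto simp: sq_ind_def)
  finally show ?thesis by simp
qed

lemma energy_eq: "X \<subseteq> {..<N} \<Longrightarrow> energy w X = (\<Sum>i<N. \<Sum>j<N. sq_ind X i j * w i j)"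
  by (simp add: sum_sq_ind energy_def)

text \<open>The covariance structure: the energies of two sets have covariance 2/N times this
  quantity, so only the size of the intersection matters.\<close>

lemma sum_sq_ind_sq_ind:
  assumes "X \<subseteq> {..<N}"
  shows "(\<Sum>i<N. \<Sum>j<N. sq_ind X i j * sq_ind Y i j) = (real (card (X \<inter> Y)))\<^sup>2"
proof -
  have [simp]: "finite X" using assms finite_subset by blast
  have "(\<Sum>i<N. \<Sum>j<N. sq_ind X i j * sq_ind Y i j) = (\<Sum>i\<in>X. \<Sum>j\<in>X. sq_ind Y i j)"
    by (rule sum_sq_ind[OF assms])
  also have "\<dots> = (\<Sum>i\<in>X. of_bool (i \<in> Y)) * (\<Sum>j\<in>X. of_bool (j \<in> Y))"
    unfolding sum_product by (intro sum.cong refl) (simp add: sq_ind_def of_bool_conj)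
  finally show ?thesis by (simp add: power2_eq_square Int_def)
qed

lemma sq_ind_sym: "sq_ind X i j = sq_ind X j i"
  by (auto simp: sq_ind_def)

context
  fixes N :: nat and M :: "'w measure" and W
  assumes W: "gaussian_symmetric_matrix N M W" and N: "N > 0"
begin

lemma measurable_energy:
  assumes "X \<subseteq> {..<N}"
  shows "(\<lambda>\<omega>. energy (W \<omega>) X) \<in> borel_measurable M"
  unfolding energy_eq[OF assms] by (rule measurable_gaussian_sum[OF W])

text \<open>Transfers \<open>gauss_vec_concentration\<close> from the canonical product space to
  \<open>M\<close>, where the independent upper-triangular entries jointly have the law
  \<open>gauss_vec\<close>. Energies of sets of size at most \<open>n\<close> have variance at most
  2 n^2 / N, which is the bound \<open>V\<close> inserted there.\<close>

lemma energy_max_concentration: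
  assumes fin: "finite \<S>" and ne: "\<S> \<noteq> {}" and sub: "\<And>X. X \<in> \<S> \<Longrightarrow> X \<subseteq> {..<N}"
    and n: "\<And>X. X \<in> \<S> \<Longrightarrow> card X \<le> n" "n > 0" and r: "r \<ge> 0"
  shows "measure M {\<omega>\<in>space M. \<exists>X\<in>\<S>. energy (W \<omega>) X \<ge> u} *
    measure M {\<omega>\<in>space M. \<forall>X\<in>\<S>. energy (W \<omega>) X \<le> u - r} \<le> exp (- r\<^sup>2 * real N / (pi\<^sup>2 * (real n)\<^sup>2))"
proof -
  interpret prob_space M by (rule gaussian_prob_space[OF W])
  let ?J = "upper_pairs N"
  \<comment> \<open>The value 1 outside the index set serves the positivity demanded by the
    locale.\<close>
  define s where "s e = (if e \<in> ?J then entry_sd N e else 1)" for e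
  interpret G: gauss_family ?J s
    by unfold_locales (auto simp: s_def entry_sd_pos)
  define T where "T \<omega> = (\<lambda>e\<in>?J. W \<omega> (fst e) (snd e))" for \<omega>
  have Jne: "?J \<noteq> {}" using N by (auto simp: upper_pairs_def)
  have Wm: "(\<lambda>\<omega>. W \<omega> (fst e) (snd e)) \<in> borel_measurable M" if "e \<in> ?J" for e
    using distributed_measurable[OF gaussian_distributed[OF W that]] by simp
  have dW: "distr M borel (\<lambda>\<omega>. W \<omega> (fst e) (snd e)) = gauss (s e)" if "e \<in> ?J" for e
  proof -
    have "distr M borel (\<lambda>\<omega>. W \<omega> (fst e) (snd e)) = distr M lborel (\<lambda>\<omega>. W \<omega> (fst e) (snd e))"
      by (rule distr_cong) auto
    then show ?thesis
      using distributed_distr_eq_density[OF gaussian_distributed[OF W that]] that by (simp add: s_def)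
  qed
  have sets: "sets G.gauss_vec = sets (PiM ?J (\<lambda>_. borel))"
    unfolding G.gauss_vec_def by (intro sets_PiM_cong) auto
  have Tm [measurable]: "T \<in> measurable M G.gauss_vec"
    unfolding measurable_cong_sets[OF refl sets] T_def[abs_def] by (intro measurable_restrict Wm)
  have "distr M G.gauss_vec T = distr M (PiM ?J (\<lambda>_. borel)) T"
    by (rule distr_cong) (auto simp: sets)
  also have "\<dots> = PiM ?J (\<lambda>e. distr M borel (\<lambda>\<omega>. W \<omega> (fst e) (snd e)))"
    using indep_vars_iff_distr_eq_PiM'[OF Jne Wm, THEN iffD1, OF _ gaussian_indep[OF W]]
    unfolding T_def[abs_def] by simp
  also have "\<dots> = G.gauss_vec"
    unfolding G.gauss_vec_def by (intro PiM_cong dW refl)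
  finally have dT: "distr M G.gauss_vec T = G.gauss_vec" .
  obtain f :: "nat \<Rightarrow> nat set" where f: "bij_betw f {..<card \<S>} \<S>"
    using ex_bij_betw_nat_finite[OF fin] by (auto simp: lessThan_atLeast0)
  let ?m = "card \<S>"
  have m: "?m > 0" using fin ne by (simp add: card_gt_0_iff)
  have fS: "f x \<in> \<S>" if "x < ?m" for x using f that by (auto simp: bij_betw_def)
  have Sf: "\<S> = f ` {..<?m}" using f by (simp add: bij_betw_def)
  define a where "a x = upper_coeff (sq_ind (f x))" for x
  have lin: "G.lin (a x) (T \<omega>) = energy (W \<omega>) (f x)" if "x < ?m" "\<omega> \<in> space M" for x \<omega>
  proof -
    have "energy (W \<omega>) (f x) = (\<Sum>e\<in>?J. upper_coeff (sq_ind (f x)) e * W \<omega> (fst e) (snd e))"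
      using energy_eq[OF sub[OF fS[OF that(1)]]] gaussian_sum_eq_upper[OF W that(2)] by simp
    also have "\<dots> = G.lin (a x) (T \<omega>)"
      unfolding G.lin_def by (rule sum.cong[OF refl]) (simp add: a_def T_def)
    finally show ?thesis by simp
  qed
  have ge: "G.lin_max a ?m (T \<omega>) \<ge> u \<longleftrightarrow> (\<exists>X\<in>\<S>. energy (W \<omega>) X \<ge> u)" if "\<omega> \<in> space M" for \<omega>
  proof
    assume "G.lin_max a ?m (T \<omega>) \<ge> u"
    then show "\<exists>X\<in>\<S>. energy (W \<omega>) X \<ge> u"
      using G.lin_argmax[OF m, of a "T \<omega>"] fS lin[OF _ that] by metis
  next
    assume "\<exists>X\<in>\<S>. energy (W \<omega>) X \<ge> u"
    then obtain x where "x < ?m" "energy (W \<omega>) (f x) \<ge> u" using Sf by (metis imageE lessThan_iff)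
    then show "G.lin_max a ?m (T \<omega>) \<ge> u"
      using G.lin_max_ge[of x ?m a "T \<omega>"] lin[OF _ that] by simp
  qed
  have le: "G.lin_max a ?m (T \<omega>) \<le> u - r \<longleftrightarrow> (\<forall>X\<in>\<S>. energy (W \<omega>) X \<le> u - r)" if "\<omega> \<in> space M" for \<omega>
  proof
    assume "G.lin_max a ?m (T \<omega>) \<le> u - r"
    then have "energy (W \<omega>) (f x) \<le> u - r" if "x < ?m" for x
      using G.lin_max_ge[OF that, of a "T \<omega>"] lin[OF that \<open>\<omega> \<in> space M\<close>] by simp
    then show "\<forall>X\<in>\<S>. energy (W \<omega>) X \<le> u - r"
      using Sf by (metis imageE lessThan_iff)
  next
    assume "\<forall>X\<in>\<S>. energy (W \<omega>) X \<le> u - r"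
    then show "G.lin_max a ?m (T \<omega>) \<le> u - r"
      using G.lin_argmax[OF m, of a "T \<omega>"] fS lin[OF _ that] by metis
  qed
  have V: "(\<Sum>e\<in>?J. (a x e * s e)\<^sup>2) \<le> 2 * (real n)\<^sup>2 / real N" if "x < ?m" for x
  proof -
    have "(\<Sum>e\<in>?J. (a x e * s e)\<^sup>2) = (\<Sum>e\<in>?J. (upper_coeff (sq_ind (f x)) e * entry_sd N e)\<^sup>2)"
      by (intro sum.cong refl) (simp add: a_def s_def)
    also have "\<dots> \<le> 2 * (\<Sum>i<N. \<Sum>j<N. (sq_ind (f x) i j)\<^sup>2) / real N"
      by (rule upper_coeff_variance(1)[OF W])
    also have "\<dots> = 2 * (real (card (f x)))\<^sup>2 / real N"
      using sum_sq_ind_sq_ind[OF sub[OF fS[OF that]], of "f x"] by (simp add: power2_eq_square)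
    also have "\<dots> \<le> 2 * (real n)\<^sup>2 / real N"
      using n(1)[OF fS[OF that]] by (intro divide_right_mono mult_left_mono power_mono) auto
    finally show ?thesis .
  qed
  have "2 * (real n)\<^sup>2 / real N > 0" using n N by simp
  from G.gauss_vec_concentration[OF m V r this, where u=u]
  have "measure G.gauss_vec {w \<in> space G.gauss_vec. u \<le> G.lin_max a ?m w} *
      measure G.gauss_vec {w \<in> space G.gauss_vec. G.lin_max a ?m w \<le> u - r}
      \<le> exp (- 2 * r\<^sup>2 / (pi\<^sup>2 * (2 * (real n)\<^sup>2 / real N)))" .
  also have "- 2 * r\<^sup>2 / (pi\<^sup>2 * (2 * (real n)\<^sup>2 / real N)) = - r\<^sup>2 * real N / (pi\<^sup>2 * (real n)\<^sup>2)"
    using n N by (simp add: field_simps)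
  also have "measure G.gauss_vec {w \<in> space G.gauss_vec. u \<le> G.lin_max a ?m w} =
      measure M {\<omega>\<in>space M. \<exists>X\<in>\<S>. energy (W \<omega>) X \<ge> u}"
    by (subst dT[symmetric], subst measure_distr[OF Tm])
      (auto intro!: arg_cong[where f="measure M"] simp: ge measurable_space[OF Tm])
  also have "measure G.gauss_vec {w \<in> space G.gauss_vec. G.lin_max a ?m w \<le> u - r} =
      measure M {\<omega>\<in>space M. \<forall>X\<in>\<S>. energy (W \<omega>) X \<le> u - r}"
    by (subst dT[symmetric], subst measure_distr[OF Tm])
      (auto intro!: arg_cong[where f="measure M"] simp: le measurable_space[OF Tm])
  finally show ?thesis .
qed

end

section \<open>Truncated second moment\<close>

definition subsets :: "nat \<Rightarrow> nat \<Rightarrow> nat set set" where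
  "subsets N n = {X. X \<subseteq> {..<N} \<and> card X = n}"

lemma finite_subsets [simp]: "finite (subsets N n)"
  unfolding subsets_def by (rule finite_subset[of _ "Pow {..<N}"]) auto

lemma card_subsets: "card (subsets N n) = N choose n"
  using n_subsets[of "{..<N}" n] by (simp add: subsets_def)

lemma card_subsets_inter_le:
  assumes "V \<subseteq> {..<N}" "j \<le> n"
  shows "card {X\<in>subsets N n. card (V \<inter> X) = j} \<le> (card V choose j) * ((N - card V) choose (n - j))"
proof -
  let ?A = "{A. A \<subseteq> V \<and> card A = j}" and ?B = "{B. B \<subseteq> {..<N} - V \<and> card B = n - j}"
  let ?L = "{X\<in>subsets N n. card (V \<inter> X) = j}"
  have fin: "finite V" using assms finite_subset by blast
  have "card ?L \<le> card (?A \<times> ?B)"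
  proof (rule card_inj_on_le)
    show "inj_on (\<lambda>X. (V \<inter> X, X - V)) ?L" by (rule inj_onI) blast
    have "card (X - V) = n - j" if "X \<in> ?L" for X
    proof -
      have "finite X" using that by (auto simp: subsets_def intro: finite_subset)
      then show ?thesis using that by (simp add: subsets_def card_Diff_subset_Int Int_commute)
    qed
    then show "(\<lambda>X. (V \<inter> X, X - V)) ` ?L \<subseteq> ?A \<times> ?B" by (auto simp: subsets_def)
    show "finite (?A \<times> ?B)" using fin by simp
  qed
  also have "\<dots> = (card V choose j) * ((N - card V) choose (n - j))"
    using fin assms by (simp add: card_cartesian_product n_subsets card_Diff_subset)
  finally show ?thesis .
qed

text \<open>Paley--Zygmund at level \<open>0\<close>, from \<open>2 s Y \<le> s\<^sup>2 Y\<^sup>2 + 1\<close> on \<open>{Y \<noteq> 0}\<close>.\<close>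

lemma (in prob_space) second_moment_nonzero:
  assumes [measurable]: "random_variable borel Y"
    and int: "integrable M Y" "integrable M (\<lambda>\<omega>. (Y \<omega>)\<^sup>2)"
    and EY: "expectation Y \<ge> a" "a \<ge> 0" and EY2: "expectation (\<lambda>\<omega>. (Y \<omega>)\<^sup>2) \<le> B" "B > 0"
  shows "prob {\<omega>\<in>space M. Y \<omega> \<noteq> 0} \<ge> a\<^sup>2 / B"
proof -
  let ?A = "{\<omega>\<in>space M. Y \<omega> \<noteq> 0}"
  \<comment> \<open>Maximises 2 s a - s^2 B.\<close>
  define s where "s = a / B"
  have s: "s \<ge> 0" using EY EY2 by (simp add: s_def)
  have "2 * s * expectation Y = expectation (\<lambda>\<omega>. 2 * s * Y \<omega>)" by simp
  also have "\<dots> \<le> expectation (\<lambda>\<omega>. s\<^sup>2 * (Y \<omega>)\<^sup>2 + indicator ?A \<omega>)"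
  proof (rule integral_mono)
    show "integrable M (\<lambda>\<omega>. 2 * s * Y \<omega>)" "integrable M (\<lambda>\<omega>. s\<^sup>2 * (Y \<omega>)\<^sup>2 + indicator ?A \<omega>)"
      using int by (auto simp: emeasure_eq_measure intro!: Bochner_Integration.integrable_add)
  next
    fix \<omega> assume "\<omega> \<in> space M"
    moreover have "0 \<le> (s * Y \<omega> - 1)\<^sup>2" by simp
    ultimately show "2 * s * Y \<omega> \<le> s\<^sup>2 * (Y \<omega>)\<^sup>2 + indicator ?A \<omega>"
      by (auto simp: power2_eq_square algebra_simps split: split_indicator)
  qed
  also have "\<dots> = s\<^sup>2 * expectation (\<lambda>\<omega>. (Y \<omega>)\<^sup>2) + prob ?A"
    using int by (subst Bochner_Integration.integral_add) (auto simp: emeasure_eq_measure)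
  also have "\<dots> \<le> s\<^sup>2 * B + prob ?A" using EY2 by (simp add: mult_left_mono)
  finally have "2 * s * expectation Y - s\<^sup>2 * B \<le> prob ?A" by simp
  moreover have "2 * s * a \<le> 2 * s * expectation Y" using s EY by (intro mult_left_mono) auto
  moreover have "2 * s * a - s\<^sup>2 * B = a\<^sup>2 / B" using EY2 by (simp add: s_def power2_eq_square field_simps)
  ultimately show ?thesis by linarith
qed

text \<open>For a subset Z of size j of an n-set X, the residual of energy Z after subtracting
  (j/n)^2 energy X has variance 2 (1 - (j/n)^2) j^2 / N. A union bound over the
  \<open>n choose j\<close> such subsets with a spare factor exp(-\<xi> n) requires the height
  sqrt(2 variance (ln (n choose j) + \<xi> n)), which is this formula. It vanishes at j = 0 and j =
  n.\<close>

definition trunc_height :: "nat \<Rightarrow> nat \<Rightarrow> real \<Rightarrow> nat \<Rightarrow> real" where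
  "trunc_height N n \<xi> j = 2 * sqrt ((1 - (real j / real n)\<^sup>2) * (real j)\<^sup>2 * (ln (real (n choose j)) + \<xi> * real n) / real N)"

context
  fixes N :: nat and M :: "'w measure" and W
  assumes W: "gaussian_symmetric_matrix N M W" and N: "N > 0"
begin

text \<open>Exact exponential moments for three energies; zero coefficients and empty sets give the
  cases of one and two. Three are needed for a pair of sets together with their
  intersection.\<close>

lemma exp_energy_3:
  assumes sub: "X \<subseteq> {..<N}" "Y \<subseteq> {..<N}" "Z \<subseteq> {..<N}"
  shows "integrable M (\<lambda>\<omega>. exp (p * energy (W \<omega>) X + q * energy (W \<omega>) Y + r * energy (W \<omega>) Z + c))" (is ?int)
    and "(\<integral>\<omega>. exp (p * energy (W \<omega>) X + q * energy (W \<omega>) Y + r * energy (W \<omega>) Z + c) \<partial>M) =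
     exp ((p\<^sup>2 * (real (card X))\<^sup>2 + q\<^sup>2 * (real (card Y))\<^sup>2 + r\<^sup>2 * (real (card Z))\<^sup>2 +
       2 * p * q * (real (card (X \<inter> Y)))\<^sup>2 + 2 * p * r * (real (card (X \<inter> Z)))\<^sup>2 +
       2 * q * r * (real (card (Y \<inter> Z)))\<^sup>2) / real N + c)" (is ?eq)
proof -
  define C where "C i j = p * sq_ind X i j + q * sq_ind Y i j + r * sq_ind Z i j" for i j
  have lin: "p * energy w X + q * energy w Y + r * energy w Z = (\<Sum>i<N. \<Sum>j<N. C i j * w i j)" for w
    unfolding C_def energy_eq[OF sub(1)] energy_eq[OF sub(2)] energy_eq[OF sub(3)]
    by (simp add: algebra_simps sum.distrib sum_distrib_left)
  have "(\<Sum>i<N. \<Sum>j<N. (C i j)\<^sup>2) = p\<^sup>2 * (\<Sum>i<N. \<Sum>j<N. sq_ind X i j * sq_ind X i j)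
     + q\<^sup>2 * (\<Sum>i<N. \<Sum>j<N. sq_ind Y i j * sq_ind Y i j) + r\<^sup>2 * (\<Sum>i<N. \<Sum>j<N. sq_ind Z i j * sq_ind Z i j)
     + 2 * p * q * (\<Sum>i<N. \<Sum>j<N. sq_ind X i j * sq_ind Y i j) + 2 * p * r * (\<Sum>i<N. \<Sum>j<N. sq_ind X i j * sq_ind Z i j)
     + 2 * q * r * (\<Sum>i<N. \<Sum>j<N. sq_ind Y i j * sq_ind Z i j)"
    unfolding sum_distrib_left sum.distrib[symmetric] C_def
    by (intro sum.cong refl) (simp add: power2_eq_square algebra_simps)
  then have C2: "(\<Sum>i<N. \<Sum>j<N. (C i j)\<^sup>2) = p\<^sup>2 * (real (card X))\<^sup>2 + q\<^sup>2 * (real (card Y))\<^sup>2 + r\<^sup>2 * (real (card Z))\<^sup>2 +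
       2 * p * q * (real (card (X \<inter> Y)))\<^sup>2 + 2 * p * r * (real (card (X \<inter> Z)))\<^sup>2 + 2 * q * r * (real (card (Y \<inter> Z)))\<^sup>2"
    by (simp add: sum_sq_ind_sq_ind sub)
  have sym: "C i j = C j i" for i j unfolding C_def by (simp add: sq_ind_sym)
  show ?int ?eq
    unfolding lin exp_add
    using integrable_exp_gaussian_sum[OF W, of C] expectation_exp_gaussian_sum[OF W sym] C2
    by (simp_all add: exp_add)
qed

text \<open>Under the measure tilted by \<open>exp (b * energy X)\<close> the vertices in \<open>X\<close> look as if planted; the
  event below is typical for that measure.  Subtracting the regression \<open>(j / n)\<^sup>2 * energy X\<close> reduces the
  fluctuations of the energies of the large subsets \<open>Z\<close> of \<open>X\<close>.\<close>

definition planted_typical :: "nat \<Rightarrow> real \<Rightarrow> real \<Rightarrow> real \<Rightarrow> nat set \<Rightarrow> 'w \<Rightarrow> bool" where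
  "planted_typical n b \<delta> \<xi> X \<omega> \<longleftrightarrow>
     2 * b * (real n)\<^sup>2 / real N - \<delta> * real N \<le> energy (W \<omega>) X \<and>
     energy (W \<omega>) X \<le> 2 * b * (real n)\<^sup>2 / real N + \<delta> * real N \<and>
     (\<forall>Z\<in>Pow X. energy (W \<omega>) Z - (real (card Z) / real n)\<^sup>2 * energy (W \<omega>) X \<le> trunc_height N n \<xi> (card Z))"

lemma measurable_planted_typical:
  assumes "X \<in> subsets N n"
  shows "{\<omega>\<in>space M. planted_typical n b \<delta> \<xi> X \<omega>} \<in> sets M"
proof -
  have X: "X \<subseteq> {..<N}" "finite X" using assms by (auto simp: subsets_def intro: finite_subset)
  have [measurable]: "Z \<in> Pow X \<Longrightarrow> (\<lambda>\<omega>. energy (W \<omega>) Z) \<in> borel_measurable M" for Z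
    using X by (intro measurable_energy[OF W N]) auto
  have [measurable]: "(\<lambda>\<omega>. energy (W \<omega>) X) \<in> borel_measurable M"
    using X by (intro measurable_energy[OF W N]) auto
  have [measurable]: "finite (Pow X)" using X by simp
  show ?thesis unfolding planted_typical_def by measurable
qed

context
  fixes n :: nat and b \<delta> \<xi> :: real
  assumes n: "n > 0" "n \<le> N" and b: "b \<ge> 0" and \<delta>: "\<delta> > 0" and \<xi>: "\<xi> > 0"
begin

abbreviation "lvl \<equiv> 2 * b * (real n)\<^sup>2 / real N"
abbreviation "wgt X \<omega> \<equiv> exp (b * energy (W \<omega>) X - b\<^sup>2 * (real n)\<^sup>2 / real N)"
abbreviation "typ X \<omega> \<equiv> planted_typical n b \<delta> \<xi> X \<omega>"

lemma integrable_wgt: "X \<in> subsets N n \<Longrightarrow> integrable M (wgt X)"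
  and expectation_wgt: "X \<in> subsets N n \<Longrightarrow> (\<integral>\<omega>. wgt X \<omega> \<partial>M) = 1"
  using exp_energy_3[of X "{}" "{}" b 0 0 "- (b\<^sup>2 * (real n)\<^sup>2 / real N)"]
  by (auto simp: subsets_def)

lemma choose_ge_1: "Z \<subseteq> X \<Longrightarrow> X \<in> subsets N n \<Longrightarrow> real (n choose card Z) \<ge> 1"
proof -
  assume "Z \<subseteq> X" "X \<in> subsets N n"
  then have "card Z \<le> n" by (auto simp: subsets_def intro!: card_mono intro: finite_subset)
  then show ?thesis using zero_less_binomial[of "card Z" n] by linarith
qed

text \<open>A Chernoff bound under the tilted measure, kept as an exponential moment so that this
  measure need not be constructed. The residual of \<open>energy Z\<close> after regression on
  \<open>energy X\<close> is uncorrelated with \<open>energy X\<close>, so the tilt does not move it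
  and \<open>b\<close> drops out.\<close>

lemma tilted_subset_tail:
  assumes X: "X \<in> subsets N n" and Z: "Z \<subset> X" "Z \<noteq> {}"
  defines "j \<equiv> card Z"
  shows "\<exists>\<nu>\<ge>0. integrable M (\<lambda>\<omega>. wgt X \<omega> * exp (\<nu> * (energy (W \<omega>) Z - (real j / real n)\<^sup>2 * energy (W \<omega>) X - trunc_height N n \<xi> j))) \<and>
    (\<integral>\<omega>. wgt X \<omega> * exp (\<nu> * (energy (W \<omega>) Z - (real j / real n)\<^sup>2 * energy (W \<omega>) X - trunc_height N n \<xi> j)) \<partial>M)
      \<le> exp (- \<xi> * real n) / real (n choose j)"
proof -
  have X': "X \<subseteq> {..<N}" "card X = n" "finite X" using X by (auto simp: subsets_def intro: finite_subset)
  have j: "j > 0" "j < n"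
    unfolding j_def using X' Z psubset_card_mono[of X Z] by (auto simp: card_gt_0_iff intro: finite_subset)
  define k where "k = ln (real (n choose j)) + \<xi> * real n"
  define D where "D = (1 - (real j / real n)\<^sup>2) * (real j)\<^sup>2"
  have c1: "real (n choose j) \<ge> 1" using choose_ge_1[of Z X] X Z by (auto simp: j_def)
  then have k: "k > 0" using \<xi> n by (simp add: k_def add_nonneg_pos)
  have "(real j / real n)\<^sup>2 < 1" using j by (simp add: power2_eq_square divide_simps mult_strict_mono)
  then have D: "D > 0" using j by (simp add: D_def)
  \<comment> \<open>Optimal parameter: the threshold contributes \<open>- 2 * k\<close> and the
    variance \<open>k\<close>, so the total exponent is \<open>- k\<close>.\<close>
  define \<nu> where "\<nu> = sqrt (k * real N / D)"
  have nu0: "\<nu> \<ge> 0" using k D by (simp add: \<nu>_def)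
  have nu2: "\<nu>\<^sup>2 = k * real N / D" using k D by (simp add: \<nu>_def)
  have h: "trunc_height N n \<xi> j = 2 * sqrt (D * k / real N)"
    by (simp add: trunc_height_def D_def k_def)
  have "\<nu> * sqrt (D * k / real N) = k"
    unfolding \<nu>_def real_sqrt_mult[symmetric] using k D N by (simp add: real_sqrt_unique power2_eq_square)
  then have nuh: "\<nu> * trunc_height N n \<xi> j = 2 * k" unfolding h by simp
  define q where "q = (real j / real n)\<^sup>2"
  let ?c = "- \<nu> * trunc_height N n \<xi> j - b\<^sup>2 * (real n)\<^sup>2 / real N"
  have eq: "wgt X \<omega> * exp (\<nu> * (energy (W \<omega>) Z - (real j / real n)\<^sup>2 * energy (W \<omega>) X - trunc_height N n \<xi> j)) =
      exp ((b - \<nu> * q) * energy (W \<omega>) X + \<nu> * energy (W \<omega>) Z + 0 * energy (W \<omega>) {} + ?c)" for \<omega>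
    unfolding exp_add[symmetric] q_def by (simp add: algebra_simps)
  have "X \<inter> Z = Z" using Z by blast
  then have "(\<integral>\<omega>. exp ((b - \<nu> * q) * energy (W \<omega>) X + \<nu> * energy (W \<omega>) Z + 0 * energy (W \<omega>) {} + ?c) \<partial>M) =
     exp (((b - \<nu> * q)\<^sup>2 * (real n)\<^sup>2 + \<nu>\<^sup>2 * (real j)\<^sup>2 + 2 * (b - \<nu> * q) * \<nu> * (real j)\<^sup>2) / real N + ?c)"
    using exp_energy_3(2)[of X Z "{}" "b - \<nu> * q" \<nu> 0 ?c] X' Z by (auto simp: j_def)
  also have "((b - \<nu> * q)\<^sup>2 * (real n)\<^sup>2 + \<nu>\<^sup>2 * (real j)\<^sup>2 + 2 * (b - \<nu> * q) * \<nu> * (real j)\<^sup>2) = b\<^sup>2 * (real n)\<^sup>2 + \<nu>\<^sup>2 * D"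
  proof -
    have qn: "q * (real n)\<^sup>2 = (real j)\<^sup>2" using n by (simp add: q_def power_divide)
    have "((b - \<nu> * q)\<^sup>2 * (real n)\<^sup>2 + \<nu>\<^sup>2 * (real j)\<^sup>2 + 2 * (b - \<nu> * q) * \<nu> * (real j)\<^sup>2) =
       b\<^sup>2 * (real n)\<^sup>2 - 2 * b * \<nu> * (q * (real n)\<^sup>2) + \<nu>\<^sup>2 * q * (q * (real n)\<^sup>2) + \<nu>\<^sup>2 * (real j)\<^sup>2
         + 2 * b * \<nu> * (real j)\<^sup>2 - 2 * \<nu>\<^sup>2 * q * (real j)\<^sup>2"
      by (simp add: power2_eq_square algebra_simps)
    also have "\<dots> = b\<^sup>2 * (real n)\<^sup>2 + \<nu>\<^sup>2 * ((1 - q) * (real j)\<^sup>2)"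
      unfolding qn by (simp add: algebra_simps)
    finally show ?thesis by (simp add: D_def q_def)
  qed
  also have "(b\<^sup>2 * (real n)\<^sup>2 + \<nu>\<^sup>2 * D) / real N + ?c = - k"
    using nuh nu2 D N by (simp add: add_divide_distrib)
  also have "exp (- k) = exp (- \<xi> * real n) / real (n choose j)"
  proof -
    have "exp (- k) = exp (- \<xi> * real n) * exp (- ln (real (n choose j)))"
      by (simp add: k_def exp_add[symmetric])
    then show ?thesis using c1 j by (simp add: exp_minus divide_inverse)
  qed
  finally have val: "(\<integral>\<omega>. exp ((b - \<nu> * q) * energy (W \<omega>) X + \<nu> * energy (W \<omega>) Z + 0 * energy (W \<omega>) {} + ?c) \<partial>M) =
      exp (- \<xi> * real n) / real (n choose j)" .
  have int: "integrable M (\<lambda>\<omega>. exp ((b - \<nu> * q) * energy (W \<omega>) X + \<nu> * energy (W \<omega>) Z + 0 * energy (W \<omega>) {} + ?c))"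
    by (rule exp_energy_3(1)) (use X' Z in auto)
  show ?thesis
    by (rule exI[of _ \<nu>]) (simp only: eq val int nu0 order.refl simp_thms)
qed

text \<open>Under the tilt \<open>energy X\<close> is Gaussian with mean \<open>lvl\<close> and
  variance 2 n^2 / N, at most 2 N. The parameter \<delta>/2 is optimal for that worst variance;
  \<open>s\<close> treats both tails at once.\<close>

lemma tilted_level_tail:
  assumes X: "X \<in> subsets N n" and s: "s = 1 \<or> s = -1"
  shows "integrable M (\<lambda>\<omega>. wgt X \<omega> * exp (\<delta> / 2 * (s * (energy (W \<omega>) X - lvl) - \<delta> * real N)))"
    and "(\<integral>\<omega>. wgt X \<omega> * exp (\<delta> / 2 * (s * (energy (W \<omega>) X - lvl) - \<delta> * real N)) \<partial>M) \<le> exp (- \<delta>\<^sup>2 * real N / 4)"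
proof -
  have X': "X \<subseteq> {..<N}" "card X = n" using X by (auto simp: subsets_def)
  let ?c = "- b\<^sup>2 * (real n)\<^sup>2 / real N - \<delta> / 2 * s * lvl - \<delta> / 2 * \<delta> * real N"
  have eq: "wgt X \<omega> * exp (\<delta> / 2 * (s * (energy (W \<omega>) X - lvl) - \<delta> * real N)) =
     exp ((b + \<delta> / 2 * s) * energy (W \<omega>) X + 0 * energy (W \<omega>) {} + 0 * energy (W \<omega>) {} + ?c)" for \<omega>
    unfolding exp_add[symmetric] by (simp add: algebra_simps)
  show "integrable M (\<lambda>\<omega>. wgt X \<omega> * exp (\<delta> / 2 * (s * (energy (W \<omega>) X - lvl) - \<delta> * real N)))"
    unfolding eq by (rule exp_energy_3) (use X' in auto)
  have "(\<integral>\<omega>. wgt X \<omega> * exp (\<delta> / 2 * (s * (energy (W \<omega>) X - lvl) - \<delta> * real N)) \<partial>M) =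
      exp ((b + \<delta> / 2 * s)\<^sup>2 * (real n)\<^sup>2 / real N + ?c)"
    unfolding eq using exp_energy_3(2)[of X "{}" "{}" "b + \<delta> / 2 * s" 0 0 ?c] X' by simp
  also have "(b + \<delta> / 2 * s)\<^sup>2 * (real n)\<^sup>2 / real N + ?c = \<delta>\<^sup>2 / 4 * ((real n)\<^sup>2 / real N) - \<delta>\<^sup>2 / 2 * real N"
    using s N by (auto simp: power2_eq_square field_simps)
  also have "\<dots> \<le> \<delta>\<^sup>2 / 4 * real N - \<delta>\<^sup>2 / 2 * real N"
  proof -
    have "(real n)\<^sup>2 \<le> real N * real N" using n by (simp add: power2_eq_square mult_mono)
    then have "(real n)\<^sup>2 / real N \<le> real N" using N by (simp add: divide_le_eq)
    then show ?thesis by (intro diff_right_mono mult_left_mono) auto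
  qed
  also have "\<delta>\<^sup>2 / 4 * real N - \<delta>\<^sup>2 / 2 * real N = - \<delta>\<^sup>2 * real N / 4" by simp
  finally show "(\<integral>\<omega>. wgt X \<omega> * exp (\<delta> / 2 * (s * (energy (W \<omega>) X - lvl) - \<delta> * real N)) \<partial>M) \<le> exp (- \<delta>\<^sup>2 * real N / 4)"
    by simp
qed

text \<open>A union bound over the ways of being atypical, done pointwise: on the failure event one
  of the Chernoff exponentials is at least 1, so the total weight is at most the weight on the
  typical event plus the sum of the exponential moments.\<close>

lemma expectation_typical_ge:
  assumes X: "X \<in> subsets N n"
  shows "(\<integral>\<omega>. wgt X \<omega> * indicator {\<omega>\<in>space M. typ X \<omega>} \<omega> \<partial>M) \<ge>
    1 - (2 * exp (- \<delta>\<^sup>2 * real N / 4) + (real n + 1) * exp (- \<xi> * real n))"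
proof -
  interpret prob_space M by (rule gaussian_prob_space[OF W])
  have X': "X \<subseteq> {..<N}" "card X = n" "finite X" using X by (auto simp: subsets_def intro: finite_subset)
  define P where "P = {Z. Z \<subset> X \<and> Z \<noteq> {}}"
  have finP: "finite P" unfolding P_def using X' by (auto intro: finite_subset[of _ "Pow X"])
  define d where "d Z \<omega> = energy (W \<omega>) Z - (real (card Z) / real n)\<^sup>2 * energy (W \<omega>) X - trunc_height N n \<xi> (card Z)" for Z \<omega>
  have "\<forall>Z\<in>P. \<exists>\<nu>\<ge>0. integrable M (\<lambda>\<omega>. wgt X \<omega> * exp (\<nu> * d Z \<omega>)) \<and>
      (\<integral>\<omega>. wgt X \<omega> * exp (\<nu> * d Z \<omega>) \<partial>M) \<le> exp (- \<xi> * real n) / real (n choose card Z)"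
    unfolding P_def d_def using tilted_subset_tail[OF X] by blast
  from bchoice[OF this] obtain \<nu> where "\<forall>Z\<in>P. \<nu> Z \<ge> 0 \<and> integrable M (\<lambda>\<omega>. wgt X \<omega> * exp (\<nu> Z * d Z \<omega>)) \<and>
      (\<integral>\<omega>. wgt X \<omega> * exp (\<nu> Z * d Z \<omega>) \<partial>M) \<le> exp (- \<xi> * real n) / real (n choose card Z)"
    by blast
  then have nu: "\<And>Z. Z \<in> P \<Longrightarrow> \<nu> Z \<ge> 0"
    "\<And>Z. Z \<in> P \<Longrightarrow> integrable M (\<lambda>\<omega>. wgt X \<omega> * exp (\<nu> Z * d Z \<omega>))"
    "\<And>Z. Z \<in> P \<Longrightarrow> (\<integral>\<omega>. wgt X \<omega> * exp (\<nu> Z * d Z \<omega>) \<partial>M) \<le> exp (- \<xi> * real n) / real (n choose card Z)"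
    by auto
  define g where "g s \<omega> = wgt X \<omega> * exp (\<delta> / 2 * (s * (energy (W \<omega>) X - lvl) - \<delta> * real N))" for s \<omega>
  have gint: "integrable M (g 1)" "integrable M (g (-1))"
    unfolding g_def using tilted_level_tail(1)[OF X, of 1] tilted_level_tail(1)[OF X, of "-1"] by auto
  have gle: "(\<integral>\<omega>. g 1 \<omega> \<partial>M) \<le> exp (- \<delta>\<^sup>2 * real N / 4)" "(\<integral>\<omega>. g (-1) \<omega> \<partial>M) \<le> exp (- \<delta>\<^sup>2 * real N / 4)"
    unfolding g_def using tilted_level_tail(2)[OF X, of 1] tilted_level_tail(2)[OF X, of "-1"] by auto
  let ?h = "\<lambda>\<omega>. g 1 \<omega> + g (-1) \<omega> + (\<Sum>Z\<in>P. wgt X \<omega> * exp (\<nu> Z * d Z \<omega>))"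
  have ptw: "wgt X \<omega> - ?h \<omega> \<le> wgt X \<omega> * indicator {\<omega>\<in>space M. typ X \<omega>} \<omega>" if om: "\<omega> \<in> space M" for \<omega>
  proof -
    have nn: "g 1 \<omega> \<ge> 0" "g (-1) \<omega> \<ge> 0" "(\<Sum>Z\<in>P. wgt X \<omega> * exp (\<nu> Z * d Z \<omega>)) \<ge> 0"
      by (auto simp: g_def intro!: sum_nonneg)
    show ?thesis
    proof (cases "typ X \<omega>")
      case True
      then show ?thesis using nn om by simp
    next
      case False
      have w: "wgt X \<omega> \<le> wgt X \<omega> * exp y" if "y \<ge> 0" for y
        using that mult_left_mono[of 1 "exp y" "wgt X \<omega>"] by simp
      consider "energy (W \<omega>) X < lvl - \<delta> * real N" | "energy (W \<omega>) X > lvl + \<delta> * real N"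
        | Z where "Z \<subseteq> X" "d Z \<omega> > 0"
        using False unfolding planted_typical_def d_def by (auto simp: not_le)
      then have "wgt X \<omega> \<le> ?h \<omega>"
      proof cases
        case 1
        then have "wgt X \<omega> \<le> g (-1) \<omega>" unfolding g_def using \<delta> by (intro w) auto
        then show ?thesis using nn by linarith
      next
        case 2
        then have "wgt X \<omega> \<le> g 1 \<omega>" unfolding g_def using \<delta> by (intro w) auto
        then show ?thesis using nn by linarith
      next
        case (3 Z)
        \<comment> \<open>The empty set and \<open>X\<close> itself have residual and threshold
          zero, so a violation comes from a proper nonempty subset, to which
          \<open>tilted_subset_tail\<close> applies.\<close>
        have "d {} \<omega> = 0" by (simp add: d_def energy_def trunc_height_def)
        moreover have "d X \<omega> = 0" using X' n by (simp add: d_def trunc_height_def)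
        ultimately have Z: "Z \<in> P" unfolding P_def using 3 by auto
        have "wgt X \<omega> \<le> wgt X \<omega> * exp (\<nu> Z * d Z \<omega>)" using 3 nu(1)[OF Z] by (intro w) auto
        also have "\<dots> \<le> (\<Sum>Z\<in>P. wgt X \<omega> * exp (\<nu> Z * d Z \<omega>))"
          using Z finP by (intro member_le_sum[where f="\<lambda>Z. wgt X \<omega> * exp (\<nu> Z * d Z \<omega>)"]) auto
        finally show ?thesis using nn by linarith
      qed
      then show ?thesis using False by simp
    qed
  qed
  have inth: "integrable M ?h"
    by (intro Bochner_Integration.integrable_add Bochner_Integration.integrable_sum gint nu(2))
  have "1 - (\<integral>\<omega>. ?h \<omega> \<partial>M) = (\<integral>\<omega>. wgt X \<omega> - ?h \<omega> \<partial>M)"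
    using integrable_wgt[OF X] inth expectation_wgt[OF X] by (subst Bochner_Integration.integral_diff) auto
  also have "\<dots> \<le> (\<integral>\<omega>. wgt X \<omega> * indicator {\<omega>\<in>space M. typ X \<omega>} \<omega> \<partial>M)"
    using integrable_wgt[OF X] inth measurable_planted_typical[OF X] ptw
    by (intro integral_mono integrable_real_mult_indicator Bochner_Integration.integrable_diff) auto
  finally have main: "1 - (\<integral>\<omega>. ?h \<omega> \<partial>M) \<le> (\<integral>\<omega>. wgt X \<omega> * indicator {\<omega>\<in>space M. typ X \<omega>} \<omega> \<partial>M)" .
  have "(\<integral>\<omega>. ?h \<omega> \<partial>M) = (\<integral>\<omega>. g 1 \<omega> \<partial>M) + (\<integral>\<omega>. g (-1) \<omega> \<partial>M) + (\<Sum>Z\<in>P. \<integral>\<omega>. wgt X \<omega> * exp (\<nu> Z * d Z \<omega>) \<partial>M)"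
    using gint nu(2) by (simp add: Bochner_Integration.integrable_sum Bochner_Integration.integral_sum)
  also have "\<dots> \<le> exp (- \<delta>\<^sup>2 * real N / 4) + exp (- \<delta>\<^sup>2 * real N / 4) + (\<Sum>Z\<in>P. exp (- \<xi> * real n) / real (n choose card Z))"
    by (intro add_mono gle sum_mono nu(3))
  also have "(\<Sum>Z\<in>P. exp (- \<xi> * real n) / real (n choose card Z)) \<le> (\<Sum>Z\<in>Pow X. exp (- \<xi> * real n) / real (n choose card Z))"
    using X' by (intro sum_mono2) (auto simp: P_def)
  also have "\<dots> = (\<Sum>j\<le>n. \<Sum>Z\<in>{Z\<in>Pow X. card Z = j}. exp (- \<xi> * real n) / real (n choose card Z))"
    using X' by (intro sum.group[symmetric]) (auto intro: card_mono)
  \<comment> \<open>The \<open>n choose j\<close> subsets of size \<open>j\<close> cancel the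
    binomial in the denominator; this is why the truncation height contains its logarithm.\<close>
  also have "\<dots> = (\<Sum>j\<le>n. exp (- \<xi> * real n))"
  proof (intro sum.cong refl)
    fix j assume "j \<in> {..n}"
    then have "n choose j > 0" by simp
    moreover have "card {Z\<in>Pow X. card Z = j} = n choose j"
      using n_subsets[OF X'(3), of j] X'(2) by (simp add: Pow_def)
    ultimately show "(\<Sum>Z\<in>{Z\<in>Pow X. card Z = j}. exp (- \<xi> * real n) / real (n choose card Z)) = exp (- \<xi> * real n)"
      by (subst sum.cong[OF refl, of _ _ "\<lambda>_. exp (- \<xi> * real n) / real (n choose j)"]) auto
  qed
  also have "\<dots> = (real n + 1) * exp (- \<xi> * real n)" by simp
  finally show ?thesis using main by simp
qed

text \<open>The gain of the truncation. On the typical event the energy of the intersection exceeds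
  2 b j^2 / N by at most an error term, so inserting exp(b (bound - energy of the intersection)),
  which is at least 1 there, preserves an upper bound. It removes the tilt counted twice on the
  intersection: the exponent drops from 2 b^2 j^2 / N to b^2 j^2 / N plus corrections.\<close>

lemma expectation_pair_le:
  assumes X: "X \<in> subsets N n" and Y: "Y \<in> subsets N n"
  defines "j \<equiv> card (X \<inter> Y)"
  shows "integrable M (\<lambda>\<omega>. wgt X \<omega> * indicator {\<omega>\<in>space M. typ X \<omega>} \<omega> * (wgt Y \<omega> * indicator {\<omega>\<in>space M. typ Y \<omega>} \<omega>))" (is ?int)
    and "(\<integral>\<omega>. wgt X \<omega> * indicator {\<omega>\<in>space M. typ X \<omega>} \<omega> * (wgt Y \<omega> * indicator {\<omega>\<in>space M. typ Y \<omega>} \<omega>) \<partial>M)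
      \<le> exp (b\<^sup>2 * (real j)\<^sup>2 / real N + b * \<delta> * real N + b * trunc_height N n \<xi> j)" (is ?le)
proof -
  interpret prob_space M by (rule gaussian_prob_space[OF W])
  have sub: "X \<subseteq> {..<N}" "Y \<subseteq> {..<N}" "X \<inter> Y \<subseteq> {..<N}" "card X = n" "card Y = n"
    using X Y by (auto simp: subsets_def)
  let ?Z = "X \<inter> Y"
  let ?f = "\<lambda>\<omega>. wgt X \<omega> * indicator {\<omega>\<in>space M. typ X \<omega>} \<omega> * (wgt Y \<omega> * indicator {\<omega>\<in>space M. typ Y \<omega>} \<omega>)"
  let ?c = "b * (2 * b * (real j)\<^sup>2 / real N + \<delta> * real N + trunc_height N n \<xi> j) - 2 * b\<^sup>2 * (real n)\<^sup>2 / real N"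
  let ?g = "\<lambda>\<omega>. exp (b * energy (W \<omega>) X + b * energy (W \<omega>) Y + (- b) * energy (W \<omega>) ?Z + ?c)"
  have jn: "j \<le> n" unfolding j_def sub(4)[symmetric] using sub by (intro card_mono) (auto intro: finite_subset)
  have ptw: "?f \<omega> \<le> ?g \<omega>" for \<omega>
  proof (cases "\<omega> \<in> space M \<and> typ X \<omega> \<and> typ Y \<omega>")
    case True
    \<comment> \<open>Typicality of \<open>X\<close> bounds both parts of the intersection energy:
      the regression part through the upper end of the energy window, the residual through the
      truncation height.\<close>
    define q where "q = (real j / real n)\<^sup>2"
    have q: "0 \<le> q" "q \<le> 1" using jn n by (auto simp: q_def power2_eq_square divide_le_eq mult_mono)
    have "energy (W \<omega>) ?Z - q * energy (W \<omega>) X \<le> trunc_height N n \<xi> j" and le: "energy (W \<omega>) X \<le> lvl + \<delta> * real N"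
      using True unfolding planted_typical_def q_def j_def by auto
    moreover have "q * energy (W \<omega>) X \<le> q * (lvl + \<delta> * real N)"
      using q le by (intro mult_left_mono)
    moreover have "q * (\<delta> * real N) \<le> 1 * (\<delta> * real N)" using q \<delta> by (intro mult_right_mono) auto
    moreover have "q * lvl = 2 * b * (real j)\<^sup>2 / real N" using n by (simp add: q_def power_divide)
    moreover have "q * (lvl + \<delta> * real N) = q * lvl + q * (\<delta> * real N)" by (rule distrib_left)
    ultimately have "energy (W \<omega>) ?Z \<le> 2 * b * (real j)\<^sup>2 / real N + \<delta> * real N + trunc_height N n \<xi> j"
      by linarith
    then have "b * energy (W \<omega>) ?Z \<le> b * (2 * b * (real j)\<^sup>2 / real N + \<delta> * real N + trunc_height N n \<xi> j)"
      using b by (rule mult_left_mono)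
    then show ?thesis using True by (simp add: exp_add[symmetric])
  qed auto
  have gint: "integrable M ?g" by (rule exp_energy_3) (use sub in auto)
  have ind: "(\<lambda>\<omega>. indicator {\<omega>\<in>space M. typ X \<omega>} \<omega> :: real) \<in> borel_measurable M"
     "(\<lambda>\<omega>. indicator {\<omega>\<in>space M. typ Y \<omega>} \<omega> :: real) \<in> borel_measurable M"
    using measurable_planted_typical X Y by (auto intro!: borel_measurable_indicator)
  have fmeas: "?f \<in> borel_measurable M"
    using ind borel_measurable_integrable[OF integrable_wgt[OF X]] borel_measurable_integrable[OF integrable_wgt[OF Y]]
    by (intro borel_measurable_times)
  show ?int
    by (rule Bochner_Integration.integrable_bound[OF gint fmeas]) (use ptw in \<open>auto simp: abs_mult\<close>)
  have "(\<integral>\<omega>. ?f \<omega> \<partial>M) \<le> (\<integral>\<omega>. ?g \<omega> \<partial>M)"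
    using \<open>?int\<close> gint ptw by (intro integral_mono) auto
  also have "\<dots> = exp ((b\<^sup>2 * (real n)\<^sup>2 + b\<^sup>2 * (real n)\<^sup>2 + (- b)\<^sup>2 * (real j)\<^sup>2 + 2 * b * b * (real j)\<^sup>2
      + 2 * b * (- b) * (real j)\<^sup>2 + 2 * b * (- b) * (real j)\<^sup>2) / real N + ?c)"
  proof -
    have "X \<inter> ?Z = ?Z" "Y \<inter> ?Z = ?Z" by auto
    then show ?thesis
      using exp_energy_3(2)[OF sub(1-3), of b b "- b" ?c] sub(4,5) by (simp only: j_def)
  qed
  also have "\<dots> = exp (b\<^sup>2 * (real j)\<^sup>2 / real N + b * \<delta> * real N + b * trunc_height N n \<xi> j)"
    using N by (intro arg_cong[where f=exp]) (simp add: power2_eq_square field_simps)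
  finally show ?le .
qed

text \<open>The second moment method for the total truncated weight of \<open>\<S>\<close>. The sum
  over partners is enlarged to all of \<open>subsets N n\<close>, so a family of at least half of
  all sets loses only a factor 2. The hypothesis on \<open>B\<close> controls each intersection size
  separately, whence the factor n + 1.\<close>

lemma second_moment_lower_bound:
  assumes S: "\<S> \<subseteq> subsets N n" "2 * card \<S> \<ge> N choose n"
    and small: "2 * exp (- \<delta>\<^sup>2 * real N / 4) + (real n + 1) * exp (- \<xi> * real n) \<le> 1 / 2"
    and B: "\<And>j. j \<le> n \<Longrightarrow> real ((n choose j) * ((N - n) choose (n - j))) *
        exp (b\<^sup>2 * (real j)\<^sup>2 / real N + b * \<delta> * real N + b * trunc_height N n \<xi> j) \<le> B * real (N choose n)"
  shows "measure M {\<omega>\<in>space M. \<exists>X\<in>\<S>. energy (W \<omega>) X \<ge> lvl - \<delta> * real N} \<ge> 1 / (8 * (real n + 1) * B)"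
proof -
  interpret prob_space M by (rule gaussian_prob_space[OF W])
  have finS: "finite \<S>" by (rule finite_subset[OF S(1)]) simp
  define f where "f X \<omega> = wgt X \<omega> * indicator {\<omega>\<in>space M. typ X \<omega>} \<omega>" for X \<omega>
  define Y where "Y \<omega> = (\<Sum>X\<in>\<S>. f X \<omega>)" for \<omega>
  define E where "E j = exp (b\<^sup>2 * (real j)\<^sup>2 / real N + b * \<delta> * real N + b * trunc_height N n \<xi> j)" for j
  have fint: "integrable M (f X)" if "X \<in> \<S>" for X
    unfolding f_def using that S integrable_wgt measurable_planted_typical
    by (intro integrable_real_mult_indicator) auto
  have Yint: "integrable M Y" unfolding Y_def by (intro Bochner_Integration.integrable_sum fint)
  have Y2: "(Y \<omega>)\<^sup>2 = (\<Sum>X\<in>\<S>. \<Sum>X'\<in>\<S>. f X \<omega> * f X' \<omega>)" for \<omega>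
    unfolding Y_def power2_eq_square sum_product ..
  have ffint: "integrable M (\<lambda>\<omega>. f X \<omega> * f X' \<omega>)" if "X \<in> \<S>" "X' \<in> \<S>" for X X'
    unfolding f_def using that S expectation_pair_le(1) by blast
  have Y2int: "integrable M (\<lambda>\<omega>. (Y \<omega>)\<^sup>2)"
    unfolding Y2 by (intro Bochner_Integration.integrable_sum ffint)
  have Cpos: "N choose n > 0" using n by simp
  then have cS: "real (card \<S>) > 0" using S(2) by (metis linorder_not_less mult_0_right of_nat_0_less_iff neq0_conv)
  have Bpos: "B > 0"
  proof -
    have "0 < real ((n choose n) * ((N - n) choose (n - n))) * E n" by (simp add: E_def)
    also have "\<dots> \<le> B * real (N choose n)" unfolding E_def by (rule B) simp
    finally show ?thesis using Cpos by (simp add: zero_less_mult_iff)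
  qed
  have EY: "expectation Y \<ge> real (card \<S>) / 2"
  proof -
    have "expectation Y = (\<Sum>X\<in>\<S>. expectation (f X))"
      unfolding Y_def using fint by (intro Bochner_Integration.integral_sum) auto
    also have "\<dots> \<ge> (\<Sum>X\<in>\<S>. 1 / 2)"
    proof (intro sum_mono)
      fix X assume "X \<in> \<S>"
      then show "1 / 2 \<le> expectation (f X)"
        using expectation_typical_ge[of X] S small unfolding f_def by force
    qed
    finally show ?thesis by simp
  qed
  have EY2: "expectation (\<lambda>\<omega>. (Y \<omega>)\<^sup>2) \<le> real (card \<S>) * ((real n + 1) * (B * real (N choose n)))"
  proof -
    have "expectation (\<lambda>\<omega>. (Y \<omega>)\<^sup>2) = (\<Sum>X\<in>\<S>. \<Sum>X'\<in>\<S>. expectation (\<lambda>\<omega>. f X \<omega> * f X' \<omega>))"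
      unfolding Y2 using ffint by (subst Bochner_Integration.integral_sum, (intro Bochner_Integration.integrable_sum; simp))
        (intro sum.cong refl Bochner_Integration.integral_sum, simp)
    also have "\<dots> \<le> (\<Sum>X\<in>\<S>. \<Sum>X'\<in>\<S>. E (card (X \<inter> X')))"
      unfolding f_def E_def using S by (intro sum_mono expectation_pair_le) auto
    also have "\<dots> \<le> (\<Sum>X\<in>\<S>. (real n + 1) * (B * real (N choose n)))"
    proof (intro sum_mono)
      fix X assume "X \<in> \<S>"
      then have X: "X \<subseteq> {..<N}" "card X = n" "finite X" using S by (auto simp: subsets_def intro: finite_subset)
      have "(\<Sum>X'\<in>\<S>. E (card (X \<inter> X'))) \<le> (\<Sum>X'\<in>subsets N n. E (card (X \<inter> X')))"
        using S by (intro sum_mono2) (auto simp: E_def)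
      also have "\<dots> = (\<Sum>j\<le>n. \<Sum>X'\<in>{X'\<in>subsets N n. card (X \<inter> X') = j}. E (card (X \<inter> X')))"
        using X by (intro sum.group[symmetric]) (auto intro: card_mono)
      also have "\<dots> = (\<Sum>j\<le>n. real (card {X'\<in>subsets N n. card (X \<inter> X') = j}) * E j)"
        by (intro sum.cong refl) simp
      also have "\<dots> \<le> (\<Sum>j\<le>n. B * real (N choose n))"
      proof (intro sum_mono)
        fix j assume "j \<in> {..n}"
        then have j: "j \<le> n" by simp
        have "real (card {X'\<in>subsets N n. card (X \<inter> X') = j}) * E j \<le> real ((n choose j) * ((N - n) choose (n - j))) * E j"
          using card_subsets_inter_le[OF X(1) j] X(2) by (intro mult_right_mono) (auto simp: E_def simp del: of_nat_mult)
        also have "\<dots> \<le> B * real (N choose n)" unfolding E_def by (rule B[OF j])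
        finally show "real (card {X'\<in>subsets N n. card (X \<inter> X') = j}) * E j \<le> B * real (N choose n)" .
      qed
      finally show "(\<Sum>X'\<in>\<S>. E (card (X \<inter> X'))) \<le> (real n + 1) * (B * real (N choose n))" by (simp add: add.commute)
    qed
    finally show ?thesis by simp
  qed
  let ?D = "real (card \<S>) * ((real n + 1) * (B * real (N choose n)))"
  have "?D > 0" using cS Bpos Cpos by simp
  from second_moment_nonzero[OF borel_measurable_integrable[OF Yint] Yint Y2int EY _ EY2 this]
  have "(real (card \<S>) / 2)\<^sup>2 / ?D \<le> prob {\<omega>\<in>space M. Y \<omega> \<noteq> 0}" by simp
  also have "\<dots> \<le> prob {\<omega>\<in>space M. \<exists>X\<in>\<S>. energy (W \<omega>) X \<ge> lvl - \<delta> * real N}"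
  proof (intro finite_measure_mono subsetI)
    have m: "X \<in> \<S> \<Longrightarrow> (\<lambda>\<omega>. energy (W \<omega>) X) \<in> borel_measurable M" for X
      using S by (intro measurable_energy[OF W N]) (auto simp: subsets_def)
    have "{\<omega>\<in>space M. \<exists>X\<in>\<S>. energy (W \<omega>) X \<ge> lvl - \<delta> * real N} = (\<Union>X\<in>\<S>. {\<omega>\<in>space M. energy (W \<omega>) X \<ge> lvl - \<delta> * real N})"
      by auto
    also have "\<dots> \<in> events" using finS m by (intro sets.finite_UN borel_measurable_le) auto
    finally show "{\<omega>\<in>space M. \<exists>X\<in>\<S>. energy (W \<omega>) X \<ge> lvl - \<delta> * real N} \<in> events" .
  next
    fix \<omega> assume om: "\<omega> \<in> {\<omega>\<in>space M. Y \<omega> \<noteq> 0}"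
    then obtain X where "X \<in> \<S>" "f X \<omega> \<noteq> 0" unfolding Y_def by (auto elim: sum.not_neutral_contains_not_neutral)
    then show "\<omega> \<in> {\<omega>\<in>space M. \<exists>X\<in>\<S>. energy (W \<omega>) X \<ge> lvl - \<delta> * real N}"
      using om by (auto simp: f_def planted_typical_def split: split_indicator_asm)
  qed
  finally have *: "(real (card \<S>) / 2)\<^sup>2 / ?D \<le> prob {\<omega>\<in>space M. \<exists>X\<in>\<S>. energy (W \<omega>) X \<ge> lvl - \<delta> * real N}" .
  have "1 / (8 * (real n + 1) * B) = real (N choose n) / 2 / (4 * (real n + 1) * B * real (N choose n))"
    using Cpos by simp
  also have "\<dots> \<le> real (card \<S>) / (4 * (real n + 1) * B * real (N choose n))"
  proof (intro divide_right_mono)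
    have "real (N choose n) \<le> real (2 * card \<S>)" using S(2) by (rule of_nat_mono)
    then show "real (N choose n) / 2 \<le> real (card \<S>)" by simp
  qed (use Bpos in auto)
  also have "\<dots> = (real (card \<S>) / 2)\<^sup>2 / ?D"
    using cS by (simp add: power2_eq_square)
  finally show ?thesis using * by linarith
qed

end

end

section \<open>Binomial exponents\<close>

lemma fact_ge_power:
  assumes "k > 0"
  shows "(real k / exp 1) ^ k \<le> fact k"
proof -
  have "real k ^ k / fact k \<le> exp (real k)"
  proof -
    have "(\<Sum>i\<in>{k}. real k ^ i /\<^sub>R fact i) \<le> (\<Sum>i. real k ^ i /\<^sub>R fact i)"
      by (intro sum_le_suminf summable_exp_generic) auto
    then show ?thesis by (simp add: exp_def divide_inverse mult.commute)
  qed
  then have "real k ^ k \<le> exp (real k) * fact k"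
    by (simp add: divide_le_eq)
  also have "exp (real k) = exp 1 ^ k" by (simp add: exp_of_nat_mult[symmetric])
  finally show ?thesis by (simp add: power_divide divide_le_eq mult.commute)
qed

lemma ln_choose_le:
  assumes "0 < k" "k \<le> n"
  shows "ln (real (n choose k)) \<le> real k * (1 + ln (real n / real k))"
proof -
  have "real ((n choose k) * fact k) \<le> real (n ^ k)" by (intro of_nat_mono binomial_fact_pow)
  then have "real (n choose k) * fact k \<le> real n ^ k" by simp
  moreover have "real (n choose k) * (real k / exp 1) ^ k \<le> real (n choose k) * fact k"
    by (intro mult_left_mono fact_ge_power assms) simp
  ultimately have "real (n choose k) * (real k / exp 1) ^ k \<le> real n ^ k" by linarith
  then have "real (n choose k) \<le> real n ^ k / (real k / exp 1) ^ k"
    using assms by (subst pos_le_divide_eq) auto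
  also have "\<dots> = (exp 1 * (real n / real k)) ^ k"
    by (simp add: power_divide power_mult_distrib field_simps)
  finally have "ln (real (n choose k)) \<le> ln ((exp 1 * (real n / real k)) ^ k)"
    using assms by (subst ln_le_cancel_iff) (auto simp: zero_less_binomial)
  also have "\<dots> = real k * (1 + ln (real n / real k))"
    using assms ln_mult[of "exp 1" "real n / real k"] by (subst ln_realpow) auto
  finally show ?thesis .
qed

lemma ln_choose_ge:
  assumes "0 < k" "k \<le> n"
  shows "real k * ln (real n / real k) \<le> ln (real (n choose k))"
proof -
  have "(real n / real k) ^ k \<le> real (n choose k)"
    using binomial_ge_n_over_k_pow_k[of k n, where 'a=real] assms by simp
  then have "ln ((real n / real k) ^ k) \<le> ln (real (n choose k))"
    using assms by (subst ln_le_cancel_iff) (auto simp: zero_less_binomial)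
  then show ?thesis using assms by (simp add: ln_realpow)
qed

text \<open>The ratio of the two binomials is the probability that a uniform \<open>n\<close>-set
  contains \<open>j\<close> given points; each further point is hit with conditional probability (n
  - j)/(N - j), at most n/N.\<close>

lemma choose_shift_le:
  assumes "j \<le> n" "n \<le> N"
  shows "real ((N - j) choose (n - j)) \<le> real (N choose n) * (real n / real N) ^ j"
  using assms(1)
proof (induction j)
  case (Suc j)
  then have j: "j < n" by simp
  have "(N - j) * ((N - Suc j) choose (n - Suc j)) = ((N - j) choose (n - j)) * (n - j)"
    using Suc_times_binomial_eq[of "N - Suc j" "n - Suc j"] j assms(2)
    by (simp add: Suc_diff_Suc)
  then have "real (N - j) * real ((N - Suc j) choose (n - Suc j)) = real ((N - j) choose (n - j)) * real (n - j)"
    unfolding of_nat_mult[symmetric] by simp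
  then have "real ((N - Suc j) choose (n - Suc j)) = real ((N - j) choose (n - j)) * (real (n - j) / real (N - j))"
    using j assms(2) by (simp add: field_simps)
  also have "\<dots> \<le> (real (N choose n) * (real n / real N) ^ j) * (real n / real N)"
  proof (intro mult_mono)
    show "real (n - j) / real (N - j) \<le> real n / real N"
    proof -
      have "real j * real n \<le> real j * real N" using assms(2) by (intro mult_left_mono) auto
      then show ?thesis using j assms(2) by (simp add: field_simps of_nat_diff)
    qed
  qed (use Suc j in auto)
  finally show ?case by (simp add: mult_ac)
qed simp

lemma choose_inter_le:
  assumes "j \<le> n" "n \<le> N"
  shows "real ((N - n) choose (n - j)) \<le> real (N choose n) * (real n / real N) ^ j"
proof -
  have "(N - n) choose (n - j) \<le> (N - j) choose (n - j)"
    using assms by (intro binomial_right_mono) auto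
  then have "real ((N - n) choose (n - j)) \<le> real ((N - j) choose (n - j))" by (rule of_nat_mono)
  then show ?thesis using choose_shift_le[OF assms] by linarith
qed

text \<open>Bounds entropy terms q ln(c/q) uniformly in \<open>q\<close>, so that no case
  distinction on the size of \<open>q\<close> is needed later.\<close>

lemma mult_ln_div_le: "q > 0 \<Longrightarrow> c > 0 \<Longrightarrow> q * ln (c / q) \<le> (c::real)"
proof -
  assume q: "q > 0" "c > 0"
  then have "ln (c / q) \<le> c / q" using ln_le_minus_one[of "c / q"] by simp
  then have "q * ln (c / q) \<le> q * (c / q)" using q by (intro mult_left_mono) auto
  then show ?thesis using q by simp
qed

section \<open>Exponential rates per vertex as the density tends to zero\<close>

lemma eventually_affine_sqrt_le:
  fixes A B c :: real
  assumes "c > 0"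
  shows "\<forall>\<^sub>F L in at_top. B + A * sqrt L \<le> c * L"
proof -
  define D where "D = \<bar>A\<bar> + \<bar>B\<bar>"
  have "\<forall>\<^sub>F L in at_top. L \<ge> max 1 ((D / c)\<^sup>2)" by (rule eventually_ge_at_top)
  then show ?thesis
  proof eventually_elim
    case (elim L)
    have s: "sqrt L \<ge> 1" "sqrt L * sqrt L = L" using elim by auto
    have "D / c \<le> sqrt L" using elim assms by (intro real_le_rsqrt) auto
    then have "D \<le> c * sqrt L" using assms by (simp add: divide_le_eq mult.commute)
    have "\<bar>B\<bar> * 1 \<le> \<bar>B\<bar> * sqrt L" using s by (intro mult_left_mono) auto
    moreover have "A * sqrt L \<le> \<bar>A\<bar> * sqrt L" using s by (intro mult_right_mono) auto
    ultimately have "B + A * sqrt L \<le> D * sqrt L" by (simp add: D_def algebra_simps)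
    also have "\<dots> \<le> (c * sqrt L) * sqrt L" using s \<open>D \<le> c * sqrt L\<close> by (intro mult_right_mono) auto
    finally show ?case using s by (simp add: mult.assoc)
  qed
qed

lemma filterlim_ln_inverse: "filterlim (\<lambda>\<rho>::real. ln (1 / \<rho>)) at_top (at_right 0)"
  by (rule filterlim_compose[OF ln_at_top]) (simp add: filterlim_inverse_at_top_right flip: inverse_eq_divide)

lemma eventually_at_right_0_powr_le:
  assumes "a > (b::real)" "c > 0"
  shows "\<forall>\<^sub>F \<rho> in at_right 0. \<rho> powr a \<le> c * \<rho> powr b"
proof -
  have "\<forall>\<^sub>F \<rho> in at_right (0::real). ln (1 / \<rho>) \<ge> ln (1 / c) / (a - b)"
    using filterlim_ln_inverse unfolding filterlim_at_top by blast
  moreover have "\<forall>\<^sub>F \<rho> in at_right (0::real). \<rho> > 0" by (rule eventually_at_right_less)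
  ultimately show ?thesis
  proof eventually_elim
    case (elim \<rho>)
    then have "ln (1 / c) \<le> ln (1 / \<rho>) * (a - b)" using assms by (simp add: divide_le_eq)
    then have "a * ln \<rho> \<le> ln c + b * ln \<rho>" using elim assms by (simp add: ln_div algebra_simps)
    then have "exp (a * ln \<rho>) \<le> exp (ln c + b * ln \<rho>)" by simp
    then show ?case using elim assms by (simp add: powr_def exp_add)
  qed
qed

text \<open>Pairs sharing a fraction \<open>q\<close> up to 1/10. Here \<open>l\<close> is the
  entropy lost per shared vertex; both \<open>l\<close> and \<open>L\<close> are about
  \<open>ln (1 / \<rho>)\<close>, and the terms in L q and sqrt L consume only a small part of
  \<open>l\<close>. What remains, q times 1 + ln(1/q) - (3/4) ln(1/\<rho>), is of order at most
  \<rho>^(3/4) whatever \<open>q\<close> is.\<close>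

lemma far_exponent:
  "\<forall>\<^sub>F \<rho> in at_right (0::real). \<forall>L l q. ln (1 / \<rho>) - 1 \<le> l \<and> l \<le> L \<and> L \<le> ln (1 / \<rho>) + 2 \<and> 0 < q \<and> q \<le> 1 / 10 \<longrightarrow>
     q * (1 + ln (1 / q) - l + L * q + 2 * sqrt (L * (q * (1 + ln (1 / q)) + \<rho>))) \<le> \<rho> powr (7 / 10)"
proof -
  have "\<forall>\<^sub>F L in at_top. 20 + 3 * sqrt L \<le> (1 / 20) * L" by (rule eventually_affine_sqrt_le) simp
  then obtain L0 where L0: "\<And>L. L \<ge> L0 \<Longrightarrow> 20 + 3 * sqrt L \<le> (1 / 20) * L"
    unfolding eventually_at_top_linorder by auto
  have "\<forall>\<^sub>F \<rho> in at_right (0::real). ln (1 / \<rho>) \<ge> max 10 (L0 + 1)"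
    using filterlim_ln_inverse unfolding filterlim_at_top by blast
  moreover have "\<forall>\<^sub>F \<rho> in at_right (0::real). \<rho> powr (3 / 4) \<le> exp (-1) * \<rho> powr (7 / 10)"
    by (intro eventually_at_right_0_powr_le) auto
  moreover have "\<forall>\<^sub>F \<rho> in at_right (0::real). \<rho> > 0 \<and> \<rho> < 1" by (simp add: eventually_at_right[of 0 1]) (auto intro: exI[of _ 1])
  ultimately show ?thesis
  proof (eventually_elim, intro allI impI)
    case (elim \<rho>)
    fix L l q :: real
    assume A: "ln (1 / \<rho>) - 1 \<le> l \<and> l \<le> L \<and> L \<le> ln (1 / \<rho>) + 2 \<and> 0 < q \<and> q \<le> 1 / 10"
    define r where "r = ln (1 / \<rho>)"
    have L: "L \<ge> L0" "L > 0" using A elim by (auto simp: r_def)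
    have q1: "q * (1 + ln (1 / q)) \<le> 1"
    proof -
      have "1 + ln (1 / q) \<le> 1 / q" using ln_le_minus_one[of "1 / q"] A by simp
      then have "q * (1 + ln (1 / q)) \<le> q * (1 / q)" using A by (intro mult_left_mono) auto
      then show ?thesis using A by simp
    qed
    have "L * (q * (1 + ln (1 / q)) + \<rho>) \<le> L * 2" using q1 elim L by (intro mult_left_mono) auto
    then have "sqrt (L * (q * (1 + ln (1 / q)) + \<rho>)) \<le> sqrt L * sqrt 2"
      by (simp flip: real_sqrt_mult)
    moreover have "sqrt L * sqrt 2 \<le> sqrt L * (3 / 2)"
      using L by (intro mult_left_mono real_le_lsqrt) (auto simp: power2_eq_square)
    moreover have "L * q \<le> L * (1 / 10)" using A L by (intro mult_left_mono) auto
    ultimately have "1 + ln (1 / q) - l + L * q + 2 * sqrt (L * (q * (1 + ln (1 / q)) + \<rho>)) \<le>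
        1 + ln (1 / q) - l + L / 10 + 3 * sqrt L" by simp
    also have "\<dots> \<le> 1 + ln (1 / q) - l + L / 10 + (L / 20 - 20)" using L0[OF L(1)] by simp
    also have "\<dots> \<le> 1 + ln (1 / q) - 3 / 4 * r" using A elim unfolding r_def[symmetric] by simp
    also have "\<dots> = ln (exp 1 * \<rho> powr (3 / 4) / q)"
      using A elim by (simp add: r_def ln_div ln_mult ln_powr)
    finally have "q * (1 + ln (1 / q) - l + L * q + 2 * sqrt (L * (q * (1 + ln (1 / q)) + \<rho>))) \<le>
        q * ln (exp 1 * \<rho> powr (3 / 4) / q)"
      using A by (intro mult_left_mono) auto
    also have "\<dots> \<le> exp 1 * \<rho> powr (3 / 4)" using A elim by (intro mult_ln_div_le) auto
    also have "\<dots> \<le> exp 1 * (exp (-1) * \<rho> powr (7 / 10))" using elim by (intro mult_left_mono) auto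
    also have "\<dots> = \<rho> powr (7 / 10)" by (simp add: exp_minus)
    finally show "q * (1 + ln (1 / q) - l + L * q + 2 * sqrt (L * (q * (1 + ln (1 / q)) + \<rho>))) \<le> \<rho> powr (7 / 10)" .
  qed
qed

text \<open>After completing the square the first claim says sqrt \<theta> < 1 - 1/sqrt 2, and the
  square of that number is 3/2 - sqrt 2.\<close>

lemma theta_gap:
  fixes \<theta> :: real
  assumes "0 < \<theta>" "\<theta> < 3 / 2 - sqrt 2"
  shows "2 * \<theta> + 2 * sqrt 2 * sqrt \<theta> < 1" "\<theta> < 1 / 10"
proof -
  have s: "sqrt 2 * sqrt 2 = (2::real)" by simp
  have "sqrt 2 > (14 / 10 :: real)" by (intro real_less_rsqrt) (simp add: power2_eq_square)
  then show "\<theta> < 1 / 10" using assms by simp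
  have "(sqrt 2 * sqrt \<theta>)\<^sup>2 < (sqrt 2 - 1)\<^sup>2"
    using assms by (simp add: power_mult_distrib power2_diff)
  then have "sqrt 2 * sqrt \<theta> < sqrt 2 - 1"
    by (rule power_less_imp_less_base) simp
  then show "2 * \<theta> + 2 * sqrt 2 * sqrt \<theta> < 1" using assms by simp
qed

text \<open>The condition \<open>\<theta> < 3 / 2 - sqrt 2\<close> is exactly what makes the middle range
  \<open>\<rho> powr \<theta> \<le> p\<close>, \<open>p\<close> small, work: it is equivalent to \<open>2 * \<theta> + 2 * sqrt 2 * sqrt \<theta> < 1\<close>.\<close>

lemma near_exponent:
  fixes \<theta> :: real
  assumes th: "0 < \<theta>" "\<theta> < 3 / 2 - sqrt 2"
  shows "\<forall>\<^sub>F \<rho> in at_right (0::real). \<forall>L p. ln (1 / \<rho>) - 1 \<le> L \<and> 0 < p \<and> p \<le> 9 / 10 \<longrightarrow>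
     - (p * (1 - p) * L) + 2 * (p * ln (1 / p)) + 2 * p + 2 * sqrt 2 * sqrt (L * (p * (p * (1 + ln (1 / p)) + \<rho>)))
       - 20 * \<rho> powr \<theta> * L * (1 - p)\<^sup>2 \<le> 0"
proof -
  \<comment> \<open>A slightly larger exponent still below the threshold; the margin
    \<open>(\<theta>' - \<theta>) * L\<close> absorbs the bounded terms.\<close>
  define \<theta>' where "\<theta>' = (\<theta> + (3 / 2 - sqrt 2)) / 2"
  have th': "0 < \<theta>'" "\<theta>' < 3 / 2 - sqrt 2" "\<theta> < \<theta>'" using th by (auto simp: \<theta>'_def)
  \<comment> \<open>Half the slack in \<open>theta_gap\<close> for \<theta>', so that 2 \<theta>' +
    2 sqrt 2 sqrt \<theta>' = 1 - 2 p1 stays below 1 - p for p \<le> p1.\<close>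
  define p1 where "p1 = (1 - (2 * \<theta>' + 2 * sqrt 2 * sqrt \<theta>')) / 2"
  have "2 * \<theta>' + 2 * sqrt 2 * sqrt \<theta>' > 0" using th' by (intro add_pos_pos) auto
  moreover have "2 * p1 = 1 - (2 * \<theta>' + 2 * sqrt 2 * sqrt \<theta>')" by (simp add: p1_def)
  ultimately have p1: "0 < p1" "p1 < 1 / 2" using theta_gap(1)[OF th'(1,2)] by linarith+
  define c where "c = ln (1 / p1)"
  have c: "c > 0" using p1 by (simp add: c_def)
  have "\<forall>\<^sub>F L in at_top. (2 * c + 2) + (2 * sqrt 2 * sqrt (2 + c)) * sqrt L \<le> (p1 / 10) * L"
    using p1 by (intro eventually_affine_sqrt_le) auto
  moreover have "\<forall>\<^sub>F L in at_top. (3::real) + 0 * sqrt L \<le> (\<theta>' - \<theta>) * L"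
    using th' by (intro eventually_affine_sqrt_le) auto
  moreover have "\<forall>\<^sub>F L in at_top. (4::real) + 0 * sqrt L \<le> (1 / 10) * L"
    by (intro eventually_affine_sqrt_le) auto
  ultimately have "\<forall>\<^sub>F L in at_top. (2 * c + 2) + (2 * sqrt 2 * sqrt (2 + c)) * sqrt L \<le> (p1 / 10) * L \<and>
      3 \<le> (\<theta>' - \<theta>) * L \<and> 4 \<le> (1 / 10) * L" by eventually_elim simp
  then obtain L0 where L0: "\<And>L. L \<ge> L0 \<Longrightarrow> (2 * c + 2) + (2 * sqrt 2 * sqrt (2 + c)) * sqrt L \<le> (p1 / 10) * L \<and>
      3 \<le> (\<theta>' - \<theta>) * L \<and> 4 \<le> (1 / 10) * L"
    unfolding eventually_at_top_linorder by auto
  have "\<forall>\<^sub>F \<rho> in at_right (0::real). ln (1 / \<rho>) \<ge> max 2 (L0 + 1)"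
    using filterlim_ln_inverse unfolding filterlim_at_top by blast
  moreover have "\<forall>\<^sub>F \<rho> in at_right (0::real). \<rho> powr \<theta> \<le> (1 / 2) * \<rho> powr 0"
    using th by (intro eventually_at_right_0_powr_le) auto
  moreover have "\<forall>\<^sub>F \<rho> in at_right (0::real). \<rho> > 0 \<and> \<rho> < 1" by (simp add: eventually_at_right[of 0 1]) (auto intro: exI[of _ 1])
  ultimately show ?thesis
  proof (eventually_elim, intro allI impI)
    case (elim \<rho>)
    fix L p :: real
    assume A: "ln (1 / \<rho>) - 1 \<le> L \<and> 0 < p \<and> p \<le> 9 / 10"
    define r where "r = ln (1 / \<rho>)"
    define t where "t = \<rho> powr \<theta>"
    have t: "0 < t" "t \<le> 1 / 2" using elim by (auto simp: t_def)
    have rho_t: "\<rho> \<le> t"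
      unfolding t_def using elim theta_gap(2)[OF th] powr_mono'[of \<theta> 1 \<rho>] by simp
    have L: "L \<ge> L0" "L > 0" "r \<ge> 2" "r - 1 \<le> L" using A elim by (auto simp: r_def)
    have l0: "(2 * c + 2) + (2 * sqrt 2 * sqrt (2 + c)) * sqrt L \<le> (p1 / 10) * L" "3 \<le> (\<theta>' - \<theta>) * L" "4 \<le> (1 / 10) * L"
      using L0[OF L(1)] by auto
    have lt: "ln (1 / t) = \<theta> * r" using elim by (simp add: t_def r_def ln_div ln_powr)
    have thr: "\<theta> * r \<le> \<theta> * L + \<theta>" using L th mult_left_mono[of r "L + 1" \<theta>] by (simp add: algebra_simps)
    have th1: "\<theta> < 1 / 10" by (rule theta_gap(2)[OF th])
    let ?S = "sqrt (L * (p * (p * (1 + ln (1 / p)) + \<rho>)))"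
    have lp: "ln (1 / p) > 0" using A by simp
    have sL: "sqrt (L * L) = L" using L by simp
    show "- (p * (1 - p) * L) + 2 * (p * ln (1 / p)) + 2 * p + 2 * sqrt 2 * ?S - 20 * \<rho> powr \<theta> * L * (1 - p)\<^sup>2 \<le> 0"
    proof -
      \<comment> \<open>Up to \<open>t\<close> the positive terms are of order t L and are paid by
        the last term: this is where the relative lowering 20 \<rho>^\<theta> of the squared level
        is spent. In the middle range ln(1/p) is at most about \<theta> L, and the inequality of
        \<open>theta_gap\<close> decides. Beyond \<open>p1\<close> a term of order L faces only
        terms of order sqrt L.\<close>
      consider "p \<le> t" | "t \<le> p" "p \<le> p1" | "p1 \<le> p" by linarith
      then show ?thesis
      proof cases
        case 1
        have "p * ln (1 / p) = p * ln (t / p) + p * ln (1 / t)"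
          using A t by (simp add: ln_div algebra_simps)
        also have "\<dots> \<le> t + t * (\<theta> * r)"
          unfolding lt using A t 1 th L by (intro add_mono mult_ln_div_le mult_right_mono) auto
        also have "\<dots> \<le> t + t * ((1 / 10) * L + \<theta>)"
        proof -
          have "\<theta> * L \<le> (1 / 10) * L" using th1 L by (intro mult_right_mono) auto
          then show ?thesis using thr t by (intro add_left_mono mult_left_mono) auto
        qed
        also have "\<dots> \<le> t * (2 + (1 / 10) * L)" using th1 t by (simp add: algebra_simps)
        finally have pl: "p * ln (1 / p) \<le> t * (2 + (1 / 10) * L)" .
        have "p * (1 + ln (1 / p)) + \<rho> \<le> t * (4 + (1 / 10) * L)"
          using pl 1 rho_t by (simp add: algebra_simps)
        also have "\<dots> \<le> t * ((2 / 10) * L)" using l0(3) t by (intro mult_left_mono) auto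
        finally have "p * (p * (1 + ln (1 / p)) + \<rho>) \<le> t * (t * ((2 / 10) * L))"
          using A 1 t lp elim by (intro mult_mono) auto
        also have "\<dots> \<le> t * (t * ((1 / 4) * L))" using t L by (intro mult_left_mono mult_right_mono) auto
        finally have "L * (p * (p * (1 + ln (1 / p)) + \<rho>)) \<le> L * (t * (t * ((1 / 4) * L)))"
          using L by (intro mult_left_mono) auto
        also have "\<dots> = (t * L / 2)\<^sup>2" by (simp add: power2_eq_square)
        finally have "?S \<le> t * L / 2" using t L by (intro real_le_lsqrt) auto
        moreover have "sqrt 2 \<le> (3 / 2 :: real)" by (intro real_le_lsqrt) (auto simp: power2_eq_square)
        ultimately have "sqrt 2 * ?S \<le> (3 / 2) * (t * L / 2)"
          using A L lp elim by (intro mult_mono) auto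
        moreover have "2 * p \<le> 2 * t" using 1 by simp
        moreover have "t * 4 \<le> t * ((1 / 10) * L)" using l0(3) t by (intro mult_left_mono) auto
        moreover have "20 * t * L * (1 / 4) \<le> 20 * t * L * (1 - p)\<^sup>2"
        proof (intro mult_left_mono)
          have "(1 / 2)\<^sup>2 \<le> (1 - p)\<^sup>2" using 1 t by (intro power_mono) auto
          then show "1 / 4 \<le> (1 - p)\<^sup>2" by (simp add: power2_eq_square)
        qed (use t L in auto)
        moreover have "p * (1 - p) * L \<ge> 0" using A L by simp
        moreover have "t * L > 0" using t L by simp
        ultimately show ?thesis using pl unfolding t_def[symmetric] by (simp add: algebra_simps)
      next
        case 2
        have "ln (1 / p) \<le> ln (1 / t)" using 2 t A by (subst ln_le_cancel_iff) (auto simp: frac_le)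
        then have lpt: "1 + ln (1 / p) + 1 \<le> \<theta>' * L"
          using thr l0(2) th1 unfolding lt by (simp add: algebra_simps)
        have "\<rho> \<le> p" using rho_t 2 by simp
        then have "p * (p * (1 + ln (1 / p)) + \<rho>) \<le> p * (p * (1 + ln (1 / p)) + p * 1)"
          using A by (intro mult_left_mono add_left_mono) auto
        also have "\<dots> = p * p * (1 + ln (1 / p) + 1)" by (simp add: algebra_simps)
        also have "\<dots> \<le> p * p * (\<theta>' * L)" using lpt A by (intro mult_left_mono) auto
        finally have "L * (p * (p * (1 + ln (1 / p)) + \<rho>)) \<le> L * (p * p * (\<theta>' * L))"
          using L by (intro mult_left_mono) auto
        also have "\<dots> = (p * L * sqrt \<theta>')\<^sup>2" using th' by (simp add: power2_eq_square)
        finally have "?S \<le> p * L * sqrt \<theta>'" using A L th' by (intro real_le_lsqrt) auto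
        then have "2 * sqrt 2 * ?S \<le> 2 * sqrt 2 * (p * L * sqrt \<theta>')" by (intro mult_left_mono) auto
        moreover have "2 * (p * ln (1 / p)) + 2 * p \<le> p * L * (2 * \<theta>')"
        proof -
          have "p * (1 + ln (1 / p)) \<le> p * (\<theta>' * L)" using lpt A by (intro mult_left_mono) auto
          then show ?thesis by (simp add: algebra_simps)
        qed
        moreover have "20 * t * L * (1 - p)\<^sup>2 \<ge> 0" using t L by simp
        moreover have "p * L * (2 * \<theta>' + 2 * sqrt 2 * sqrt \<theta>' - (1 - p)) \<le> 0"
          using 2 A L p1 by (intro mult_nonneg_nonpos) (auto simp: p1_def)
        moreover have "p * L * (2 * \<theta>' + 2 * sqrt 2 * sqrt \<theta>' - (1 - p)) =
            p * L * (2 * \<theta>') + 2 * sqrt 2 * (p * L * sqrt \<theta>') - p * (1 - p) * L"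
          by (simp add: algebra_simps)
        ultimately show ?thesis unfolding t_def[symmetric] by linarith
      next
        case 3
        have lpc: "ln (1 / p) \<le> c" unfolding c_def using 3 A p1 by (subst ln_le_cancel_iff) (auto simp: frac_le)
        have pc: "p * ln (1 / p) \<le> 1 * c" using A lpc lp by (intro mult_mono) auto
        have "p * (p * (1 + ln (1 / p)) + \<rho>) \<le> 1 * (1 * (1 + c) + 1)"
          using A lpc lp elim c by (intro mult_mono add_mono) auto
        then have "L * (p * (p * (1 + ln (1 / p)) + \<rho>)) \<le> L * (2 + c)" using L by (intro mult_left_mono) auto
        then have "?S \<le> sqrt (2 + c) * sqrt L" by (simp add: mult.commute flip: real_sqrt_mult)
        then have "2 * sqrt 2 * ?S \<le> 2 * sqrt 2 * (sqrt (2 + c) * sqrt L)" by (intro mult_left_mono) auto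
        moreover have "p1 * (1 / 10) * L \<le> p * (1 - p) * L"
          using 3 A L p1 by (intro mult_right_mono mult_mono) auto
        moreover have "20 * t * L * (1 - p)\<^sup>2 \<ge> 0" using t L by simp
        moreover have "(2 * c + 2) + 2 * sqrt 2 * (sqrt (2 + c) * sqrt L) \<le> p1 * (1 / 10) * L"
          using l0(1) by (simp add: mult_ac)
        ultimately show ?thesis using pc A unfolding t_def[symmetric] by linarith
      qed
    qed
  qed
qed


text \<open>Chosen so that b^2 n^2 / N = (1 - \<eta>) ln (N choose n). At \<eta> = 0 the tilted mean
  energy is 2 n sqrt(ln (N choose n) / N), the level at which the union bound over all sets stops
  being effective; \<eta> is the relative lowering of its square.\<close>

definition tilt_beta :: "real \<Rightarrow> nat \<Rightarrow> nat \<Rightarrow> real" where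
  "tilt_beta \<eta> N n = sqrt ((1 - \<eta>) * ln (real (N choose n)) * real N) / real n"

text \<open>Entropy of the pairs with intersection \<open>j\<close> relative to all pairs, plus the
  tilt and the truncation height. Values up to n \<rho>^(7/10) are tolerated: they cost a factor in
  the success probability that Gaussian concentration makes up for.\<close>

lemma pair_exponent:
  fixes \<theta> :: real
  assumes th: "0 < \<theta>" "\<theta> < 3 / 2 - sqrt 2"
  shows "\<forall>\<^sub>F \<rho> in at_right (0::real). \<forall>N n j. \<rho> / 2 \<le> real n / real N \<and> real n / real N \<le> 2 * \<rho> \<and> 0 < j \<and> j \<le> n \<longrightarrow>
     (let \<eta> = 20 * \<rho> powr \<theta>; \<Lambda> = ln (real (N choose n)); q = real j / real n in
      ln (real (n choose j)) + ln (real ((N - n) choose (n - j))) - \<Lambda> + (1 - \<eta>) * \<Lambda> * q\<^sup>2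
        + 2 * sqrt ((1 - \<eta>) * \<Lambda> * q\<^sup>2 * ((1 - q\<^sup>2) * (ln (real (n choose j)) + \<rho> * real n))) \<le> real n * \<rho> powr (7 / 10))"
proof -
  have "\<forall>\<^sub>F \<rho> in at_right (0::real). \<rho> powr \<theta> \<le> (1 / 20) * \<rho> powr 0"
    using th by (intro eventually_at_right_0_powr_le) auto
  moreover have "\<forall>\<^sub>F \<rho> in at_right (0::real). \<rho> > 0 \<and> \<rho> < 1 / 4"
    by (simp add: eventually_at_right[of 0 1]) (auto intro: exI[of _ "1 / 4"])
  ultimately show ?thesis
    using far_exponent near_exponent[OF th]
  proof (eventually_elim, intro allI impI)
    case (elim \<rho>)
    fix N n j :: nat
    assume A: "\<rho> / 2 \<le> real n / real N \<and> real n / real N \<le> 2 * \<rho> \<and> 0 < j \<and> j \<le> n"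
    define \<eta> where "\<eta> = 20 * \<rho> powr \<theta>"
    define \<Lambda> where "\<Lambda> = ln (real (N choose n))"
    define q where "q = real j / real n"
    define L where "L = \<Lambda> / real n"
    define l where "l = ln (real N / real n)"
    have n: "n > 0" using A by simp
    have N: "N > 0" using A elim n by (cases "N = 0") auto
    have nN2: "2 * real n \<le> real N"
    proof -
      have "real n / real N \<le> 1 / 2" using A elim by linarith
      then show ?thesis using N by (simp add: divide_le_eq)
    qed
    then have nN: "n \<le> N" "n \<le> N - n" by linarith+
    have eta: "0 \<le> \<eta>" "\<eta> \<le> 1" using elim by (auto simp: \<eta>_def)
    have Lam: "\<Lambda> = real n * L" using n by (simp add: L_def)
    have ll: "ln (1 / \<rho>) - 1 \<le> l" "l \<le> ln (1 / \<rho>) + 1"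
    proof -
      have ln2: "ln 2 \<le> (1::real)" using ln_le_minus_one[of "2::real"] by simp
      have "ln (real n / real N) \<le> ln (2 * \<rho>)" "ln (\<rho> / 2) \<le> ln (real n / real N)"
        using A elim n N by (auto intro!: ln_mono)
      then show "ln (1 / \<rho>) - 1 \<le> l" "l \<le> ln (1 / \<rho>) + 1"
        using elim n N ln2 by (simp_all add: l_def ln_div ln_mult)
    qed
    have "real n * l \<le> \<Lambda>" "\<Lambda> \<le> real n * (1 + l)"
      unfolding \<Lambda>_def l_def using ln_choose_ge[OF n nN(1)] ln_choose_le[OF n nN(1)] by auto
    then have lL: "l \<le> L" "L \<le> l + 1" using n unfolding Lam by auto
    have l_pos: "l > 0"
    proof -
      have "real N / real n \<ge> 2" using nN2 n by (simp add: le_divide_eq)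
      then show ?thesis unfolding l_def by (intro ln_gt_zero) simp
    qed
    have L: "L > 0" using lL l_pos by linarith
    have q: "0 < q" "q \<le> 1" using A n by (auto simp: q_def)
    have q2: "q\<^sup>2 \<le> 1" "0 \<le> q\<^sup>2" using q by (auto simp: power_le_one)
    have c_pos: "n choose j > 0" "(N - n) choose (n - j) > 0" using A nN by auto
    have c_ge: "0 \<le> ln (real (n choose j))" using c_pos by (intro ln_ge_zero) linarith
    have key: "ln (real (n choose j)) + ln (real ((N - n) choose (n - j))) - \<Lambda> + (1 - \<eta>) * \<Lambda> * q\<^sup>2
        + 2 * sqrt ((1 - \<eta>) * \<Lambda> * q\<^sup>2 * ((1 - q\<^sup>2) * (ln (real (n choose j)) + \<rho> * real n))) \<le> real n * \<rho> powr (7 / 10)"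
      (is "?A + ?B - \<Lambda> + ?C + 2 * sqrt ?D \<le> _")
    proof -
      \<comment> \<open>Small intersections use \<open>choose_inter_le\<close>, a penalty for each
        shared vertex; large ones are described by the fraction \<open>p\<close> of vertices that
        differ. At \<open>j = n\<close> the exponent is exactly
        \<open>- (\<eta> * \<Lambda>)\<close>.\<close>
      consider "q \<le> 1 / 10" | "q > 1 / 10" "j < n" | "j = n" using A by linarith
      then show ?thesis
      proof cases
        case 1
        have A1: "?A \<le> real n * (q * (1 + ln (1 / q)))"
          using ln_choose_le[of j n] A n by (simp add: q_def)
        have "real ((N - n) choose (n - j)) \<le> real (N choose n) * (real n / real N) ^ j"
          using A nN by (intro choose_inter_le) auto
        then have "?B \<le> ln (real (N choose n) * (real n / real N) ^ j)"
          using c_pos by (intro ln_mono) auto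
        also have "\<dots> = \<Lambda> - real n * (q * l)"
          using n N nN by (simp add: ln_mult ln_realpow \<Lambda>_def q_def l_def ln_div algebra_simps)
        finally have B1: "?B \<le> \<Lambda> - real n * (q * l)" .
        have C1: "?C \<le> real n * (L * q\<^sup>2)"
          unfolding Lam using eta n L q2 mult_right_mono[of "1 - \<eta>" 1 "real n * L * q\<^sup>2"] by (simp add: mult_ac)
        have "?D \<le> 1 * \<Lambda> * q\<^sup>2 * (1 * (real n * (q * (1 + ln (1 / q))) + \<rho> * real n))"
          using eta A1 c_ge q2 L n elim unfolding Lam by (intro mult_mono add_mono) auto
        also have "\<dots> = (real n * q)\<^sup>2 * (L * (q * (1 + ln (1 / q)) + \<rho>))"
          unfolding Lam by (simp add: power2_eq_square algebra_simps)
        finally have "sqrt ?D \<le> real n * q * sqrt (L * (q * (1 + ln (1 / q)) + \<rho>))"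
          using n q by (subst (asm) real_sqrt_le_iff[symmetric]) (simp add: real_sqrt_mult)
        then have "?A + ?B - \<Lambda> + ?C + 2 * sqrt ?D \<le>
            real n * (q * (1 + ln (1 / q) - l + L * q + 2 * sqrt (L * (q * (1 + ln (1 / q)) + \<rho>))))"
          using A1 B1 C1 by (simp add: algebra_simps power2_eq_square)
        also have "\<dots> \<le> real n * \<rho> powr (7 / 10)"
          using elim(3) 1 q ll lL by (intro mult_left_mono) auto
        finally show ?thesis .
      next
        case 2
        define p where "p = real (n - j) / real n"
        have p: "0 < p" "p \<le> 9 / 10" "q = 1 - p" "p < 1"
          using 2 n q by (auto simp: p_def q_def field_simps of_nat_diff)
        have "n choose j = n choose (n - j)" using A by (simp add: binomial_symmetric[of j n])
        then have A1: "?A \<le> real n * (p * (1 + ln (1 / p)))"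
          using ln_choose_le[of "n - j" n] 2 n by (simp add: p_def)
        have "?B \<le> real (n - j) * (1 + ln (real (N - n) / real (n - j)))"
          using 2 nN by (intro ln_choose_le) auto
        also have "\<dots> \<le> real (n - j) * (1 + ln (real N / real (n - j)))"
          using 2 nN n by (intro mult_left_mono add_left_mono ln_mono divide_right_mono) auto
        also have "\<dots> = real n * (p * (1 + l + ln (1 / p)))"
          using 2 n N by (simp add: p_def l_def ln_div)
        finally have B1: "?B \<le> real n * (p * (1 + l + ln (1 / p)))" .
        have "p * l \<le> p * L" using lL p by (intro mult_left_mono) auto
        then have B2: "?B \<le> real n * (p * (1 + ln (1 / p)) + p * L)"
          using B1 n mult_left_mono[of "p * (1 + l + ln (1 / p))" "p * (1 + ln (1 / p)) + p * L" "real n"]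
          by (simp add: algebra_simps)
        have "1 - q\<^sup>2 \<le> 2 * p" unfolding p(3) by (simp add: power2_eq_square algebra_simps)
        then have "?D \<le> 1 * \<Lambda> * 1 * ((2 * p) * (real n * (p * (1 + ln (1 / p))) + \<rho> * real n))"
          using eta A1 c_ge q2 L n elim p unfolding Lam by (intro mult_mono add_mono) auto
        also have "\<dots> = (real n)\<^sup>2 * (2 * (L * (p * (p * (1 + ln (1 / p)) + \<rho>))))"
          unfolding Lam by (simp add: power2_eq_square algebra_simps)
        finally have "sqrt ?D \<le> real n * (sqrt 2 * sqrt (L * (p * (p * (1 + ln (1 / p)) + \<rho>))))"
          using n by (subst (asm) real_sqrt_le_iff[symmetric]) (simp add: real_sqrt_mult)
        \<comment> \<open>Apart from the \<eta> term, the coefficients of \<open>L\<close> combine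
          to -1 + (1 - p)^2 + p = - p (1 - p).\<close>
        then have "?A + ?B - \<Lambda> + ?C + 2 * sqrt ?D \<le>
            real n * (- (p * (1 - p) * L) + 2 * (p * ln (1 / p)) + 2 * p + 2 * sqrt 2 * sqrt (L * (p * (p * (1 + ln (1 / p)) + \<rho>)))
               - \<eta> * L * (1 - p)\<^sup>2)"
          using A1 B2 unfolding Lam p(3) by (simp add: algebra_simps power2_eq_square)
        also have "\<dots> \<le> real n * 0"
          using elim(4) p ll lL unfolding \<eta>_def by (intro mult_left_mono) auto
        also have "\<dots> \<le> real n * \<rho> powr (7 / 10)" by simp
        finally show ?thesis .
      next
        case 3
        then have "q = 1" using n by (simp add: q_def)
        moreover have "\<eta> * \<Lambda> \<ge> 0" using eta L n by (simp add: Lam)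
        moreover have "0 \<le> real n * \<rho> powr (7 / 10)" by simp
        ultimately have "- (\<eta> * \<Lambda>) \<le> real n * \<rho> powr (7 / 10)" by linarith
        then show ?thesis using 3 \<open>q = 1\<close> by (simp add: algebra_simps)
      qed
    qed
    show "let \<eta> = 20 * \<rho> powr \<theta>; \<Lambda> = ln (real (N choose n)); q = real j / real n in
      ln (real (n choose j)) + ln (real ((N - n) choose (n - j))) - \<Lambda> + (1 - \<eta>) * \<Lambda> * q\<^sup>2
        + 2 * sqrt ((1 - \<eta>) * \<Lambda> * q\<^sup>2 * ((1 - q\<^sup>2) * (ln (real (n choose j)) + \<rho> * real n))) \<le> real n * \<rho> powr (7 / 10)"
      using key unfolding Let_def \<eta>_def \<Lambda>_def q_def .
  qed
qed

text \<open>\<open>pair_exponent\<close> in exponentiated form, shaped as the hypothesis on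
  \<open>B\<close> in \<open>second_moment_lower_bound\<close>. The factor from \<delta> is carried
  along, and \<open>j = 0\<close> is treated directly since the exponent bound starts at 1.\<close>

lemma pair_weight_bound:
  fixes \<theta> :: real
  assumes th: "0 < \<theta>" "\<theta> < 3 / 2 - sqrt 2"
  shows "\<forall>\<^sub>F \<rho> in at_right (0::real). \<forall>N n j. \<forall>\<delta>\<ge>0. \<rho> / 2 \<le> real n / real N \<and> real n / real N \<le> 2 * \<rho> \<and> 0 < n \<and> j \<le> n \<longrightarrow>
     (let b = tilt_beta (20 * \<rho> powr \<theta>) N n in
      real ((n choose j) * ((N - n) choose (n - j))) *
        exp (b\<^sup>2 * (real j)\<^sup>2 / real N + b * \<delta> * real N + b * trunc_height N n \<rho> j)
      \<le> exp (real n * \<rho> powr (7 / 10) + b * \<delta> * real N) * real (N choose n))"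
proof -
  have "\<forall>\<^sub>F \<rho> in at_right (0::real). \<rho> powr \<theta> \<le> (1 / 20) * \<rho> powr 0"
    using th by (intro eventually_at_right_0_powr_le) auto
  moreover have "\<forall>\<^sub>F \<rho> in at_right (0::real). \<rho> > 0 \<and> \<rho> < 1 / 4"
    by (simp add: eventually_at_right[of 0 1]) (auto intro: exI[of _ "1 / 4"])
  ultimately show ?thesis
    using pair_exponent[OF th]
  proof (eventually_elim, intro allI impI)
    case (elim \<rho>)
    fix N n j :: nat and \<delta> :: real
    assume d: "\<delta> \<ge> 0" and A: "\<rho> / 2 \<le> real n / real N \<and> real n / real N \<le> 2 * \<rho> \<and> 0 < n \<and> j \<le> n"
    define \<eta> where "\<eta> = 20 * \<rho> powr \<theta>"
    define \<Lambda> where "\<Lambda> = ln (real (N choose n))"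
    define b where "b = tilt_beta \<eta> N n"
    have n: "n > 0" using A by simp
    have N: "N > 0" using A elim n by (cases "N = 0") auto
    have nN2: "2 * real n \<le> real N"
    proof -
      have "real n / real N \<le> 1 / 2" using A elim by linarith
      then show ?thesis using N by (simp add: divide_le_eq)
    qed
    then have nN: "n \<le> N" "n \<le> N - n" by linarith+
    have C: "N choose n > 0" "n choose j > 0" "(N - n) choose (n - j) > 0" using A nN by auto
    have Lam: "\<Lambda> \<ge> 0" unfolding \<Lambda>_def using C by (intro ln_ge_zero) linarith
    have eta: "0 \<le> \<eta>" "\<eta> \<le> 1" using elim by (auto simp: \<eta>_def)
    have b0: "b \<ge> 0" unfolding b_def tilt_beta_def using eta Lam by (simp add: \<Lambda>_def)
    have b2: "b\<^sup>2 = (1 - \<eta>) * \<Lambda> * real N / (real n)\<^sup>2"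
      unfolding b_def tilt_beta_def \<Lambda>_def[symmetric] using eta Lam by (simp add: power_divide)
    have "real ((n choose j) * ((N - n) choose (n - j))) * exp (b\<^sup>2 * (real j)\<^sup>2 / real N + b * trunc_height N n \<rho> j)
       \<le> exp (real n * \<rho> powr (7 / 10)) * real (N choose n)"
    proof (cases "j = 0")
      case True
      have "real ((N - n) choose n) \<le> real (N choose n)" by (intro of_nat_mono binomial_right_mono) auto
      moreover have "1 * real (N choose n) \<le> exp (real n * \<rho> powr (7 / 10)) * real (N choose n)"
        by (intro mult_right_mono) auto
      ultimately show ?thesis using True by (simp add: trunc_height_def)
    next
      case False
      define q where "q = real j / real n"
      have e1: "b\<^sup>2 * (real j)\<^sup>2 / real N = (1 - \<eta>) * \<Lambda> * q\<^sup>2"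
        unfolding b2 q_def using N n by (simp add: power_divide)
      have "b * sqrt ((1 - q\<^sup>2) * (real j)\<^sup>2 * (ln (real (n choose j)) + \<rho> * real n) / real N) =
          sqrt (b\<^sup>2 * ((1 - q\<^sup>2) * (real j)\<^sup>2 * (ln (real (n choose j)) + \<rho> * real n) / real N))"
      proof -
        have "b * sqrt y = sqrt (b\<^sup>2 * y)" for y using b0 by (simp add: real_sqrt_mult)
        then show ?thesis by blast
      qed
      also have "b\<^sup>2 * ((1 - q\<^sup>2) * (real j)\<^sup>2 * (ln (real (n choose j)) + \<rho> * real n) / real N) =
          (b\<^sup>2 * (real j)\<^sup>2 / real N) * ((1 - q\<^sup>2) * (ln (real (n choose j)) + \<rho> * real n))"
        by (simp add: mult_ac)
      finally have e2: "b * trunc_height N n \<rho> j = 2 * sqrt ((1 - \<eta>) * \<Lambda> * q\<^sup>2 * ((1 - q\<^sup>2) * (ln (real (n choose j)) + \<rho> * real n)))"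
        unfolding trunc_height_def q_def[symmetric] e1 by simp
      have "ln (real (n choose j)) + ln (real ((N - n) choose (n - j))) - \<Lambda> + (1 - \<eta>) * \<Lambda> * q\<^sup>2
        + 2 * sqrt ((1 - \<eta>) * \<Lambda> * q\<^sup>2 * ((1 - q\<^sup>2) * (ln (real (n choose j)) + \<rho> * real n))) \<le> real n * \<rho> powr (7 / 10)"
        using elim(3)[rule_format, of n N j] A False unfolding Let_def \<eta>_def \<Lambda>_def q_def by simp
      then have "exp (ln (real (n choose j)) + ln (real ((N - n) choose (n - j))) + (b\<^sup>2 * (real j)\<^sup>2 / real N + b * trunc_height N n \<rho> j))
          \<le> exp (real n * \<rho> powr (7 / 10) + \<Lambda>)"
        unfolding e1 e2 by simp
      then show ?thesis using C by (simp add: exp_add \<Lambda>_def)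
    qed
    then have "real ((n choose j) * ((N - n) choose (n - j))) * exp (b\<^sup>2 * (real j)\<^sup>2 / real N + b * trunc_height N n \<rho> j) * exp (b * \<delta> * real N)
       \<le> exp (real n * \<rho> powr (7 / 10)) * real (N choose n) * exp (b * \<delta> * real N)"
      by (intro mult_right_mono) auto
    then show "let b = tilt_beta (20 * \<rho> powr \<theta>) N n in
      real ((n choose j) * ((N - n) choose (n - j))) *
        exp (b\<^sup>2 * (real j)\<^sup>2 / real N + b * \<delta> * real N + b * trunc_height N n \<rho> j)
      \<le> exp (real n * \<rho> powr (7 / 10) + b * \<delta> * real N) * real (N choose n)"
      unfolding Let_def b_def[symmetric] \<eta>_def[symmetric] by (simp add: exp_add mult_ac)
  qed
qed

section \<open>The barrier at small overlap\<close>

definition cross_sum :: "(nat \<Rightarrow> nat \<Rightarrow> real) \<Rightarrow> nat set \<Rightarrow> nat set \<Rightarrow> real" where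
  "cross_sum w X Y = (\<Sum>i\<in>X. \<Sum>j\<in>Y. w i j)"

text \<open>Rectangle and diagonal sums are what averages over swaps involve. The threshold comes
  from a union bound: each form has coefficients of squared norm at most N^2, so it exceeds 6 N with
  probability at most exp(-9 N), against at most 4 * 4^N signed forms.\<close>

definition tame_matrix :: "nat \<Rightarrow> (nat \<Rightarrow> nat \<Rightarrow> real) \<Rightarrow> bool" where
  "tame_matrix N w \<longleftrightarrow> (\<forall>X\<in>Pow {..<N}. \<forall>Y\<in>Pow {..<N}. \<bar>cross_sum w X Y\<bar> \<le> 6 * real N) \<and>
     (\<forall>X\<in>Pow {..<N}. \<bar>\<Sum>i\<in>X. w i i\<bar> \<le> 6 * real N)"

definition level_set :: "nat \<Rightarrow> nat \<Rightarrow> nat set \<Rightarrow> nat \<Rightarrow> nat set set" where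
  "level_set N n V k = {X\<in>subsets N n. card (V \<inter> X) = k}"

lemma finite_level_set [simp]: "finite (level_set N n V k)"
  by (simp add: level_set_def)

lemma energy_swap:
  assumes "finite X" "i \<in> X" "u \<notin> X" and sym: "\<And>j. j \<in> insert u X \<Longrightarrow> w i j = w j i \<and> w u j = w j u"
  shows "energy w (insert u (X - {i})) = energy w X - 2 * (\<Sum>l\<in>X. w i l) + w i i
    + 2 * (\<Sum>l\<in>X. w u l) - 2 * w u i + w u u"
proof -
  let ?Y = "X - {i}"
  have fin: "finite ?Y" using assms by simp
  have ins: "energy w (insert a A) = energy w A + (\<Sum>l\<in>A. w a l) + (\<Sum>l\<in>A. w l a) + w a a"
    if "finite A" "a \<notin> A" for a A
    using that by (simp add: energy_def sum.distrib)
  have "energy w X = energy w ?Y + (\<Sum>l\<in>?Y. w i l) + (\<Sum>l\<in>?Y. w l i) + w i i"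
    using ins[of ?Y i] fin insert_Diff[OF assms(2)] by simp
  moreover have "(\<Sum>l\<in>?Y. w l i) = (\<Sum>l\<in>?Y. w i l)"
  proof (rule sum.cong[OF refl])
    fix l assume "l \<in> ?Y"
    then show "w l i = w i l" using sym[of l] by simp
  qed
  moreover have "(\<Sum>l\<in>X. w i l) = w i i + (\<Sum>l\<in>?Y. w i l)" by (rule sum.remove[OF assms(1,2)])
  moreover have "energy w (insert u ?Y) = energy w ?Y + (\<Sum>l\<in>?Y. w u l) + (\<Sum>l\<in>?Y. w l u) + w u u"
    using assms(3) fin by (intro ins) auto
  moreover have "(\<Sum>l\<in>?Y. w l u) = (\<Sum>l\<in>?Y. w u l)"
  proof (rule sum.cong[OF refl])
    fix l assume "l \<in> ?Y"
    then show "w l u = w u l" using sym[of l] by simp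
  qed
  moreover have "(\<Sum>l\<in>X. w u l) = w u i + (\<Sum>l\<in>?Y. w u l)" by (rule sum.remove[OF assms(1,2)])
  ultimately show ?thesis by simp
qed

text \<open>A single swap may be costly, but summed over all m^2 swaps the row sums turn into
  rectangle and diagonal sums of size at most 6 N. The constant is 48 = 8 * 6, from weights 2 + 1 +
  2 + 2 + 1 of the five sums; the mean cost per swap is thus O(N/m).\<close>

lemma sum_energy_swap_ge:
  assumes tame: "tame_matrix N w" and sym: "\<And>i j. i < N \<Longrightarrow> j < N \<Longrightarrow> w i j = w j i"
    and X: "X \<subseteq> {..<N}" and V: "V \<subseteq> {..<N}" and m: "card (X - V) = m" "card (V - X) = m" "m > 0"
  shows "(\<Sum>(i, u)\<in>(X - V) \<times> (V - X). energy w (insert u (X - {i})) - energy w X) \<ge> - 48 * real N * real m"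
proof -
  let ?R = "X - V" and ?U = "V - X"
  have fin: "finite X" "finite V" using X V finite_subset by auto
  have sw: "energy w (insert u (X - {i})) - energy w X = - 2 * (\<Sum>l\<in>X. w i l) + w i i
    + 2 * (\<Sum>l\<in>X. w u l) - 2 * w u i + w u u" if "i \<in> ?R" "u \<in> ?U" for i u
  proof -
    have "energy w (insert u (X - {i})) = energy w X - 2 * (\<Sum>l\<in>X. w i l) + w i i
       + 2 * (\<Sum>l\<in>X. w u l) - 2 * w u i + w u u"
      using that X V fin by (intro energy_swap) (auto intro!: sym)
    then show ?thesis by simp
  qed
  have "(\<Sum>(i, u)\<in>?R \<times> ?U. energy w (insert u (X - {i})) - energy w X) =
      (\<Sum>i\<in>?R. \<Sum>u\<in>?U. - 2 * (\<Sum>l\<in>X. w i l) + w i i + 2 * (\<Sum>l\<in>X. w u l) - 2 * w u i + w u u)"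
    unfolding sum.cartesian_product[symmetric] by (intro sum.cong refl) (simp add: sw)
  also have "\<dots> = (\<Sum>i\<in>?R. \<Sum>u\<in>?U. - 2 * (\<Sum>l\<in>X. w i l)) + (\<Sum>i\<in>?R. \<Sum>u\<in>?U. w i i)
      + (\<Sum>i\<in>?R. \<Sum>u\<in>?U. 2 * (\<Sum>l\<in>X. w u l)) - (\<Sum>i\<in>?R. \<Sum>u\<in>?U. 2 * w u i) + (\<Sum>i\<in>?R. \<Sum>u\<in>?U. w u u)"
    by (simp only: sum.distrib sum_subtractf)
  also have "\<dots> = - 2 * real m * cross_sum w ?R X + real m * (\<Sum>i\<in>?R. w i i)
      + 2 * real m * cross_sum w ?U X - 2 * cross_sum w ?U ?R + real m * (\<Sum>u\<in>?U. w u u)"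
    unfolding cross_sum_def
    by (subst (8) sum.swap) (simp add: m sum_distrib_left sum_negf mult_ac)
  also have "\<dots> \<ge> - 48 * real N * real m"
  proof -
    have b: "\<bar>cross_sum w ?R X\<bar> \<le> 6 * real N" "\<bar>cross_sum w ?U X\<bar> \<le> 6 * real N" "\<bar>cross_sum w ?U ?R\<bar> \<le> 6 * real N"
      "\<bar>\<Sum>i\<in>?R. w i i\<bar> \<le> 6 * real N" "\<bar>\<Sum>u\<in>?U. w u u\<bar> \<le> 6 * real N"
      using tame X V unfolding tame_matrix_def by blast+
    have s1: "- (real m * (6 * real N)) \<le> real m * y" and s2: "real m * y \<le> real m * (6 * real N)"
      if "\<bar>y\<bar> \<le> 6 * real N" for y
      using that mult_left_mono[of y "6 * real N" "real m"] mult_left_mono[of "- (6 * real N)" y "real m"] by auto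
    have "real m * (6 * real N) \<ge> 1 * (6 * real N)" using m by (intro mult_right_mono) auto
    moreover have "- 48 * real N * real m = - 8 * (real m * (6 * real N))"
      "- 2 * real m * cross_sum w ?R X = - 2 * (real m * cross_sum w ?R X)"
      "2 * real m * cross_sum w ?U X = 2 * (real m * cross_sum w ?U X)" by simp_all
    ultimately show ?thesis using s2[OF b(1)] s1[OF b(2)] s1[OF b(4)] s1[OF b(5)] b(3) by linarith
  qed
  finally show ?thesis .
qed

text \<open>Jensen's inequality through the tangent of exp at \<open>- c\<close>.\<close>

lemma exp_mean_ge:
  fixes f :: "'a \<Rightarrow> real"
  assumes "finite A" and "(\<Sum>x\<in>A. f x) \<ge> - c * real (card A)"
  shows "(\<Sum>x\<in>A. exp (f x)) \<ge> real (card A) * exp (- c)"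
proof -
  have "real (card A) * exp (- c) \<le> (\<Sum>x\<in>A. exp (- c) * (1 + (f x + c)))"
    using assms by (simp add: sum_distrib_left[symmetric] sum.distrib mult_left_mono mult.commute)
  also have "\<dots> \<le> (\<Sum>x\<in>A. exp (- c) * exp (f x + c))"
    by (intro sum_mono mult_left_mono exp_ge_add_one_self) auto
  also have "\<dots> = (\<Sum>x\<in>A. exp (f x))" by (simp add: exp_add[symmetric])
  finally show ?thesis .
qed

text \<open>Averaging over all swaps costs only a bounded factor \<open>exp (- c)\<close> in energy, whereas near overlap
  zero the number of swaps that raise the overlap is much larger than the number that lower it.\<close>

lemma level_sum_step:
  fixes \<beta> lam :: real
  assumes tame: "tame_matrix N w" and sym: "\<And>i j. i < N \<Longrightarrow> j < N \<Longrightarrow> w i j = w j i"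
    and V: "V \<in> subsets N n" and k: "k < n" and lam: "lam \<ge> 0" and \<beta>: "\<beta> \<ge> 0"
  defines "H X \<equiv> energy w X + lam * (real (card (V \<inter> X)))\<^sup>2"
  shows "real (n - k) ^ 2 * exp (- \<beta> * 48 * real N / real (n - k)) * (\<Sum>X\<in>level_set N n V k. exp (\<beta> * H X))
    \<le> real (k + 1) * real N * (\<Sum>X\<in>level_set N n V (Suc k). exp (\<beta> * H X))"
proof -
  let ?m = "n - k"
  have V': "V \<subseteq> {..<N}" "card V = n" "finite V" using V by (auto simp: subsets_def intro: finite_subset)
  define sw where "sw X p = insert (snd p) (X - {fst p})" for X :: "nat set" and p
  define P where "P X = (X - V) \<times> (V - X)" for X
  have LX: "X \<subseteq> {..<N}" "finite X" "card (X - V) = ?m" "card (V - X) = ?m" "card (V \<inter> X) = k" "card X = n"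
    if "X \<in> level_set N n V k" for X
  proof -
    show X: "X \<subseteq> {..<N}" "card (V \<inter> X) = k" "card X = n" using that by (auto simp: level_set_def subsets_def)
    show fin: "finite X" using X finite_subset by auto
    show "card (X - V) = ?m" "card (V - X) = ?m"
      using X fin V' by (simp_all add: card_Diff_subset_Int Int_commute)
  qed
  have swL: "sw X p \<in> level_set N n V (Suc k)" "V \<inter> sw X p = insert (snd p) (V \<inter> X)" if "X \<in> level_set N n V k" "p \<in> P X" for X p
  proof -
    obtain i u where "p = (i, u)" by (cases p)
    with that(2) have p: "p = (i, u)" "i \<in> X" "i \<notin> V" "u \<in> V" "u \<notin> X" by (auto simp: P_def)
    have "card (insert u (X - {i})) = Suc (card (X - {i}))" using LX[OF that(1)] p by simp
    also have "\<dots> = n" using LX[OF that(1)] p k by (simp add: card_Suc_Diff1)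
    finally have c: "card (insert u (X - {i})) = n" .
    show e: "V \<inter> sw X p = insert (snd p) (V \<inter> X)" using p by (auto simp: sw_def)
    have "card (V \<inter> sw X p) = Suc k" unfolding e using LX[OF that(1)] p by simp
    then show "sw X p \<in> level_set N n V (Suc k)"
      using c p LX[OF that(1)] V' by (auto simp: level_set_def subsets_def sw_def)
  qed
  have finP: "finite (P X)" "card (P X) = ?m * ?m" if "X \<in> level_set N n V k" for X
    using LX[OF that] V' by (auto simp: P_def card_cartesian_product)
  have one: "real ?m ^ 2 * exp (- \<beta> * 48 * real N / real ?m) * exp (\<beta> * H X) \<le> (\<Sum>p\<in>P X. exp (\<beta> * H (sw X p)))"
    if X: "X \<in> level_set N n V k" for X
  proof -
    \<comment> \<open>The swap raises the overlap, so the spike term can only help and the bare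
      noise energy gives a lower bound.\<close>
    have H: "\<beta> * (energy w (sw X p) - energy w X) \<le> \<beta> * (H (sw X p) - H X)" if "p \<in> P X" for p
    proof -
      have "card (V \<inter> X) \<le> card (V \<inter> sw X p)"
        using swL[OF X that] LX[OF X] by (simp add: level_set_def)
      then have "lam * (real (card (V \<inter> X)))\<^sup>2 \<le> lam * (real (card (V \<inter> sw X p)))\<^sup>2"
        using lam by (intro mult_left_mono power_mono) auto
      then show ?thesis unfolding H_def using \<beta> by (intro mult_left_mono) auto
    qed
    have "- (\<beta> * 48 * real N / real ?m) * real (card (P X)) = \<beta> * (- 48 * real N * real ?m)"
      using k unfolding finP(2)[OF X] by (simp add: field_simps)
    also have "\<dots> \<le> \<beta> * (\<Sum>(i, u)\<in>(X - V) \<times> (V - X). energy w (insert u (X - {i})) - energy w X)"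
      using \<beta> k LX[OF X] V' by (intro mult_left_mono sum_energy_swap_ge tame sym) auto
    also have "\<dots> = (\<Sum>p\<in>P X. \<beta> * (energy w (sw X p) - energy w X))"
      by (simp add: sum_distrib_left P_def sw_def case_prod_beta')
    also have "\<dots> \<le> (\<Sum>p\<in>P X. \<beta> * (H (sw X p) - H X))" by (intro sum_mono H)
    finally have "real (card (P X)) * exp (- (\<beta> * 48 * real N / real ?m)) \<le> (\<Sum>p\<in>P X. exp (\<beta> * (H (sw X p) - H X)))"
      by (intro exp_mean_ge finP X)
    then have "real (card (P X)) * exp (- (\<beta> * 48 * real N / real ?m)) * exp (\<beta> * H X) \<le>
        (\<Sum>p\<in>P X. exp (\<beta> * (H (sw X p) - H X))) * exp (\<beta> * H X)" by (intro mult_right_mono) auto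
    also have "\<dots> = (\<Sum>p\<in>P X. exp (\<beta> * H (sw X p)))"
      unfolding sum_distrib_right exp_add[symmetric] by (intro sum.cong refl) (simp add: algebra_simps)
    finally show ?thesis unfolding finP(2)[OF X] by (simp add: power2_eq_square)
  qed
  \<comment> \<open>Double counting: a swap is recovered from its result \<open>Y\<close> and the
    two exchanged vertices. The entering vertex lies in \<open>V \<inter> Y\<close>, of size k + 1;
    for the leaving one all \<open>N\<close> indices are allowed, a crude count that suffices near
    overlap zero.\<close>
  define Q where "Q Y = {..<N} \<times> (V \<inter> Y)" for Y
  have "real ?m ^ 2 * exp (- \<beta> * 48 * real N / real ?m) * (\<Sum>X\<in>level_set N n V k. exp (\<beta> * H X))
      \<le> (\<Sum>X\<in>level_set N n V k. \<Sum>p\<in>P X. exp (\<beta> * H (sw X p)))"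
    unfolding sum_distrib_left by (intro sum_mono one)
  also have "\<dots> = (\<Sum>(X, p)\<in>Sigma (level_set N n V k) P. exp (\<beta> * H (sw X p)))"
    using finP by (intro sum.Sigma) auto
  also have "\<dots> = (\<Sum>(Y, p)\<in>(\<lambda>(X, p). (sw X p, p)) ` Sigma (level_set N n V k) P. exp (\<beta> * H Y))"
  proof -
    have "inj_on (\<lambda>(X, p). (sw X p, p)) (Sigma (level_set N n V k) P)"
    proof (rule inj_onI)
      fix x y assume x: "x \<in> Sigma (level_set N n V k) P" and y: "y \<in> Sigma (level_set N n V k) P"
        and eq: "(\<lambda>(X, p). (sw X p, p)) x = (\<lambda>(X, p). (sw X p, p)) y"
      obtain X X' a b where xy: "x = (X, a, b)" "y = (X', a, b)" "sw X (a, b) = sw X' (a, b)"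
        using eq by (cases x; cases y) auto
      have "X = insert a (sw X (a, b) - {b})" "X' = insert a (sw X' (a, b) - {b})"
        using x y xy(1,2) by (auto simp: P_def sw_def)
      then show "x = y" using xy by simp
    qed
    then show ?thesis by (simp add: sum.reindex case_prod_beta')
  qed
  also have "\<dots> \<le> (\<Sum>(Y, p)\<in>Sigma (level_set N n V (Suc k)) Q. exp (\<beta> * H Y))"
  proof (rule sum_mono2)
    show "finite (Sigma (level_set N n V (Suc k)) Q)" using V' by (auto simp: Q_def)
    show "(\<lambda>(X, p). (sw X p, p)) ` Sigma (level_set N n V k) P \<subseteq> Sigma (level_set N n V (Suc k)) Q"
    proof (rule subsetI)
      fix z assume "z \<in> (\<lambda>(X, p). (sw X p, p)) ` Sigma (level_set N n V k) P"
      then obtain X p where z: "z = (sw X p, p)" and X: "X \<in> level_set N n V k" and p: "p \<in> P X" by auto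
      have "sw X p \<in> level_set N n V (Suc k)" by (rule swL[OF X p])
      moreover have "p \<in> Q (sw X p)" using p LX[OF X] by (auto simp: P_def Q_def sw_def)
      ultimately show "z \<in> Sigma (level_set N n V (Suc k)) Q" using z by simp
    qed
  qed auto
  also have "\<dots> = (\<Sum>Y\<in>level_set N n V (Suc k). \<Sum>p\<in>Q Y. exp (\<beta> * H Y))"
    using V' by (intro sum.Sigma[symmetric]) (auto simp: Q_def)
  also have "\<dots> = (\<Sum>Y\<in>level_set N n V (Suc k). real (k + 1) * real N * exp (\<beta> * H Y))"
    by (intro sum.cong refl) (simp add: Q_def card_cartesian_product level_set_def algebra_simps)
  finally show ?thesis by (simp add: sum_distrib_left)
qed

text \<open>Up to level \<epsilon> N each step at least doubles the level sum. There n - k \<ge>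
  \<rho> N / 4, which turns the cost 48 N / (n - k) into at most 192/\<rho>, and \<epsilon> is
  chosen to make (n - k)^2 exp(-192 \<beta> / \<rho>) at least twice (k + 1) N. The induction starts
  at level 1, the left boundary of the window.\<close>

lemma level_sum_growth:
  fixes \<beta> lam \<rho> \<epsilon> :: real
  assumes tame: "tame_matrix N w" and sym: "\<And>i j. i < N \<Longrightarrow> j < N \<Longrightarrow> w i j = w j i"
    and V: "V \<in> subsets N n" and lam: "lam \<ge> 0" and \<beta>: "\<beta> \<ge> 0" and N: "N > 0" and \<rho>: "0 < \<rho>" "\<rho> < 1"
    and n: "real n \<ge> \<rho> / 2 * real N" and \<epsilon>: "\<epsilon> = \<rho>\<^sup>2 * exp (- \<beta> * 192 / \<rho>) / 64"
    and k: "1 \<le> k" "real k \<le> \<epsilon> * real N"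
  defines "H X \<equiv> energy w X + lam * (real (card (V \<inter> X)))\<^sup>2"
  shows "2 ^ (k - 1) * (\<Sum>X\<in>level_set N n V 1. exp (\<beta> * H X)) \<le> (\<Sum>X\<in>level_set N n V k. exp (\<beta> * H X))"
  using k
proof (induction k rule: dec_induct)
  case (step k)
  let ?Z = "\<lambda>k. \<Sum>X\<in>level_set N n V k. exp (\<beta> * H X)"
  have kN: "real k + 1 \<le> \<epsilon> * real N" using step.prems by simp
  have "exp (- \<beta> * 192 / \<rho>) \<le> 1" using \<beta> \<rho> by simp
  then have "\<rho>\<^sup>2 * exp (- \<beta> * 192 / \<rho>) \<le> \<rho> * 1" using \<rho> by (intro mult_mono) (auto simp: power2_eq_square mult_left_le)
  then have "\<epsilon> \<le> \<rho> / 4" using \<rho> by (simp add: \<epsilon>)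
  then have "\<epsilon> * real N \<le> \<rho> / 4 * real N" by (intro mult_right_mono) auto
  then have kn: "real k \<le> real n / 2" "k < n" using kN n by auto
  define m where "m = n - k"
  have m: "real m \<ge> \<rho> / 4 * real N" "m > 0" using kn n by (auto simp: m_def of_nat_diff)
  have "\<beta> * 48 * real N / real m \<le> \<beta> * 192 / \<rho>"
  proof -
    have "real N / real m \<le> 4 / \<rho>" using m \<rho> by (simp add: field_simps)
    then have "(\<beta> * 48) * (real N / real m) \<le> (\<beta> * 48) * (4 / \<rho>)" using \<beta> by (intro mult_left_mono) auto
    then show ?thesis by (simp add: mult.commute)
  qed
  then have e: "exp (- \<beta> * 192 / \<rho>) \<le> exp (- \<beta> * 48 * real N / real m)" by simp
  have Z0: "?Z j \<ge> 0" for j by (intro sum_nonneg) auto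
  have "\<epsilon> > 0" unfolding \<epsilon> using \<rho> by simp
  then have pos: "\<epsilon> * real N * real N > 0" using N by simp
  have "2 * (\<epsilon> * real N * real N) \<le> (\<rho> / 4 * real N)\<^sup>2 * exp (- \<beta> * 192 / \<rho>)"
    unfolding \<epsilon> using \<rho> by (simp add: power2_eq_square field_simps)
  also have "\<dots> \<le> (real m)\<^sup>2 * exp (- \<beta> * 48 * real N / real m)"
    using m \<rho> e by (intro mult_mono power_mono) auto
  finally have "2 * (\<epsilon> * real N * real N) * ?Z k \<le> (real m)\<^sup>2 * exp (- \<beta> * 48 * real N / real m) * ?Z k"
    using Z0 by (intro mult_right_mono) auto
  also have "\<dots> \<le> real (k + 1) * real N * ?Z (Suc k)"
    using level_sum_step[OF tame sym V kn(2) lam \<beta>] unfolding m_def H_def by simp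
  also have "\<dots> \<le> (\<epsilon> * real N) * real N * ?Z (Suc k)"
    using kN Z0 by (intro mult_right_mono) auto
  finally have "(\<epsilon> * real N * real N) * (2 * ?Z k) \<le> (\<epsilon> * real N * real N) * ?Z (Suc k)" by (simp add: mult_ac)
  then have st: "2 * ?Z k \<le> ?Z (Suc k)" using pos by (simp only: mult_le_cancel_left_pos)
  have "2 ^ (Suc k - 1) * ?Z 1 = 2 * (2 ^ (k - 1) * ?Z 1)"
    using step.hyps by (cases k) auto
  also have "\<dots> \<le> 2 * ?Z k" using step.IH kN by simp
  finally show ?case using st by simp
qed simp

section \<open>Probability that the noise matrix is tame\<close>

context
  fixes N :: nat and M :: "'w measure" and W
  assumes W: "gaussian_symmetric_matrix N M W" and N: "N > 0"
begin

lemma tame_matrix_prob: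
  "{\<omega>\<in>space M. tame_matrix N (W \<omega>)} \<in> sets M"
  "measure M {\<omega>\<in>space M. \<not> tame_matrix N (W \<omega>)} \<le> 4 * 4 ^ N * exp (- 9 * real N)"
proof -
  interpret prob_space M by (rule gaussian_prob_space[OF W])
  let ?P = "Pow {..<N}"
  define C where "C s X Y i j = s * of_bool (i \<in> X \<and> j \<in> Y)" for s :: real and X Y :: "nat set" and i j :: nat
  define D where "D s X i j = s * of_bool (i \<in> X \<and> i = j)" for s :: real and X :: "nat set" and i j :: nat
  define S where "S C \<omega> = (\<Sum>i<N. \<Sum>j<N. C i j * W \<omega> i j)" for C \<omega>
  have SC: "S (C s X Y) \<omega> = s * cross_sum (W \<omega>) X Y" if "X \<in> ?P" "Y \<in> ?P" for s X Y \<omega>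
  proof -
    have "cross_sum (W \<omega>) X Y = (\<Sum>i\<in>X. \<Sum>j<N. of_bool (j \<in> Y) * W \<omega> i j)"
      unfolding cross_sum_def using that by (intro sum.cong refl sum.mono_neutral_cong_left) auto
    also have "\<dots> = (\<Sum>i<N. \<Sum>j<N. of_bool (i \<in> X \<and> j \<in> Y) * W \<omega> i j)"
      using that by (intro sum.mono_neutral_cong_left) auto
    finally show ?thesis unfolding S_def C_def by (simp only: sum_distrib_left mult.assoc)
  qed
  have SD: "S (D s X) \<omega> = s * (\<Sum>i\<in>X. W \<omega> i i)" if "X \<in> ?P" for s X \<omega>
  proof -
    have "(\<Sum>i\<in>X. W \<omega> i i) = (\<Sum>i<N. of_bool (i \<in> X) * W \<omega> i i)"
      using that by (intro sum.mono_neutral_cong_left) auto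
    also have "\<dots> = (\<Sum>i<N. \<Sum>j<N. of_bool (i \<in> X \<and> i = j) * W \<omega> i j)"
    proof (intro sum.cong refl)
      fix i assume "i \<in> {..<N}"
      then have "(\<Sum>j<N. of_bool (i \<in> X \<and> i = j) * W \<omega> i j) = (\<Sum>j\<in>{i}. of_bool (i \<in> X \<and> i = j) * W \<omega> i j)"
        by (intro sum.mono_neutral_right) auto
      then show "of_bool (i \<in> X) * W \<omega> i i = (\<Sum>j<N. of_bool (i \<in> X \<and> i = j) * W \<omega> i j)" by simp
    qed
    finally show ?thesis unfolding S_def D_def by (simp only: sum_distrib_left mult.assoc)
  qed
  define \<C> where "\<C> = (\<lambda>(s, X, Y). C s X Y) ` ({1, -1} \<times> ?P \<times> ?P) \<union> (\<lambda>(s, X). D s X) ` ({1, -1} \<times> ?P)"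
  have fin: "finite \<C>" by (simp add: \<C>_def)
  have Sm [measurable]: "S c \<in> borel_measurable M" for c
    unfolding S_def[abs_def] by (rule measurable_gaussian_sum[OF W])
  have tame_iff: "tame_matrix N (W \<omega>) \<longleftrightarrow> (\<forall>c\<in>\<C>. S c \<omega> \<le> 6 * real N)" for \<omega>
    unfolding tame_matrix_def \<C>_def ball_Un ball_simps
    by (auto simp: SC SD abs_le_iff simp del: Pow_iff)
  have eq: "{\<omega>\<in>space M. \<not> tame_matrix N (W \<omega>)} = (\<Union>c\<in>\<C>. {\<omega>\<in>space M. S c \<omega> > 6 * real N})"
    by (auto simp: tame_iff not_le)
  have bad: "{\<omega>\<in>space M. \<not> tame_matrix N (W \<omega>)} \<in> events"
    unfolding eq using fin by (intro sets.finite_UN) auto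
  have "{\<omega>\<in>space M. tame_matrix N (W \<omega>)} = space M - {\<omega>\<in>space M. \<not> tame_matrix N (W \<omega>)}" by auto
  then show "{\<omega>\<in>space M. tame_matrix N (W \<omega>)} \<in> sets M" using bad by simp
  have CN: "(\<Sum>i<N. \<Sum>j<N. (c i j)\<^sup>2) \<le> (real N)\<^sup>2" if "c \<in> \<C>" for c
  proof -
    have "(c i j)\<^sup>2 \<le> 1" for i j using that by (auto simp: \<C>_def C_def D_def power_mult_distrib)
    then have "(\<Sum>i<N. \<Sum>j<N. (c i j)\<^sup>2) \<le> (\<Sum>i<N. \<Sum>j<N. 1)" by (intro sum_mono)
    then show ?thesis by (simp add: power2_eq_square)
  qed
  have "prob (\<Union>c\<in>\<C>. {\<omega>\<in>space M. S c \<omega> > 6 * real N}) \<le> (\<Sum>c\<in>\<C>. prob {\<omega>\<in>space M. S c \<omega> > 6 * real N})"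
    using fin by (intro finite_measure_subadditive_finite) auto
  also have "\<dots> \<le> (\<Sum>c\<in>\<C>. exp (- 9 * real N))"
  proof (intro sum_mono)
    fix c assume c: "c \<in> \<C>"
    have "prob {\<omega>\<in>space M. S c \<omega> > 6 * real N} \<le> prob {\<omega>\<in>space M. S c \<omega> \<ge> 6 * real N}"
      by (intro finite_measure_mono) auto
    also have "\<dots> \<le> exp (- (6 * real N)\<^sup>2 * real N / (4 * (real N)\<^sup>2))"
      unfolding S_def using N by (intro gaussian_sum_tail[OF W] CN c) auto
    also have "- (6 * real N)\<^sup>2 * real N / (4 * (real N)\<^sup>2) = - 9 * real N"
      using N by (simp add: power2_eq_square)
    finally show "prob {\<omega>\<in>space M. S c \<omega> > 6 * real N} \<le> exp (- 9 * real N)" .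
  qed
  also have "\<dots> = real (card \<C>) * exp (- 9 * real N)" by simp
  also have "\<dots> \<le> (4 * 4 ^ N) * exp (- 9 * real N)"
  proof (intro mult_right_mono)
    have "card \<C> \<le> card ({1, -1 :: real} \<times> ?P \<times> ?P) + card ({1, -1 :: real} \<times> ?P)"
      unfolding \<C>_def by (intro order.trans[OF card_Un_le] add_mono card_image_le) auto
    also have "\<dots> = 2 * (2 ^ N * 2 ^ N) + 2 * 2 ^ N" by (simp add: card_cartesian_product card_Pow)
    also have "\<dots> \<le> 4 * (2 ^ N * 2 ^ N)" by simp
    finally have "real (card \<C>) \<le> real (4 * (2 ^ N * 2 ^ N))" by (rule of_nat_mono)
    then show "real (card \<C>) \<le> 4 * 4 ^ N" by (simp add: power_mult_distrib[symmetric])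
  qed simp
  finally show "prob {\<omega>\<in>space M. \<not> tame_matrix N (W \<omega>)} \<le> 4 * 4 ^ N * exp (- 9 * real N)"
    unfolding eq .
qed

end

section \<open>Asymptotic estimates\<close>

text \<open>The consequence of rounding to the nearest integer on which the size estimates
  rest.\<close>

definition near_size :: "real \<Rightarrow> nat \<Rightarrow> nat \<Rightarrow> bool" where
  "near_size \<rho> N n \<longleftrightarrow> \<bar>real n - real N * \<rho>\<bar> \<le> 1 / 2"

lemma powr_lt_one: "0 < x \<Longrightarrow> x < 1 / 4 \<Longrightarrow> 0 < a \<Longrightarrow> x powr a < (1::real)"
  using powr_less_mono2[of a x 1] by simp

lemma linear_exp_tendsto_0:
  fixes x :: real
  assumes "x > 0"
  shows "(\<lambda>N. (real N + 1) * exp (- x * real N)) \<longlonglongrightarrow> 0"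
  using assms by real_asymp

lemma near_sizeD:
  assumes "near_size \<rho> N n" "0 < \<rho>" "\<rho> < 1 / 4" "real N \<ge> 1 / \<rho>"
  shows "n > 0" "2 * n \<le> N" "\<rho> / 2 \<le> real n / real N" "real n / real N \<le> 2 * \<rho>" "N > 0"
    "\<rho> / 2 * real N \<le> real n" "real n \<le> 2 * \<rho> * real N"
proof -
  have a: "real n \<le> real N * \<rho> + 1 / 2" "real n \<ge> real N * \<rho> - 1 / 2"
    using assms(1) unfolding near_size_def by linarith+
  have N1: "real N * \<rho> \<ge> 1" using assms by (simp add: divide_le_eq mult.commute)
  then show N: "N > 0" by (cases "N = 0") auto
  show "n > 0" using a N1 by (cases "n = 0") auto
  show r: "\<rho> / 2 * real N \<le> real n" "real n \<le> 2 * \<rho> * real N" proof -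
    have e: "\<rho> / 2 * real N = (real N * \<rho>) / 2" "2 * \<rho> * real N = 2 * (real N * \<rho>)" by simp_all
    show "\<rho> / 2 * real N \<le> real n" "real n \<le> 2 * \<rho> * real N" unfolding e using a N1 by linarith+
  qed
  then show "\<rho> / 2 \<le> real n / real N" "real n / real N \<le> 2 * \<rho>"
    using N by (simp_all add: le_divide_eq divide_le_eq)
  have "2 * \<rho> * real N \<le> 1 / 2 * real N" using assms by (intro mult_right_mono) auto
  then show "2 * n \<le> N" using r by simp
qed

lemma ln_choose_bounds:
  assumes "near_size \<rho> N n" "0 < \<rho>" "\<rho> < 1 / 4" "real N \<ge> 1 / \<rho>" "ln (1 / \<rho>) \<ge> 2"
  shows "ln (1 / \<rho>) - 1 \<le> ln (real N / real n)" "real n \<le> ln (real (N choose n))"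
    "ln (real (N choose n)) \<le> 2 * real n * ln (1 / \<rho>)" "ln (real (N choose n)) \<le> real n * (ln (1 / \<rho>) + 2)"
proof -
  note n = near_sizeD[OF assms(1-4)]
  define l where "l = ln (real N / real n)"
  have ln2: "ln 2 \<le> (1::real)" using ln_le_minus_one[of "2::real"] by simp
  have "ln (real n / real N) \<le> ln (2 * \<rho>)" "ln (\<rho> / 2) \<le> ln (real n / real N)"
    using assms n by (auto intro!: ln_mono)
  then have l: "ln (1 / \<rho>) - 1 \<le> l" "l \<le> ln (1 / \<rho>) + 1"
    using assms n ln2 by (simp_all add: l_def ln_div ln_mult)
  show "ln (1 / \<rho>) - 1 \<le> ln (real N / real n)" using l by (simp add: l_def)
  have "real n * l \<le> ln (real (N choose n))" "ln (real (N choose n)) \<le> real n * (1 + l)"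
    unfolding l_def using ln_choose_ge[of n N] ln_choose_le[of n N] n by auto
  moreover have "real n * 1 \<le> real n * l"
    using l assms by (intro mult_left_mono) auto
  moreover have "real n * (1 + l) \<le> real n * (ln (1 / \<rho>) + 2)"
    "real n * (ln (1 / \<rho>) + 2) \<le> real n * (2 * ln (1 / \<rho>))"
    using l assms by (auto intro!: mult_left_mono)
  ultimately show "real n \<le> ln (real (N choose n))"
    "ln (real (N choose n)) \<le> 2 * real n * ln (1 / \<rho>)" "ln (real (N choose n)) \<le> real n * (ln (1 / \<rho>) + 2)"
    by simp_all
qed

lemma eventually_small_ln_ge: "\<forall>\<^sub>F \<rho> in at_right (0::real). 0 < \<rho> \<and> \<rho> < 1 / 4 \<and> ln (1 / \<rho>) \<ge> C"
proof -
  have "\<forall>\<^sub>F \<rho> in at_right (0::real). ln (1 / \<rho>) \<ge> C"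
    using filterlim_ln_inverse unfolding filterlim_at_top by blast
  moreover have "\<forall>\<^sub>F \<rho> in at_right (0::real). \<rho> > 0 \<and> \<rho> < 1 / 4"
    by (simp add: eventually_at_right[of 0 1]) (auto intro: exI[of _ "1 / 4"])
  ultimately show ?thesis by eventually_elim simp
qed

lemma eventually_real_ge: "\<forall>\<^sub>F N in sequentially. real N \<ge> C"
  using filterlim_real_sequentially unfolding filterlim_at_top by blast

text \<open>Up to a polynomial factor the second moment succeeds with probability at least exp(-
  \<rho>^(16/10) N / 80), while concentration at distance \<rho>^(9/5) N yields exp(- \<rho>^(16/10)
  N / 40); the quotient still decays. The exponent 9/5 is small enough for concentration to beat the
  second moment error of order \<rho>^(17/10) N, and large enough to stay below an energy gap of
  order \<rho>^(3/2 + \<gamma>) N with \<gamma> < 1/10.\<close>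

lemma interior_max_lower_bound:
  fixes \<theta> :: real
  assumes th: "0 < \<theta>" "\<theta> < 3 / 2 - sqrt 2"
  shows "\<forall>\<^sub>F \<rho> in at_right (0::real). \<exists>c>0. \<forall>\<^sub>F N in sequentially. \<forall>n. near_size \<rho> N n \<longrightarrow>
    (\<forall>(M :: 'w measure) W \<S>. gaussian_symmetric_matrix N M W \<and> \<S> \<subseteq> subsets N n \<and> N choose n \<le> 2 * card \<S> \<longrightarrow>
      measure M {\<omega>\<in>space M. \<forall>X\<in>\<S>. energy (W \<omega>) X \<le>
        2 * real n * sqrt ((1 - 20 * \<rho> powr \<theta>) * ln (real (N choose n)) / real N) - \<rho> ^ 3 * real N - \<rho> powr (9 / 5) * real N}
      \<le> exp (- c * real N))"
proof -
  have "\<forall>\<^sub>F \<rho> in at_right (0::real). \<rho> powr \<theta> \<le> (1 / 20) * \<rho> powr 0"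
    using th by (intro eventually_at_right_0_powr_le) auto
  moreover have "\<forall>\<^sub>F \<rho> in at_right (0::real). \<rho> powr (17 / 10) \<le> (1 / 240) * \<rho> powr (16 / 10)"
    by (intro eventually_at_right_0_powr_le) auto
  moreover have "\<forall>\<^sub>F \<rho> in at_right (0::real). \<rho> powr 2 \<le> 1 * \<rho> powr (17 / 10)"
    by (intro eventually_at_right_0_powr_le) auto
  moreover have "\<forall>\<^sub>F \<rho> in at_right (0::real). 2 * \<rho> * (2 + ln (1 / \<rho>)) \<le> 1"
    by real_asymp
  ultimately show ?thesis using pair_weight_bound[OF th] eventually_small_ln_ge[of 2]
  proof eventually_elim
    case (elim \<rho>)
    have rho: "0 < \<rho>" "\<rho> < 1 / 4" "ln (1 / \<rho>) \<ge> 2" using elim(6) by auto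
    define \<eta> where "\<eta> = 20 * \<rho> powr \<theta>"
    have eta: "0 \<le> \<eta>" "\<eta> \<le> 1" using elim(1) rho by (auto simp: \<eta>_def)
    \<comment> \<open>In units of \<rho>^(16/10) the quotient leaves the rate 1/40 - 1/80 = 1/80;
      half of it is given up to absorb the polynomial factor.\<close>
    define c where "c = \<rho> powr (16 / 10) / 160"
    have c: "c > 0" using rho by (simp add: c_def)
    have "\<forall>\<^sub>F N in sequentially. 2 * exp (- (\<rho> ^ 6 / 4) * real N) + (real N + 1) * exp (- (\<rho>\<^sup>2 / 2) * real N) \<le> 1 / 2"
    proof -
      have pos: "0 < \<rho> ^ 6 / 4" "0 < \<rho>\<^sup>2 / 2" using rho by auto
      have "\<forall>\<^sub>F N in sequentially. (real N + 1) * exp (- (\<rho> ^ 6 / 4) * real N) < 1 / 8"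
        "\<forall>\<^sub>F N in sequentially. (real N + 1) * exp (- (\<rho>\<^sup>2 / 2) * real N) < 1 / 4"
        by (rule order_tendstoD(2)[OF linear_exp_tendsto_0[OF pos(1)]], simp)
          (rule order_tendstoD(2)[OF linear_exp_tendsto_0[OF pos(2)]], simp)
      then show ?thesis
      proof eventually_elim
        case (elim N)
        have "1 * exp (- (\<rho> ^ 6 / 4) * real N) \<le> (real N + 1) * exp (- (\<rho> ^ 6 / 4) * real N)"
          by (intro mult_right_mono) auto
        then show ?case using elim by linarith
      qed
    qed
    moreover have "\<forall>\<^sub>F N in sequentially. 8 * (real N + 1) * exp (- c * real N) \<le> 1"
    proof -
      have "\<forall>\<^sub>F N in sequentially. (real N + 1) * exp (- c * real N) < 1 / 8"
        by (intro order_tendstoD(2)[OF linear_exp_tendsto_0] c) auto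
      then show ?thesis by eventually_elim (simp add: algebra_simps)
    qed
    ultimately have "\<forall>\<^sub>F N in sequentially. \<forall>n. near_size \<rho> N n \<longrightarrow>
      (\<forall>(M :: 'w measure) W \<S>. gaussian_symmetric_matrix N M W \<and> \<S> \<subseteq> subsets N n \<and> N choose n \<le> 2 * card \<S> \<longrightarrow>
      measure M {\<omega>\<in>space M. \<forall>X\<in>\<S>. energy (W \<omega>) X \<le>
        2 * real n * sqrt ((1 - \<eta>) * ln (real (N choose n)) / real N) - \<rho> ^ 3 * real N - \<rho> powr (9 / 5) * real N}
      \<le> exp (- c * real N))"
      using eventually_real_ge[of "1 / \<rho>"]
    proof (eventually_elim, intro allI impI)
      fix N n :: nat and M :: "'w measure" and W \<S>
      assume small: "2 * exp (- (\<rho> ^ 6 / 4) * real N) + (real N + 1) * exp (- (\<rho>\<^sup>2 / 2) * real N) \<le> 1 / 2"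
        and cN: "8 * (real N + 1) * exp (- c * real N) \<le> 1" and N1: "1 / \<rho> \<le> real N"
        and near: "near_size \<rho> N n"
        and "gaussian_symmetric_matrix N M W \<and> \<S> \<subseteq> subsets N n \<and> N choose n \<le> 2 * card \<S>"
      then have W: "gaussian_symmetric_matrix N M W" and S: "\<S> \<subseteq> subsets N n" "N choose n \<le> 2 * card \<S>" by auto
      interpret prob_space M by (rule gaussian_prob_space[OF W])
      note n = near_sizeD[OF near rho(1,2) N1] and Lam = ln_choose_bounds[OF near rho(1,2) N1 rho(3)]
      define \<Lambda> where "\<Lambda> = ln (real (N choose n))"
      define b where "b = tilt_beta \<eta> N n"
      define B where "B = exp (real n * \<rho> powr (7 / 10) + b * \<rho> ^ 3 * real N)"
      have Lam0: "\<Lambda> \<ge> 0" using Lam(2) by (simp add: \<Lambda>_def)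
      have b0: "b \<ge> 0" unfolding b_def tilt_beta_def using eta Lam0 by (simp add: \<Lambda>_def)
      have lvl: "2 * b * (real n)\<^sup>2 / real N = 2 * real n * sqrt ((1 - \<eta>) * \<Lambda> / real N)"
      proof -
        have "sqrt ((1 - \<eta>) * \<Lambda> * real N) / real N = sqrt ((1 - \<eta>) * \<Lambda> / real N)"
        proof -
          have "(1 - \<eta>) * \<Lambda> * real N = ((1 - \<eta>) * \<Lambda> / real N) * (real N)\<^sup>2" by (simp add: power2_eq_square)
          then have "sqrt ((1 - \<eta>) * \<Lambda> * real N) = sqrt ((1 - \<eta>) * \<Lambda> / real N) * real N"
            by (simp only: real_sqrt_mult real_sqrt_abs abs_of_nat)
          then show ?thesis using n by simp
        qed
        moreover have "2 * b * (real n)\<^sup>2 / real N = 2 * real n * (sqrt ((1 - \<eta>) * \<Lambda> * real N) / real N)"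
          using n unfolding b_def tilt_beta_def \<Lambda>_def[symmetric] by (simp add: power2_eq_square)
        ultimately show ?thesis by simp
      qed
      \<comment> \<open>With \<delta> = \<rho>^3 the width of the energy window costs b \<delta> N
        in the exponent; this bound makes it at most \<rho>^2 N, below the pair error of order
        \<rho>^(17/10) N.\<close>
      have b_le: "b \<le> 1 / \<rho>"
      proof -
        have "(1 - \<eta>) * \<Lambda> * real N \<le> 1 * (real n * (ln (1 / \<rho>) + 2)) * real N"
          using eta Lam Lam0 unfolding \<Lambda>_def by (intro mult_mono) auto
        also have "\<dots> \<le> (real n * (1 / (2 * \<rho>))) * real N"
        proof -
          have "ln (1 / \<rho>) + 2 \<le> 1 / (2 * \<rho>)" using elim(4) rho by (simp add: field_simps)
          then have "real n * (ln (1 / \<rho>) + 2) * real N \<le> real n * (1 / (2 * \<rho>)) * real N"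
            by (intro mult_right_mono mult_left_mono) auto
          then show ?thesis by simp
        qed
        also have "\<dots> \<le> (real n * (1 / (2 * \<rho>))) * (real n * (2 / \<rho>))"
          using n rho by (intro mult_left_mono) (auto simp: field_simps)
        also have "\<dots> = (real n / \<rho>)\<^sup>2" by (simp add: power2_eq_square)
        finally have "sqrt ((1 - \<eta>) * \<Lambda> * real N) \<le> real n / \<rho>"
          using rho by (intro real_le_lsqrt) auto
        then show ?thesis using n unfolding b_def tilt_beta_def \<Lambda>_def[symmetric] by (simp add: divide_le_eq)
      qed
      have B_le: "B \<le> exp (\<rho> powr (16 / 10) / 80 * real N)"
      proof -
        have "real n * \<rho> powr (7 / 10) \<le> 2 * \<rho> * real N * \<rho> powr (7 / 10)"
          using n by (intro mult_right_mono) auto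
        also have "\<dots> = 2 * (\<rho> powr (17 / 10)) * real N"
          using rho powr_add[of \<rho> 1 "7 / 10"] by simp
        finally have 1: "real n * \<rho> powr (7 / 10) \<le> 2 * (\<rho> powr (17 / 10)) * real N" .
        have "b * \<rho> ^ 3 * real N \<le> (1 / \<rho>) * \<rho> ^ 3 * real N" using b_le rho by (intro mult_right_mono) auto
        also have "\<dots> = \<rho> powr 2 * real N" using rho by (simp add: power2_eq_square power3_eq_cube powr_numeral)
        also have "\<dots> \<le> \<rho> powr (17 / 10) * real N" using elim(3) by (intro mult_right_mono) auto
        finally have "real n * \<rho> powr (7 / 10) + b * \<rho> ^ 3 * real N \<le> 3 * (\<rho> powr (17 / 10)) * real N" using 1 by simp
        also have "\<dots> \<le> 3 * ((1 / 240) * \<rho> powr (16 / 10)) * real N"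
          using elim(2) by (intro mult_right_mono mult_left_mono) auto
        finally show ?thesis by (simp add: B_def)
      qed
      have Bpos: "B > 0" by (simp add: B_def)
      \<comment> \<open>For fixed \<rho>, with \<delta> = \<rho>^3 and \<xi> = \<rho>, the atypical
        part of the tilted weight decays exponentially in \<open>N\<close>, so at least half of the
        weight remains.\<close>
      have sm: "2 * exp (- (\<rho> ^ 3)\<^sup>2 * real N / 4) + (real n + 1) * exp (- \<rho> * real n) \<le> 1 / 2"
      proof -
        have "\<rho>\<^sup>2 / 2 * real N \<le> \<rho> * real n"
          using mult_left_mono[OF n(6), of \<rho>] rho by (simp add: power2_eq_square)
        then have "(real n + 1) * exp (- \<rho> * real n) \<le> (real N + 1) * exp (- (\<rho>\<^sup>2 / 2) * real N)"
          using n by (intro mult_mono) auto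
        then show ?thesis using small by (simp add: power_mult[symmetric])
      qed
      define u where "u = 2 * b * (real n)\<^sup>2 / real N - \<rho> ^ 3 * real N"
      have "1 / (8 * (real n + 1) * B) \<le> prob {\<omega>\<in>space M. \<exists>X\<in>\<S>. energy (W \<omega>) X \<ge> u}"
        unfolding u_def
      proof (rule second_moment_lower_bound[OF W n(5) n(1) _ b0 _ rho(1) S sm])
        show "n \<le> N" "0 < \<rho> ^ 3" using n rho by auto
        fix j assume "j \<le> n"
        then show "real ((n choose j) * ((N - n) choose (n - j))) *
            exp (b\<^sup>2 * (real j)\<^sup>2 / real N + b * \<rho> ^ 3 * real N + b * trunc_height N n \<rho> j) \<le> B * real (N choose n)"
          using elim(5)[rule_format, of "\<rho> ^ 3" n N j] n rho unfolding Let_def B_def b_def \<eta>_def by simp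
      qed
      moreover have "prob {\<omega>\<in>space M. \<exists>X\<in>\<S>. energy (W \<omega>) X \<ge> u} *
          prob {\<omega>\<in>space M. \<forall>X\<in>\<S>. energy (W \<omega>) X \<le> u - \<rho> powr (9 / 5) * real N}
          \<le> exp (- (\<rho> powr (9 / 5) * real N)\<^sup>2 * real N / (pi\<^sup>2 * (real n)\<^sup>2))" (is "_ * ?p \<le> _")
      proof (rule energy_max_concentration[OF W n(5)])
        show "finite \<S>" using S(1) by (rule finite_subset) simp
        have "N choose n > 0" using n by simp
        then show "\<S> \<noteq> {}" using S(2) by auto
      qed (use S n in \<open>auto simp: subsets_def\<close>)
      ultimately have "1 / (8 * (real n + 1) * B) * ?p \<le> exp (- (\<rho> powr (9 / 5) * real N)\<^sup>2 * real N / (pi\<^sup>2 * (real n)\<^sup>2))"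
        by (smt (verit) mult_right_mono measure_nonneg)
      then have "?p \<le> 8 * (real n + 1) * B * exp (- (\<rho> powr (9 / 5) * real N)\<^sup>2 * real N / (pi\<^sup>2 * (real n)\<^sup>2))"
        proof -
        have aux: "p \<le> K * e" if "1 / K * p \<le> e" "K > 0" for p K e :: real
          using that by (simp add: divide_le_eq mult.commute)
        assume "1 / (8 * (real n + 1) * B) * ?p \<le> exp (- (\<rho> powr (9 / 5) * real N)\<^sup>2 * real N / (pi\<^sup>2 * (real n)\<^sup>2))"
        then show ?thesis by (rule aux) (use Bpos in simp)
      qed
      also have "\<dots> \<le> 8 * (real N + 1) * exp (\<rho> powr (16 / 10) / 80 * real N) * exp (- (\<rho> powr (16 / 10) / 40) * real N)"
      proof (intro mult_mono)
        have "pi\<^sup>2 \<le> 10"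
        proof -
          have "pi \<le> 3.15" using pi_approx by simp
          then have "pi\<^sup>2 \<le> 3.15\<^sup>2" by (intro power_mono) auto
          then show ?thesis by (simp add: power2_eq_square)
        qed
        then have "pi\<^sup>2 * (real n)\<^sup>2 \<le> 10 * (2 * \<rho> * real N)\<^sup>2" using n by (intro mult_mono power_mono) auto
        then have "(\<rho> powr (9 / 5) * real N)\<^sup>2 * real N / (10 * (2 * \<rho> * real N)\<^sup>2) \<le> (\<rho> powr (9 / 5) * real N)\<^sup>2 * real N / (pi\<^sup>2 * (real n)\<^sup>2)"
          using n rho by (intro divide_left_mono) (auto intro!: mult_pos_pos)
        moreover have "(\<rho> powr (9 / 5) * real N)\<^sup>2 * real N / (10 * (2 * \<rho> * real N)\<^sup>2) = \<rho> powr (16 / 10) / 40 * real N"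
        proof -
          have "(\<rho> powr (9 / 5))\<^sup>2 = \<rho> powr (18 / 5)" using rho by (simp add: power2_eq_square powr_add[symmetric])
          also have "\<dots> = \<rho> powr (16 / 10) * \<rho>\<^sup>2" using rho powr_add[of \<rho> "16 / 10" 2] by (simp add: powr_numeral)
          finally show ?thesis using n rho by (simp add: power_mult_distrib power2_eq_square field_simps)
        qed
        ultimately show "exp (- (\<rho> powr (9 / 5) * real N)\<^sup>2 * real N / (pi\<^sup>2 * (real n)\<^sup>2)) \<le> exp (- (\<rho> powr (16 / 10) / 40) * real N)"
          by simp
      qed (use n B_le Bpos in auto)
      also have "\<dots> = (8 * (real N + 1) * exp (- c * real N)) * exp (- c * real N)"
      proof -
        have "exp (\<rho> powr (16 / 10) / 80 * real N) * exp (- (\<rho> powr (16 / 10) / 40) * real N) = exp (- c * real N) * exp (- c * real N)"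
          unfolding exp_add[symmetric] c_def by (rule arg_cong[where f=exp]) simp
        then show ?thesis by (simp add: mult_ac)
      qed
      also have "\<dots> \<le> 1 * exp (- c * real N)" using cN by (intro mult_right_mono) auto
      finally show "prob {\<omega>\<in>space M. \<forall>X\<in>\<S>. energy (W \<omega>) X \<le>
        2 * real n * sqrt ((1 - \<eta>) * ln (real (N choose n)) / real N) - \<rho> ^ 3 * real N - \<rho> powr (9 / 5) * real N}
        \<le> exp (- c * real N)"
        unfolding u_def lvl \<Lambda>_def by simp
    qed
    then show ?case using c unfolding \<eta>_def by blast
  qed
qed

text \<open>At overlap about b N each shared vertex costs ln(N/n), about ln(1/\<rho>), and regains
  only 1 + ln(n/j), about \<gamma> ln(1/\<rho>). Hence at least half of ln(1/\<rho>) is lost on each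
  of at least n \<rho>^\<gamma> / 2 vertices, which is a fraction \<rho>^\<gamma> / 8 of the
  entropy. The \<open>- 1\<close> admits the last level below b N.\<close>

lemma tail_level_count:
  assumes g: "0 < \<gamma>" "\<gamma> < 1 / 10"
  shows "\<forall>\<^sub>F \<rho> in at_right (0::real). \<forall>\<^sub>F N in sequentially. \<forall>n j. near_size \<rho> N n \<and> \<rho> powr (1 + \<gamma>) * real N - 1 \<le> real j \<and> j \<le> n \<longrightarrow>
     real ((n choose j) * ((N - n) choose (n - j))) \<le> real (N choose n) * exp (- ln (real (N choose n)) * \<rho> powr \<gamma> / 8)"
  using eventually_small_ln_ge[of 10]
proof eventually_elim
  case (elim \<rho>)
  then have rho: "0 < \<rho>" "\<rho> < 1 / 4" "ln (1 / \<rho>) \<ge> 10" "ln (1 / \<rho>) \<ge> 2" by auto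
  define t where "t = \<rho> powr \<gamma>"
  define r where "r = ln (1 / \<rho>)"
  have t: "0 < t" "t < 1" using rho g by (auto simp: t_def powr_lt_one)
  have rt: "\<rho> powr (1 + \<gamma>) = \<rho> * t" using rho by (simp add: t_def powr_add)
  show ?case using eventually_real_ge[of "1 / \<rho>"] eventually_real_ge[of "4 / (\<rho> * t)"]
  proof (eventually_elim, intro allI impI)
    case (elim N)
    fix n j assume A: "near_size \<rho> N n \<and> \<rho> powr (1 + \<gamma>) * real N - 1 \<le> real j \<and> j \<le> n"
    note n = near_sizeD[OF _ rho(1,2) elim(1), of n] and Lam = ln_choose_bounds[OF _ rho(1,2) elim(1) rho(4), of n]
    have near: "near_size \<rho> N n" using A by simp
    note n = n[OF near] and Lam = Lam[OF near]
    define \<Lambda> where "\<Lambda> = ln (real (N choose n))"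
    have Nt: "\<rho> * t * real N \<ge> 4" using elim(2) rho t by (simp add: divide_le_eq mult.commute)
    have "real n * t / 2 \<le> (real N * \<rho> + 1 / 2) * t / 2"
    proof (intro divide_right_mono mult_right_mono)
      show "real n \<le> real N * \<rho> + 1 / 2" using near unfolding near_size_def by linarith
    qed (use t in auto)
    also have "(real N * \<rho> + 1 / 2) * t / 2 = \<rho> * t * real N / 2 + t / 4" by (simp add: field_simps)
    also have "\<dots> \<le> \<rho> * t * real N - 1" using Nt t by linarith
    also have "\<dots> \<le> real j" using A unfolding rt by simp
    finally have j: "real n * t / 2 \<le> real j" .
    have j0: "j > 0" using j n t by (cases "j = 0") (auto simp: mult_le_0_iff)
    have jn: "j \<le> n" using A by simp
    have c1: "ln (real (n choose j)) \<le> real j * (1 + ln (real n / real j))" by (rule ln_choose_le[OF j0 jn])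
    have lnj: "ln (real n / real j) \<le> ln (2 / t)"
    proof (intro ln_mono)
      show "real n / real j \<le> 2 / t" using j j0 t by (simp add: field_simps)
    qed (use n j0 t in auto)
    have ln2: "ln 2 \<le> (1::real)" using ln_le_minus_one[of "2::real"] by simp
    have "ln (2 / t) = ln 2 + \<gamma> * r" using t rho by (simp add: ln_div t_def r_def ln_powr)
    also have "\<dots> \<le> 1 + (1 / 10) * r" using ln2 g rho by (intro add_mono mult_right_mono) (auto simp: r_def)
    finally have "1 + ln (real n / real j) - ln (real N / real n) \<le> - (r / 2)"
      using lnj Lam(1) rho(3) unfolding r_def by simp
    then have "real j * (1 + ln (real n / real j) - ln (real N / real n)) \<le> real j * (- (r / 2))"
      by (intro mult_left_mono) auto
    also have "\<dots> \<le> - (real n * t / 2 * (r / 2))"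
      using mult_right_mono[OF j, of "r / 2"] rho by (simp add: r_def)
    also have "\<dots> \<le> - \<Lambda> * t / 8"
    proof -
      have "\<Lambda> * t \<le> (2 * real n * r) * t" using Lam(3) t unfolding \<Lambda>_def r_def by (intro mult_right_mono) auto
      then show ?thesis by (simp add: mult_ac)
    qed
    finally have ex: "real j * (1 + ln (real n / real j)) + real j * ln (real n / real N) \<le> - \<Lambda> * t / 8"
      using n by (simp add: ln_div algebra_simps)
    have "real (n choose j) * real ((N - n) choose (n - j)) \<le> exp (real j * (1 + ln (real n / real j))) * (real (N choose n) * (real n / real N) ^ j)"
    proof (intro mult_mono choose_inter_le)
      have "exp (ln (real (n choose j))) \<le> exp (real j * (1 + ln (real n / real j)))"
        using c1 by (simp only: exp_le_cancel_iff)
      moreover have "real (n choose j) > 0" using jn by simp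
      ultimately show "real (n choose j) \<le> exp (real j * (1 + ln (real n / real j)))" by (simp only: exp_ln)
    qed (use jn n in auto)
    also have "(real n / real N) ^ j = exp (real j * ln (real n / real N))"
      using n by (simp add: exp_of_nat_mult)
    also have "exp (real j * (1 + ln (real n / real j))) * (real (N choose n) * exp (real j * ln (real n / real N))) =
        real (N choose n) * exp (real j * (1 + ln (real n / real j)) + real j * ln (real n / real N))"
      by (simp add: exp_add)
    also have "\<dots> \<le> real (N choose n) * exp (- \<Lambda> * t / 8)"
      using ex by (intro mult_left_mono) auto
    finally show "real ((n choose j) * ((N - n) choose (n - j))) \<le> real (N choose n) * exp (- ln (real (N choose n)) * \<rho> powr \<gamma> / 8)"
      unfolding \<Lambda>_def t_def by simp
  qed
qed

text \<open>Level 1 is one term of Vandermonde's sum, and passing from it to level 0 gives a factor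
  at most N / n^2, of order 1/N when \<open>n\<close> is proportional to \<open>N\<close>.\<close>

lemma choose_disjoint_le:
  assumes "0 < n" "2 * n \<le> N"
  shows "real ((N - n) choose n) \<le> real (N choose n) * (real N / (real n)\<^sup>2)"
proof -
  have "(n choose 1) * ((N - n) choose (n - 1)) \<le> (\<Sum>k\<le>n. (n choose k) * ((N - n) choose (n - k)))"
    using assms by (intro member_le_sum[of 1 "{..n}" "\<lambda>k. (n choose k) * ((N - n) choose (n - k))"]) auto
  also have "\<dots> = N choose n" using vandermonde[of n "N - n" n] assms by simp
  finally have 1: "n * ((N - n) choose (n - 1)) \<le> N choose n" by simp
  have "n * ((N - n) choose n) = (N - n - (n - 1)) * ((N - n) choose (n - 1))"
    using binomial_absorb_comp[of "N - n" "n - 1"] binomial_absorption[of "n - 1" "N - n"] assms by simp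
  also have "\<dots> \<le> N * ((N - n) choose (n - 1))" by (intro mult_right_mono) auto
  finally have "n * (n * ((N - n) choose n)) \<le> N * (n * ((N - n) choose (n - 1)))"
    by (metis mult.left_commute mult_le_mono2)
  also have "\<dots> \<le> N * (N choose n)" using 1 by simp
  finally have "real (n * (n * ((N - n) choose n))) \<le> real (N * (N choose n))" by (rule of_nat_mono)
  then show ?thesis using assms by (simp add: power2_eq_square field_simps)
qed

definition interior_family :: "nat \<Rightarrow> nat \<Rightarrow> nat set \<Rightarrow> real \<Rightarrow> nat set set" where
  "interior_family N n V b = {X\<in>subsets N n. 0 < card (V \<inter> X) \<and> real (card (V \<inter> X)) < b * real N}"

text \<open>The discarded sets lie on level 0 or on levels from b N - 1 upwards, and each kind makes
  up at most a quarter of all sets. The remaining half is what the second moment bound asks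
  for.\<close>

lemma interior_family_card:
  assumes g: "0 < \<gamma>" "\<gamma> < 1 / 10"
  shows "\<forall>\<^sub>F \<rho> in at_right (0::real). \<forall>\<^sub>F N in sequentially. \<forall>n V. near_size \<rho> N n \<and> V \<in> subsets N n \<longrightarrow>
     N choose n \<le> 2 * card (interior_family N n V (\<rho> powr (1 + \<gamma>)))"
  using tail_level_count[OF g] eventually_small_ln_ge[of 2]
proof eventually_elim
  case (elim \<rho>)
  then have rho: "0 < \<rho>" "\<rho> < 1 / 4" "ln (1 / \<rho>) \<ge> 2" by auto
  define t where "t = \<rho> powr \<gamma>"
  have t: "0 < t" using rho by (simp add: t_def)
  have "\<forall>\<^sub>F N in sequentially. (real N + 1) * exp (- (\<rho> * t / 16) * real N) \<le> 1 / 4"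
  proof -
    have "0 < \<rho> * t / 16" using rho t by simp
    then have "\<forall>\<^sub>F N in sequentially. (real N + 1) * exp (- (\<rho> * t / 16) * real N) < 1 / 4"
      by (intro order_tendstoD(2)[OF linear_exp_tendsto_0]) auto
    then show ?thesis by eventually_elim simp
  qed
  then show ?case
    using elim(1) eventually_real_ge[of "1 / \<rho>"] eventually_real_ge[of "16 / \<rho>\<^sup>2"]
  proof (eventually_elim, intro allI impI)
    case (elim N)
    fix n V assume A: "near_size \<rho> N n \<and> V \<in> subsets N n"
    then have near: "near_size \<rho> N n" and V: "V \<in> subsets N n" by auto
    note n = near_sizeD[OF near rho(1,2) elim(3)] and Lam = ln_choose_bounds[OF near rho(1,2) elim(3) rho(3)]
    define b where "b = \<rho> powr (1 + \<gamma>)"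
    define J where "J = {j\<in>{..n}. b * real N - 1 \<le> real j}"
    have V': "V \<subseteq> {..<N}" "card V = n" "finite V" using V by (auto simp: subsets_def intro: finite_subset)
    have "subsets N n \<subseteq> interior_family N n V b \<union> (level_set N n V 0 \<union> (\<Union>j\<in>J. level_set N n V j))"
    proof
      fix X assume X: "X \<in> subsets N n"
      have "card (V \<inter> X) \<le> n" using V' by (metis card_mono inf_le1)
      then show "X \<in> interior_family N n V b \<union> (level_set N n V 0 \<union> (\<Union>j\<in>J. level_set N n V j))"
        using X by (auto simp: interior_family_def level_set_def J_def not_less)
    qed
    then have "card (subsets N n) \<le> card (interior_family N n V b \<union> (level_set N n V 0 \<union> (\<Union>j\<in>J. level_set N n V j)))"
      by (intro card_mono) (auto simp: interior_family_def J_def)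
    also have "\<dots> \<le> card (interior_family N n V b) + (card (level_set N n V 0) + (\<Sum>j\<in>J. card (level_set N n V j)))"
      by (intro order.trans[OF card_Un_le] add_mono card_UN_le order.refl) (simp add: J_def)
    finally have "real (N choose n) \<le> real (card (interior_family N n V b) + (card (level_set N n V 0) + (\<Sum>j\<in>J. card (level_set N n V j))))"
      unfolding card_subsets by (rule of_nat_mono)
    then have 1: "real (N choose n) \<le> real (card (interior_family N n V b)) + (real (card (level_set N n V 0)) + (\<Sum>j\<in>J. real (card (level_set N n V j))))"
      by simp
    have "real (card (level_set N n V 0)) \<le> real ((n choose 0) * ((N - n) choose (n - 0)))"
      unfolding level_set_def using card_subsets_inter_le[OF V'(1), of 0 n] V'(2) by (intro of_nat_mono) simp
    also have "\<dots> \<le> real (N choose n) * (real N / (real n)\<^sup>2)" using choose_disjoint_le[OF n(1,2)] by simp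
    also have "\<dots> \<le> real (N choose n) * (1 / 4)"
    proof (intro mult_left_mono)
      have "(\<rho> / 2 * real N)\<^sup>2 \<le> (real n)\<^sup>2" using n rho by (intro power_mono) auto
      moreover have "4 * real N \<le> (\<rho> / 2 * real N)\<^sup>2"
      proof -
        have "16 \<le> \<rho>\<^sup>2 * real N" using elim(4) rho by (simp add: divide_le_eq mult.commute)
        then have "16 * real N \<le> \<rho>\<^sup>2 * real N * real N" by (intro mult_right_mono) auto
        then show ?thesis by (simp add: power2_eq_square mult_ac)
      qed
      ultimately have "4 * real N \<le> (real n)\<^sup>2" by linarith
      then show "real N / (real n)\<^sup>2 \<le> 1 / 4" using n by (simp add: divide_le_eq)
    qed simp
    finally have 2: "real (card (level_set N n V 0)) \<le> real (N choose n) / 4" by simp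
    have "(\<Sum>j\<in>J. real (card (level_set N n V j))) \<le> (\<Sum>j\<in>J. real (N choose n) * exp (- (\<rho> * t / 16) * real N))"
    proof (intro sum_mono)
      fix j assume j: "j \<in> J"
      then have jn: "j \<le> n" by (simp add: J_def)
      have "real (card (level_set N n V j)) \<le> real ((n choose j) * ((N - n) choose (n - j)))"
        unfolding level_set_def using card_subsets_inter_le[OF V'(1) jn] V'(2) by (intro of_nat_mono) simp
      also have "\<dots> \<le> real (N choose n) * exp (- ln (real (N choose n)) * t / 8)"
        using elim(2)[rule_format, of n j] near j jn unfolding J_def b_def t_def by simp
      also have "\<dots> \<le> real (N choose n) * exp (- (\<rho> * t / 16) * real N)"
      proof -
        have "\<rho> / 2 * real N * t \<le> ln (real (N choose n)) * t" using n(6) Lam(2) t by (intro mult_right_mono) auto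
        then show ?thesis by (intro mult_left_mono) (auto simp: algebra_simps)
      qed
      finally show "real (card (level_set N n V j)) \<le> real (N choose n) * exp (- (\<rho> * t / 16) * real N)" .
    qed
    also have "\<dots> = real (card J) * (real (N choose n) * exp (- (\<rho> * t / 16) * real N))" by simp
    also have "\<dots> \<le> (real N + 1) * (real (N choose n) * exp (- (\<rho> * t / 16) * real N))"
    proof (intro mult_right_mono)
      have "card J \<le> card {..n}" unfolding J_def by (intro card_mono) auto
      then show "real (card J) \<le> real N + 1" using n by simp
    qed simp
    also have "\<dots> = real (N choose n) * ((real N + 1) * exp (- (\<rho> * t / 16) * real N))" by simp
    also have "\<dots> \<le> real (N choose n) * (1 / 4)" using elim(1) by (intro mult_left_mono) auto
    finally have "real (N choose n) \<le> 2 * real (card (interior_family N n V b))" using 1 2 by simp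
    then show "N choose n \<le> 2 * card (interior_family N n V (\<rho> powr (1 + \<gamma>)))"
      unfolding b_def by (metis of_nat_le_iff of_nat_mult of_nat_numeral)
  qed
qed

text \<open>First moment. With t = \<rho>^\<gamma> the number of sets on this level is below
  \<open>N choose n\<close> by a factor exp(- \<Lambda> t / 8). Lowering the squared energy level by
  the fraction t/16 spends half of this deficit; the other half, exp(- \<Lambda> t / 16), is the
  failure probability.\<close>

lemma boundary_max_upper_bound:
  assumes g: "0 < \<gamma>" "\<gamma> < 1 / 10"
  shows "\<forall>\<^sub>F \<rho> in at_right (0::real). \<forall>\<^sub>F N in sequentially. \<forall>n V j. near_size \<rho> N n \<and> V \<in> subsets N n \<and>
     \<rho> powr (1 + \<gamma>) * real N - 1 \<le> real j \<and> j \<le> n \<longrightarrow>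
    (\<forall>(M :: 'w measure) W. gaussian_symmetric_matrix N M W \<longrightarrow>
      measure M {\<omega>\<in>space M. \<exists>X\<in>level_set N n V j. energy (W \<omega>) X \<ge>
        2 * real n * sqrt (ln (real (N choose n)) * (1 - \<rho> powr \<gamma> / 16) / real N)}
      \<le> exp (- (\<rho> powr (1 + \<gamma>) / 32) * real N))"
  using tail_level_count[OF g] eventually_small_ln_ge[of 2]
proof eventually_elim
  case (elim \<rho>)
  then have rho: "0 < \<rho>" "\<rho> < 1 / 4" "ln (1 / \<rho>) \<ge> 2" by auto
  define t where "t = \<rho> powr \<gamma>"
  have t: "0 < t" "t < 1" using rho g by (auto simp: t_def powr_lt_one)
  have rt: "\<rho> powr (1 + \<gamma>) = \<rho> * t" using rho by (simp add: t_def powr_add)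
  show ?case using elim(1) eventually_real_ge[of "1 / \<rho>"]
  proof (eventually_elim, intro allI impI)
    case (elim N)
    fix n V j and M :: "'w measure" and W
    assume A: "near_size \<rho> N n \<and> V \<in> subsets N n \<and> \<rho> powr (1 + \<gamma>) * real N - 1 \<le> real j \<and> j \<le> n"
      and W: "gaussian_symmetric_matrix N M W"
    then have near: "near_size \<rho> N n" and V: "V \<in> subsets N n" by auto
    interpret prob_space M by (rule gaussian_prob_space[OF W])
    note n = near_sizeD[OF near rho(1,2) elim(2)] and Lam = ln_choose_bounds[OF near rho(1,2) elim(2) rho(3)]
    define \<Lambda> where "\<Lambda> = ln (real (N choose n))"
    define s where "s = 2 * real n * sqrt (\<Lambda> * (1 - t / 16) / real N)"
    have V': "V \<subseteq> {..<N}" "card V = n" using V by (auto simp: subsets_def)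
    have Lam0: "\<Lambda> \<ge> 0" using Lam(2) by (simp add: \<Lambda>_def)
    have s0: "s \<ge> 0" unfolding s_def using Lam0 t by simp
    have tail: "prob {\<omega>\<in>space M. energy (W \<omega>) X \<ge> s} \<le> exp (- \<Lambda> * (1 - t / 16))" if X: "X \<in> level_set N n V j" for X
    proof -
      have X': "X \<subseteq> {..<N}" "card X = n" using X by (auto simp: level_set_def subsets_def)
      have "(\<Sum>i<N. \<Sum>j<N. (sq_ind X i j)\<^sup>2) \<le> (real n)\<^sup>2"
        using sum_sq_ind_sq_ind[OF X'(1), of X] X'(2) by (simp add: power2_eq_square)
      then have "prob {\<omega>\<in>space M. energy (W \<omega>) X \<ge> s} \<le> exp (- s\<^sup>2 * real N / (4 * (real n)\<^sup>2))"
        unfolding energy_eq[OF X'(1)] using s0 n by (intro gaussian_sum_tail[OF W]) auto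
      also have "s\<^sup>2 = 4 * (real n)\<^sup>2 * (\<Lambda> * (1 - t / 16) / real N)"
        unfolding s_def using Lam0 t by (simp add: power_mult_distrib)
      also have "- (4 * (real n)\<^sup>2 * (\<Lambda> * (1 - t / 16) / real N)) * real N / (4 * (real n)\<^sup>2) = - \<Lambda> * (1 - t / 16)"
        using n by simp
      finally show ?thesis .
    qed
    have m: "(\<lambda>\<omega>. energy (W \<omega>) X) \<in> borel_measurable M" if "X \<in> level_set N n V j" for X
      using that n by (intro measurable_energy[OF W]) (auto simp: level_set_def subsets_def)
    have "{\<omega>\<in>space M. \<exists>X\<in>level_set N n V j. energy (W \<omega>) X \<ge> s} = (\<Union>X\<in>level_set N n V j. {\<omega>\<in>space M. energy (W \<omega>) X \<ge> s})"
      by auto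
    then have "prob {\<omega>\<in>space M. \<exists>X\<in>level_set N n V j. energy (W \<omega>) X \<ge> s} \<le> (\<Sum>X\<in>level_set N n V j. prob {\<omega>\<in>space M. energy (W \<omega>) X \<ge> s})"
      using m by (simp, intro finite_measure_subadditive_finite) (auto intro!: borel_measurable_le)
    also have "\<dots> \<le> (\<Sum>X\<in>level_set N n V j. exp (- \<Lambda> * (1 - t / 16)))" by (intro sum_mono tail)
    also have "\<dots> = real (card (level_set N n V j)) * exp (- \<Lambda> * (1 - t / 16))" by simp
    also have "\<dots> \<le> (real (N choose n) * exp (- \<Lambda> * t / 8)) * exp (- \<Lambda> * (1 - t / 16))"
    proof (intro mult_right_mono)
      have "real (card (level_set N n V j)) \<le> real ((n choose j) * ((N - n) choose (n - j)))"
        unfolding level_set_def using card_subsets_inter_le[OF V'(1), of j n] V'(2) A by (intro of_nat_mono) simp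
      also have "\<dots> \<le> real (N choose n) * exp (- \<Lambda> * t / 8)"
        using elim(1)[rule_format, of n j] A unfolding \<Lambda>_def t_def by simp
      finally show "real (card (level_set N n V j)) \<le> real (N choose n) * exp (- \<Lambda> * t / 8)" .
    qed simp
    also have "\<dots> = exp (- \<Lambda> * t / 16)"
    proof -
      have "real (N choose n) = exp \<Lambda>" using n by (simp add: \<Lambda>_def)
      then show ?thesis by (simp add: exp_add[symmetric] algebra_simps)
    qed
    also have "\<dots> \<le> exp (- (\<rho> * t / 32) * real N)"
    proof -
      have "\<rho> / 2 * real N * t \<le> \<Lambda> * t" unfolding \<Lambda>_def using n(6) Lam(2) t by (intro mult_right_mono) auto
      then show ?thesis by (simp add: algebra_simps)
    qed
    finally show "prob {\<omega>\<in>space M. \<exists>X\<in>level_set N n V j. energy (W \<omega>) X \<ge>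
        2 * real n * sqrt (ln (real (N choose n)) * (1 - \<rho> powr \<gamma> / 16) / real N)}
      \<le> exp (- (\<rho> powr (1 + \<gamma>) / 32) * real N)"
      unfolding s_def \<Lambda>_def rt unfolding t_def .
  qed
qed

text \<open>Everything is measured against G = \<rho>^(3/2 + \<gamma>). The entropy deficit lowers
  the boundary level by the fraction t/32, against a fraction at most t/64 on the inner side; since
  sqrt(\<Lambda>/N) \<ge> sqrt \<rho> / 2, the difference is at least G N / 128. The spike, at most
  \<rho>^(2 + 2 \<gamma> - \<alpha>) N, and the two errors are each at most G N / 1024, and the
  condition on \<alpha> is what makes the spike of smaller order than G.\<close>

lemma energy_gap:
  assumes g: "0 < \<gamma>" "\<gamma> < \<theta>" "\<theta> < 1 / 10" and \<alpha>: "\<alpha> < 1 / 2 + \<gamma>"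
  shows "\<forall>\<^sub>F \<rho> in at_right (0::real). \<forall>lam. lam < \<rho> powr (- \<alpha>) \<longrightarrow> (\<forall>\<^sub>F N in sequentially. \<forall>n. near_size \<rho> N n \<longrightarrow>
     2 * real n * sqrt (ln (real (N choose n)) * (1 - \<rho> powr \<gamma> / 16) / real N) + lam * (\<rho> powr (1 + \<gamma>))\<^sup>2 * real N
       + \<rho> powr (3 / 2 + \<gamma>) / 512 * real N
     \<le> 2 * real n * sqrt ((1 - 20 * \<rho> powr \<theta>) * ln (real (N choose n)) / real N) - \<rho> ^ 3 * real N - \<rho> powr (9 / 5) * real N)"
proof -
  have "\<forall>\<^sub>F \<rho> in at_right (0::real). \<rho> powr \<theta> \<le> (1 / 1280) * \<rho> powr \<gamma>"
    "\<forall>\<^sub>F \<rho> in at_right (0::real). \<rho> powr 3 \<le> (1 / 1024) * \<rho> powr (3 / 2 + \<gamma>)"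
    "\<forall>\<^sub>F \<rho> in at_right (0::real). \<rho> powr (9 / 5) \<le> (1 / 1024) * \<rho> powr (3 / 2 + \<gamma>)"
    "\<forall>\<^sub>F \<rho> in at_right (0::real). \<rho> powr (2 + 2 * \<gamma> - \<alpha>) \<le> (1 / 1024) * \<rho> powr (3 / 2 + \<gamma>)"
    using g \<alpha> by (intro eventually_at_right_0_powr_le; simp)+
  then show ?thesis using eventually_small_ln_ge[of 2]
  proof (eventually_elim, intro allI impI)
    case (elim \<rho>)
    fix lam :: real
    assume lam: "lam < \<rho> powr (- \<alpha>)"
    have rho: "0 < \<rho>" "\<rho> < 1 / 4" "ln (1 / \<rho>) \<ge> 2" using elim by auto
    define t where "t = \<rho> powr \<gamma>"
    define \<eta> where "\<eta> = 20 * \<rho> powr \<theta>"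
    define G where "G = \<rho> powr (3 / 2 + \<gamma>)"
    have t: "0 < t" "t < 1" using rho g by (auto simp: t_def powr_lt_one)
    have eta: "0 \<le> \<eta>" "\<eta> \<le> t / 64" using elim(1) by (auto simp: \<eta>_def t_def)
    have bb: "(\<rho> powr (1 + \<gamma>))\<^sup>2 = \<rho> powr (2 + 2 * \<gamma>)"
      by (simp add: power2_eq_square powr_add[symmetric])
    have "lam * (\<rho> powr (1 + \<gamma>))\<^sup>2 \<le> \<rho> powr (- \<alpha>) * \<rho> powr (2 + 2 * \<gamma>)"
      unfolding bb using lam by (intro mult_right_mono) auto
    also have "\<dots> = \<rho> powr (2 + 2 * \<gamma> - \<alpha>)" by (simp add: powr_add[symmetric])
    finally have lamb: "lam * (\<rho> powr (1 + \<gamma>))\<^sup>2 \<le> G / 1024" using elim(4) by (simp add: G_def)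
    have r3: "\<rho> ^ 3 \<le> G / 1024" using elim(2) rho by (simp add: G_def powr_numeral)
    have r95: "\<rho> powr (9 / 5) \<le> G / 1024" using elim(3) by (simp add: G_def)
    show "\<forall>\<^sub>F N in sequentially. \<forall>n. near_size \<rho> N n \<longrightarrow>
     2 * real n * sqrt (ln (real (N choose n)) * (1 - \<rho> powr \<gamma> / 16) / real N) + lam * (\<rho> powr (1 + \<gamma>))\<^sup>2 * real N
       + \<rho> powr (3 / 2 + \<gamma>) / 512 * real N
     \<le> 2 * real n * sqrt ((1 - 20 * \<rho> powr \<theta>) * ln (real (N choose n)) / real N) - \<rho> ^ 3 * real N - \<rho> powr (9 / 5) * real N"
      using eventually_real_ge[of "1 / \<rho>"]
    proof (eventually_elim, intro allI impI)
      case (elim N)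
      fix n assume near: "near_size \<rho> N n"
      note n = near_sizeD[OF near rho(1,2) elim] and Lam = ln_choose_bounds[OF near rho(1,2) elim rho(3)]
      define \<Lambda> where "\<Lambda> = ln (real (N choose n))"
      define R where "R = sqrt (\<Lambda> / real N)"
      have Lam0: "\<Lambda> \<ge> 0" using Lam(2) by (simp add: \<Lambda>_def)
      have R0: "R \<ge> 0" unfolding R_def using Lam0 by simp
      have s1: "sqrt (\<Lambda> * (1 - t / 16) / real N) \<le> R * (1 - t / 32)"
      proof -
        have "sqrt (1 - t / 16) \<le> 1 - t / 32"
          using t by (intro real_le_lsqrt) (auto simp: power2_eq_square algebra_simps)
        then have "R * sqrt (1 - t / 16) \<le> R * (1 - t / 32)" using R0 by (intro mult_left_mono)
        then show ?thesis unfolding R_def by (simp add: real_sqrt_mult[symmetric])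
      qed
      have s2: "sqrt ((1 - \<eta>) * \<Lambda> / real N) \<ge> R * (1 - \<eta>)"
      proof -
        have "1 - \<eta> \<le> sqrt (1 - \<eta>)"
        proof (rule real_le_rsqrt)
          have "(1 - \<eta>) * (1 - \<eta>) \<le> 1 * (1 - \<eta>)" using eta t by (intro mult_right_mono) auto
          then show "(1 - \<eta>)\<^sup>2 \<le> 1 - \<eta>" by (simp add: power2_eq_square)
        qed
        then have "R * (1 - \<eta>) \<le> R * sqrt (1 - \<eta>)" using R0 by (intro mult_left_mono)
        then show ?thesis unfolding R_def by (simp add: real_sqrt_mult[symmetric] mult.commute)
      qed
      have R_ge: "R \<ge> sqrt \<rho> / 2"
        unfolding R_def
      proof (rule real_le_rsqrt)
        have "\<rho> / 2 * real N \<le> \<Lambda>" using n(6) Lam(2) unfolding \<Lambda>_def by linarith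
        then have "\<rho> / 2 \<le> \<Lambda> / real N" using n by (simp add: le_divide_eq)
        moreover have "(sqrt \<rho> / 2)\<^sup>2 = \<rho> / 4" using rho by (simp add: power_divide)
        ultimately show "(sqrt \<rho> / 2)\<^sup>2 \<le> \<Lambda> / real N" using rho by linarith
      qed
      have "G * real N / 128 = (\<rho> / 2 * real N) * (sqrt \<rho> / 2) * (t / 32)"
      proof -
        have "G = \<rho> * sqrt \<rho> * t"
          unfolding G_def t_def using rho powr_add[of \<rho> "3 / 2" \<gamma>] powr_add[of \<rho> 1 "1 / 2"] by (simp add: powr_half_sqrt)
        then show ?thesis by simp
      qed
      also have "\<dots> \<le> real n * R * (2 * (t / 32 - \<eta>))"
        using n R_ge R0 eta t rho by (intro mult_mono) auto
      finally have gap: "G * real N / 128 \<le> 2 * real n * (R * (1 - \<eta>)) - 2 * real n * (R * (1 - t / 32))"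
        by (simp add: algebra_simps)
      have "2 * real n * sqrt (\<Lambda> * (1 - t / 16) / real N) \<le> 2 * real n * (R * (1 - t / 32))"
        "2 * real n * (R * (1 - \<eta>)) \<le> 2 * real n * sqrt ((1 - \<eta>) * \<Lambda> / real N)"
        using s1 s2 by (auto intro!: mult_left_mono)
      moreover have "lam * (\<rho> powr (1 + \<gamma>))\<^sup>2 * real N \<le> G / 1024 * real N" "\<rho> ^ 3 * real N \<le> G / 1024 * real N"
        "\<rho> powr (9 / 5) * real N \<le> G / 1024 * real N"
        using mult_right_mono[OF lamb, of "real N"] mult_right_mono[OF r3, of "real N"]
          mult_right_mono[OF r95, of "real N"] by simp_all
      moreover have "0 \<le> G * real N" by (simp add: G_def)
      ultimately show "2 * real n * sqrt (ln (real (N choose n)) * (1 - \<rho> powr \<gamma> / 16) / real N) + lam * (\<rho> powr (1 + \<gamma>))\<^sup>2 * real N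
       + \<rho> powr (3 / 2 + \<gamma>) / 512 * real N
     \<le> 2 * real n * sqrt ((1 - 20 * \<rho> powr \<theta>) * ln (real (N choose n)) / real N) - \<rho> ^ 3 * real N - \<rho> powr (9 / 5) * real N"
        using gap unfolding \<Lambda>_def[symmetric] t_def[symmetric] \<eta>_def[symmetric] G_def[symmetric] by simp
    qed
  qed
qed

section \<open>The free energy well\<close>

definition ones :: "nat \<Rightarrow> (nat \<Rightarrow> real) \<Rightarrow> nat set" where
  "ones N x = {i. i < N \<and> x i = 1}"

lemma ones_subset: "ones N x \<subseteq> {..<N}" and finite_ones [simp]: "finite (ones N x)"
  by (auto simp: ones_def)

lemma slice_eq_ones: "x \<in> slice N \<rho> \<Longrightarrow> i < N \<Longrightarrow> x i = of_bool (i \<in> ones N x)"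
  by (auto simp: slice_def ones_def PiE_iff)

lemma sum_slice:
  assumes "x \<in> slice N \<rho>"
  shows "(\<Sum>i<N. x i * f i) = (\<Sum>i\<in>ones N x. f i)"
proof -
  have "(\<Sum>i<N. x i * f i) = (\<Sum>i<N. of_bool (i \<in> ones N x) * f i)"
    using assms by (intro sum.cong refl) (simp add: slice_eq_ones)
  also have "\<dots> = (\<Sum>i\<in>ones N x. f i)"
    using ones_subset by (intro sum.mono_neutral_cong_right) auto
  finally show ?thesis .
qed

lemma card_ones: "x \<in> slice N \<rho> \<Longrightarrow> int (card (ones N x)) = num_ones N \<rho>"
proof -
  assume x: "x \<in> slice N \<rho>"
  have "(\<Sum>i<N. x i) = real (card (ones N x))" using sum_slice[OF x, of "\<lambda>_. 1"] by simp
  then have "real_of_int (int (card (ones N x))) = real_of_int (num_ones N \<rho>)" using x by (simp add: slice_def)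
  then show ?thesis by (simp only: of_int_eq_iff)
qed

lemma near_size_card_ones:
  assumes "x \<in> slice N \<rho>"
  shows "near_size \<rho> N (card (ones N x))"
proof -
  have "num_ones N \<rho> = int (card (ones N x))" using card_ones[OF assms] by simp
  then have "real N * \<rho> \<in> {real_of_int (int (card (ones N x))) - 1 / 2 <.. real_of_int (int (card (ones N x))) + 1 / 2}"
    unfolding num_ones_iff .
  then have "real (card (ones N x)) - 1 / 2 < real N * \<rho>" "real N * \<rho> \<le> real (card (ones N x)) + 1 / 2"
    by auto
  then show ?thesis unfolding near_size_def by linarith
qed

lemma ones_bij:
  assumes v: "v \<in> slice N \<rho>"
  shows "bij_betw (ones N) (slice N \<rho>) (subsets N (card (ones N v)))"
proof (rule bij_betw_byWitness[where f'="\<lambda>X. \<lambda>i\<in>{..<N}. of_bool (i \<in> X)"])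
  let ?g = "\<lambda>X. \<lambda>i\<in>{..<N}. of_bool (i \<in> X) :: real"
  show "\<forall>x\<in>slice N \<rho>. ?g (ones N x) = x"
  proof
    fix x assume x: "x \<in> slice N \<rho>"
    then have "x \<in> extensional {..<N}" by (auto simp: slice_def PiE_def)
    then show "?g (ones N x) = x"
      by (intro extensionalityI[of _ "{..<N}"]) (auto simp: slice_eq_ones[OF x])
  qed
  have g: "ones N (?g X) = X" if "X \<in> subsets N (card (ones N v))" for X
    using that by (auto simp: subsets_def ones_def split: if_splits)
  then show "\<forall>X\<in>subsets N (card (ones N v)). ones N (?g X) = X" by blast
  show "ones N ` slice N \<rho> \<subseteq> subsets N (card (ones N v))"
  proof (rule image_subsetI)
    fix x assume "x \<in> slice N \<rho>"
    then have "int (card (ones N x)) = int (card (ones N v))" using card_ones v by simp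
    then show "ones N x \<in> subsets N (card (ones N v))" using ones_subset by (simp add: subsets_def)
  qed
  show "?g ` subsets N (card (ones N v)) \<subseteq> slice N \<rho>"
  proof clarify
    fix X assume X: "X \<in> subsets N (card (ones N v))"
    then have X': "X \<subseteq> {..<N}" "card X = card (ones N v)" by (auto simp: subsets_def)
    have "(\<Sum>i<N. ?g X i) = (\<Sum>i<N. of_bool (i \<in> X))" by (intro sum.cong) auto
    also have "\<dots> = real (card X)" using X' by (simp add: sum_of_bool_eq Int_absorb1)
    also have "\<dots> = of_int (num_ones N \<rho>)" using card_ones[OF v] X' by (metis of_int_of_nat_eq)
    finally show "?g X \<in> slice N \<rho>" by (auto simp: slice_def)
  qed
qed

lemma overlap_eq: "v \<in> slice N \<rho> \<Longrightarrow> x \<in> slice N \<rho> \<Longrightarrow> overlap N v x = real (card (ones N v \<inter> ones N x)) / real N"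
proof -
  assume v: "v \<in> slice N \<rho>" and x: "x \<in> slice N \<rho>"
  have "(\<Sum>i<N. x i * v i) = (\<Sum>i\<in>ones N x. v i)" by (rule sum_slice[OF x])
  also have "\<dots> = (\<Sum>i\<in>ones N x. of_bool (i \<in> ones N v))"
    using ones_subset by (intro sum.cong refl slice_eq_ones[OF v]) auto
  also have "\<dots> = real (card (ones N v \<inter> ones N x))" by (simp add: sum_of_bool_eq Int_commute)
  finally show ?thesis by (simp add: overlap_def)
qed

lemma quad_form_eq:
  assumes v: "v \<in> slice N \<rho>" and x: "x \<in> slice N \<rho>"
  shows "quad_form N (spiked_matrix N lam v w) x = energy w (ones N x) + lam / real N * (real (card (ones N v \<inter> ones N x)))\<^sup>2"
proof -
  let ?X = "ones N x"
  have "quad_form N (spiked_matrix N lam v w) x = (\<Sum>i\<in>?X. \<Sum>j\<in>?X. spiked_matrix N lam v w i j)"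
  proof -
    have "(\<Sum>j<N. a j * x j) = (\<Sum>j\<in>?X. a j)" for a
      using sum_slice[OF x, of a] by (simp add: mult.commute)
    then show ?thesis unfolding quad_form_def using sum_slice[OF x] by simp
  qed
  also have "\<dots> = energy w ?X + lam / real N * ((\<Sum>i\<in>?X. v i) * (\<Sum>j\<in>?X. v j))"
    unfolding spiked_matrix_def energy_def sum_product by (simp add: sum.distrib sum_distrib_left)
  also have "(\<Sum>i\<in>?X. v i) = (\<Sum>i\<in>?X. of_bool (i \<in> ones N v))"
    using ones_subset by (intro sum.cong refl slice_eq_ones[OF v]) auto
  also have "\<dots> = real (card (ones N v \<inter> ?X))" by (simp add: sum_of_bool_eq Int_commute)
  finally show ?thesis by (simp add: power2_eq_square)
qed

text \<open>Equal cardinality and Hamming distance 2 mean a single swap, so one move cannot jump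
  across a boundary level.\<close>

lemma card_inter_neighbor_le:
  assumes x: "x \<in> slice N \<rho>" and y: "y \<in> slice N \<rho>" and h: "hamming_dist N x y = 2"
  shows "card (V \<inter> ones N y) \<le> card (V \<inter> ones N x) + 1"
proof -
  let ?X = "ones N x" and ?Y = "ones N y"
  have "{i. i < N \<and> x i \<noteq> y i} = (?X - ?Y) \<union> (?Y - ?X)"
  proof (rule set_eqI)
    fix i
    have "i < N \<and> x i \<noteq> y i \<longleftrightarrow> i < N \<and> (i \<in> ?X) \<noteq> (i \<in> ?Y)"
      using slice_eq_ones[OF x, of i] slice_eq_ones[OF y, of i] by auto
    then show "i \<in> {i. i < N \<and> x i \<noteq> y i} \<longleftrightarrow> i \<in> (?X - ?Y) \<union> (?Y - ?X)"
      by (auto simp: ones_def)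
  qed
  then have "card (?X - ?Y) + card (?Y - ?X) = 2"
    using h unfolding hamming_dist_def by (subst card_Un_disjoint[symmetric]) auto
  moreover have "card ?X = card ?Y" using card_ones[OF x] card_ones[OF y] by simp
  then have "card (?X - ?Y) = card (?Y - ?X)" by (simp add: card_Diff_subset_Int Int_commute)
  ultimately have 1: "card (?Y - ?X) = 1" by simp
  have "card (V \<inter> ?Y) \<le> card ((V \<inter> ?X) \<union> (?Y - ?X))" by (intro card_mono) auto
  also have "\<dots> \<le> card (V \<inter> ?X) + card (?Y - ?X)" by (rule card_Un_le)
  finally show ?thesis using 1 by simp
qed

text \<open>The states through which the chain can leave the window \<open>(0, b)\<close> have \<open>1\<close> or
  \<open>\<lceil>b * N\<rceil> - 1\<close> ones in common with \<open>v\<close>.\<close>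

lemma boundary_weight_le:
  fixes lam \<beta> b A g :: real
  assumes v: "v \<in> slice N \<rho>" and N: "N > 0" and tame: "tame_matrix N w"
    and sym: "\<And>i j. i < N \<Longrightarrow> j < N \<Longrightarrow> w i j = w j i"
    and lam: "lam \<ge> 0" and \<beta>: "\<beta> \<ge> 0" "\<beta> * g \<ge> 2" and \<rho>: "0 < \<rho>" "\<rho> < 1"
    and n: "real (card (ones N v)) \<ge> \<rho> / 2 * real N"
    and \<epsilon>: "\<epsilon> = \<rho>\<^sup>2 * exp (- \<beta> * 192 / \<rho>) / 64" "\<epsilon> * real N \<ge> 1" "\<epsilon> < b"
    and inner: "X0 \<in> interior_family N (card (ones N v)) (ones N v) b" "energy w X0 \<ge> A"
    and outer: "\<And>X j. b * real N - 1 \<le> real j \<Longrightarrow> real j < b * real N \<Longrightarrow> X \<in> level_set N (card (ones N v)) (ones N v) j \<Longrightarrow>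
      energy w X \<le> A - lam * b\<^sup>2 * real N - g * real N"
  defines "\<pi> \<equiv> gibbs N \<rho> \<beta> (spiked_matrix N lam v w)"
    and "I \<equiv> {x. overlap N v x \<in> {0<..<b}}"
    and "D \<equiv> {x. card (ones N v \<inter> ones N x) = 1 \<or> b * real N - 1 \<le> real (card (ones N v \<inter> ones N x))}"
  shows "(\<Sum>x\<in>slice N \<rho> \<inter> I \<inter> D. pmf \<pi> x) \<le>
    (4 * exp (- ln 2 * \<epsilon> * real N) + exp (- real N)) * (\<Sum>x\<in>slice N \<rho> \<inter> I. pmf \<pi> x)"
    and "(\<Sum>x\<in>slice N \<rho> \<inter> I. pmf \<pi> x) > 0"
proof -
  let ?S = "slice N \<rho>" and ?V = "ones N v" and ?n = "card (ones N v)"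
  define H where "H X = energy w X + lam / real N * (real (card (?V \<inter> X)))\<^sup>2" for X
  define Z where "Z = (\<Sum>y\<in>?S. exp (\<beta> * quad_form N (spiked_matrix N lam v w) y))"
  define F where "F = interior_family N ?n ?V b"
  \<comment> \<open>The last level strictly below b N. It is the only integer in [b N - 1, b N), so
    all right boundary states lie on one level.\<close>
  define j where "j = nat (\<lceil>b * real N\<rceil> - 1)"
  have ne: "?S \<noteq> {}" using v by auto
  have Z: "Z > 0" unfolding Z_def using ne by (intro sum_pos) auto
  have pm: "pmf \<pi> x = exp (\<beta> * H (ones N x)) / Z" if "x \<in> ?S" for x
    unfolding \<pi>_def pmf_gibbs[OF ne] using that by (simp add: Z_def quad_form_eq[OF v that] H_def)
  have inI: "x \<in> I \<longleftrightarrow> ones N x \<in> F" if "x \<in> ?S" for x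
  proof -
    have "ones N x \<in> subsets N ?n" using ones_bij[OF v] that by (auto simp: bij_betw_def)
    then show ?thesis using N unfolding I_def F_def interior_family_def
      by (auto simp: overlap_eq[OF v that] divide_less_eq zero_less_divide_iff)
  qed
  have bij: "bij_betw (ones N) (?S \<inter> I) F"
  proof (rule bij_betw_subset[OF ones_bij[OF v], THEN bij_betw_cong[THEN iffD1, rotated]])
    show "?S \<inter> I \<subseteq> ?S" by simp
  next
    have im: "ones N ` ?S = subsets N ?n" using ones_bij[OF v] by (simp add: bij_betw_def)
    have sub: "F \<subseteq> subsets N ?n" unfolding F_def interior_family_def by auto
    show "ones N ` (?S \<inter> I) = F"
    proof (intro equalityI subsetI)
      fix X assume "X \<in> ones N ` (?S \<inter> I)"
      then obtain x where x: "x \<in> ?S" "x \<in> I" "X = ones N x" by auto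
      then show "X \<in> F" using inI[OF x(1)] by simp
    next
      fix X assume X: "X \<in> F"
      then have "X \<in> ones N ` ?S" unfolding im using sub by blast
      then obtain x where x: "x \<in> ?S" "X = ones N x" by auto
      then show "X \<in> ones N ` (?S \<inter> I)" using inI[OF x(1)] X by auto
    qed
  qed simp
  have sumF: "(\<Sum>x\<in>?S \<inter> I. pmf \<pi> x) = (\<Sum>X\<in>F. exp (\<beta> * H X)) / Z"
    using sum.reindex_bij_betw[OF bij, of "\<lambda>X. exp (\<beta> * H X) / Z"] pm by (simp add: sum_divide_distrib)
  have finF: "finite F" unfolding F_def interior_family_def by simp
  have "X0 \<in> F" using inner by (simp add: F_def)
  then have pos: "(\<Sum>X\<in>F. exp (\<beta> * H X)) > 0" using finF by (intro sum_pos) auto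
  then show "(\<Sum>x\<in>?S \<inter> I. pmf \<pi> x) > 0" unfolding sumF using Z by simp
  have "\<epsilon> > 0" unfolding \<epsilon>(1) using \<rho> by simp
  then have b0: "b > 0" using \<epsilon>(3) by linarith
  have bN: "b * real N > 0" using b0 N by simp
  have j: "b * real N - 1 \<le> real j" "real j < b * real N"
  proof -
    have "\<lceil>b * real N\<rceil> \<ge> 1" using bN by simp
    then have "real j = of_int \<lceil>b * real N\<rceil> - 1" by (simp add: j_def)
    then show "b * real N - 1 \<le> real j" "real j < b * real N" by linarith+
  qed
  have juniq: "i = j" if "b * real N - 1 \<le> real i" "real i < b * real N" for i
  proof -
    have "real i < real j + 1" "real j < real i + 1" using j that by linarith+
    then show ?thesis by linarith
  qed
  have sub: "ones N ` (?S \<inter> I \<inter> D) \<subseteq> level_set N ?n ?V 1 \<union> level_set N ?n ?V j"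
  proof
    fix X assume "X \<in> ones N ` (?S \<inter> I \<inter> D)"
    then obtain x where x: "x \<in> ?S" "x \<in> I" "x \<in> D" "X = ones N x" by auto
    then have "X \<in> F" using inI by simp
    then show "X \<in> level_set N ?n ?V 1 \<union> level_set N ?n ?V j"
      using x juniq unfolding F_def interior_family_def level_set_def D_def by auto
  qed
  have inj: "inj_on (ones N) (?S \<inter> I \<inter> D)"
    using ones_bij[OF v] by (auto simp: bij_betw_def intro: inj_on_subset)
  have "(\<Sum>x\<in>?S \<inter> I \<inter> D. pmf \<pi> x) = (\<Sum>x\<in>?S \<inter> I \<inter> D. exp (\<beta> * H (ones N x)) / Z)"
    using pm by (intro sum.cong) auto
  also have "\<dots> = (\<Sum>X\<in>ones N ` (?S \<inter> I \<inter> D). exp (\<beta> * H X) / Z)"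
    by (simp add: sum.reindex[OF inj])
  also have "\<dots> \<le> (\<Sum>X\<in>level_set N ?n ?V 1 \<union> level_set N ?n ?V j. exp (\<beta> * H X) / Z)"
    using Z sub by (intro sum_mono2) auto
  also have "\<dots> \<le> (\<Sum>X\<in>level_set N ?n ?V 1. exp (\<beta> * H X) / Z) + (\<Sum>X\<in>level_set N ?n ?V j. exp (\<beta> * H X) / Z)"
    using Z by (subst sum_Un) (auto intro!: sum_nonneg)
  also have "\<dots> = ((\<Sum>X\<in>level_set N ?n ?V 1. exp (\<beta> * H X)) + (\<Sum>X\<in>level_set N ?n ?V j. exp (\<beta> * H X))) / Z"
    by (simp add: sum_divide_distrib add_divide_distrib)
  finally have D: "(\<Sum>x\<in>?S \<inter> I \<inter> D. pmf \<pi> x) \<le>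
    ((\<Sum>X\<in>level_set N ?n ?V 1. exp (\<beta> * H X)) + (\<Sum>X\<in>level_set N ?n ?V j. exp (\<beta> * H X))) / Z" .
  have left: "(\<Sum>X\<in>level_set N ?n ?V 1. exp (\<beta> * H X)) \<le> 4 * exp (- ln 2 * \<epsilon> * real N) * (\<Sum>X\<in>F. exp (\<beta> * H X))"
  proof -
    \<comment> \<open>The highest level reached by \<open>level_sum_growth\<close>. Since \<epsilon>
      < b it lies in the window, so its weight bounds the total weight of the window from
      below.\<close>
    define k where "k = nat \<lfloor>\<epsilon> * real N\<rfloor>"
    have "real k = of_int \<lfloor>\<epsilon> * real N\<rfloor>" using \<epsilon>(2) by (simp add: k_def)
    then have k: "real k \<le> \<epsilon> * real N" "real k > \<epsilon> * real N - 1" "1 \<le> k" using \<epsilon>(2) by linarith+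
    have V: "?V \<in> subsets N ?n" using ones_subset by (auto simp: subsets_def)
    have "2 ^ (k - 1) * (\<Sum>X\<in>level_set N ?n ?V 1. exp (\<beta> * H X)) \<le> (\<Sum>X\<in>level_set N ?n ?V k. exp (\<beta> * H X))"
      unfolding H_def using lam N
      by (intro level_sum_growth[OF tame sym V _ \<beta>(1) N \<rho> n \<epsilon>(1) k(3,1)]) auto
    also have "\<dots> \<le> (\<Sum>X\<in>F. exp (\<beta> * H X))"
    proof (rule sum_mono2[OF finF])
      have "real k < b * real N" using k \<epsilon>(3) N mult_strict_right_mono[of \<epsilon> b "real N"] by linarith
      then show "level_set N ?n ?V k \<subseteq> F" using k unfolding F_def interior_family_def level_set_def by auto
    qed simp
    finally have 1: "2 ^ (k - 1) * (\<Sum>X\<in>level_set N ?n ?V 1. exp (\<beta> * H X)) \<le> (\<Sum>X\<in>F. exp (\<beta> * H X))" .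
    \<comment> \<open>The factor 4 = 2^2 pays for rounding \<epsilon> N down and for the exponent k
      - 1.\<close>
    have "1 \<le> 4 * exp (- ln 2 * \<epsilon> * real N) * 2 ^ (k - 1)"
    proof -
      have "real (k - 1) \<ge> \<epsilon> * real N - 2" using k by simp
      then have "ln 2 * (\<epsilon> * real N - 2) \<le> ln 2 * real (k - 1)" by (intro mult_left_mono) auto
      then have "exp 0 \<le> exp (2 * ln 2 + (- ln 2 * \<epsilon> * real N) + real (k - 1) * ln 2)"
        by (simp add: algebra_simps)
      also have "\<dots> = 4 * exp (- ln 2 * \<epsilon> * real N) * 2 ^ (k - 1)"
      proof -
        have "exp (2 * ln 2 :: real) = 4" using exp_of_nat_mult[of 2 "ln 2 :: real"] by simp
        moreover have "exp (real (k - 1) * ln 2) = (2 :: real) ^ (k - 1)" by (simp add: exp_of_nat_mult)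
        ultimately show ?thesis unfolding exp_add by simp
      qed
      finally show ?thesis by simp
    qed
    then have "1 * (\<Sum>X\<in>level_set N ?n ?V 1. exp (\<beta> * H X)) \<le>
        4 * exp (- ln 2 * \<epsilon> * real N) * 2 ^ (k - 1) * (\<Sum>X\<in>level_set N ?n ?V 1. exp (\<beta> * H X))"
      by (intro mult_right_mono sum_nonneg) auto
    also have "\<dots> = 4 * exp (- ln 2 * \<epsilon> * real N) * (2 ^ (k - 1) * (\<Sum>X\<in>level_set N ?n ?V 1. exp (\<beta> * H X)))"
      by simp
    also have "\<dots> \<le> 4 * exp (- ln 2 * \<epsilon> * real N) * (\<Sum>X\<in>F. exp (\<beta> * H X))"
      using 1 by (intro mult_left_mono) auto
    finally show ?thesis by simp
  qed
  have right: "(\<Sum>X\<in>level_set N ?n ?V j. exp (\<beta> * H X)) \<le> exp (- real N) * (\<Sum>X\<in>F. exp (\<beta> * H X))"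
  proof -
    \<comment> \<open>The single interior state \<open>X0\<close> serves as denominator: the energy
      gap with \<beta> g \<ge> 2 gives a factor exp(-2 N) for each boundary state, and there are at
      most exp(N) of them.\<close>
    have "(\<Sum>X\<in>level_set N ?n ?V j. exp (\<beta> * H X)) \<le> (\<Sum>X\<in>level_set N ?n ?V j. exp (- 2 * real N) * exp (\<beta> * H X0))"
    proof (intro sum_mono)
      fix X assume X: "X \<in> level_set N ?n ?V j"
      have "lam / real N * (real (card (?V \<inter> X)))\<^sup>2 \<le> lam / real N * (b * real N)\<^sup>2"
        using X j lam by (intro mult_left_mono power_mono) (auto simp: level_set_def)
      also have "\<dots> = lam * b\<^sup>2 * real N" using N by (simp add: power2_eq_square)
      finally have "H X \<le> A - g * real N" using outer[OF j X] by (simp add: H_def)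
      moreover have "A \<le> H X0" using inner lam by (simp add: H_def add_increasing2)
      ultimately have "H X \<le> H X0 - g * real N" by simp
      then have "\<beta> * H X \<le> \<beta> * (H X0 - g * real N)" using \<beta> by (intro mult_left_mono) auto
      also have "\<dots> \<le> \<beta> * H X0 - 2 * real N"
        using mult_right_mono[OF \<beta>(2), of "real N"] by (simp add: algebra_simps)
      finally show "exp (\<beta> * H X) \<le> exp (- 2 * real N) * exp (\<beta> * H X0)" by (simp add: exp_add[symmetric])
    qed
    also have "\<dots> = real (card (level_set N ?n ?V j)) * (exp (- 2 * real N) * exp (\<beta> * H X0))" by simp
    also have "\<dots> \<le> exp (real N) * (exp (- 2 * real N) * exp (\<beta> * H X0))"
    proof (intro mult_right_mono)
      have "card (level_set N ?n ?V j) \<le> card (Pow {..<N})"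
        by (intro card_mono) (auto simp: level_set_def subsets_def)
      then have "real (card (level_set N ?n ?V j)) \<le> real (2 ^ N)" by (simp add: card_Pow)
      also have "\<dots> \<le> exp 1 ^ N" using exp_ge_add_one_self[of 1] by (simp add: power_mono)
      also have "\<dots> = exp (real N)" by (simp add: exp_of_nat_mult[symmetric])
      finally show "real (card (level_set N ?n ?V j)) \<le> exp (real N)" .
    qed simp
    also have "\<dots> = exp (- real N) * exp (\<beta> * H X0)" by (simp add: exp_add[symmetric])
    also have "\<dots> \<le> exp (- real N) * (\<Sum>X\<in>F. exp (\<beta> * H X))"
      using \<open>X0 \<in> F\<close> finF by (intro mult_left_mono member_le_sum) auto
    finally show ?thesis .
  qed
  have "(\<Sum>x\<in>?S \<inter> I \<inter> D. pmf \<pi> x) \<le>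
    (4 * exp (- ln 2 * \<epsilon> * real N) * (\<Sum>X\<in>F. exp (\<beta> * H X)) + exp (- real N) * (\<Sum>X\<in>F. exp (\<beta> * H X))) / Z"
    using left right Z by (intro order.trans[OF D] divide_right_mono add_mono) auto
  also have "\<dots> = (4 * exp (- ln 2 * \<epsilon> * real N) + exp (- real N)) * (\<Sum>x\<in>?S \<inter> I. pmf \<pi> x)"
    unfolding sumF by (simp add: algebra_simps add_divide_distrib)
  finally show "(\<Sum>x\<in>?S \<inter> I \<inter> D. pmf \<pi> x) \<le>
    (4 * exp (- ln 2 * \<epsilon> * real N) + exp (- real N)) * (\<Sum>x\<in>?S \<inter> I. pmf \<pi> x)" .
qed

text \<open>Combines the exit bound for reversible chains with the boundary weight. One move changes
  the number of ones shared with \<open>v\<close> by at most one, so the window can be left only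
  from the count 1 or from the last count below b N, which is the set \<open>D\<close>.\<close>

lemma exit_probability_le:
  fixes lam \<beta> b A g :: real
  assumes v: "v \<in> slice N \<rho>" and N: "N > 0" and tame: "tame_matrix N w"
    and sym: "\<And>i j. i < N \<Longrightarrow> j < N \<Longrightarrow> w i j = w j i"
    and lam: "lam \<ge> 0" and \<beta>: "\<beta> \<ge> 0" "\<beta> * g \<ge> 2" and \<rho>: "0 < \<rho>" "\<rho> < 1"
    and n: "real (card (ones N v)) \<ge> \<rho> / 2 * real N"
    and \<epsilon>: "\<epsilon> = \<rho>\<^sup>2 * exp (- \<beta> * 192 / \<rho>) / 64" "\<epsilon> * real N \<ge> 1" "\<epsilon> < b"
    and inner: "X0 \<in> interior_family N (card (ones N v)) (ones N v) b" "energy w X0 \<ge> A"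
    and outer: "\<And>X j. b * real N - 1 \<le> real j \<Longrightarrow> real j < b * real N \<Longrightarrow> X \<in> level_set N (card (ones N v)) (ones N v) j \<Longrightarrow>
      energy w X \<le> A - lam * b\<^sup>2 * real N - g * real N"
  defines "\<pi> \<equiv> gibbs N \<rho> \<beta> (spiked_matrix N lam v w)"
    and "I \<equiv> {x. overlap N v x \<in> {0<..<b}}"
  assumes Q: "nearest_neighbor_chain N \<rho> Q" "reversible_on (slice N \<rho>) \<pi> Q"
  shows "measure_pmf.expectation (cond_pmf \<pi> I) (\<lambda>x. measure (chain_law Q x) {\<xi>. hitting_time (- I) \<xi> \<le> enat T})
    \<le> real T * (4 * exp (- ln 2 * \<epsilon> * real N) + exp (- real N))"
proof -
  let ?S = "slice N \<rho>"
  define D where "D = {x. card (ones N v \<inter> ones N x) = 1 \<or> b * real N - 1 \<le> real (card (ones N v \<inter> ones N x))}"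
  note bw = boundary_weight_le[OF v N tame sym lam \<beta> \<rho> n \<epsilon> inner outer, folded \<pi>_def I_def D_def]
  have ne: "?S \<noteq> {}" using v by auto
  have supp: "set_pmf \<pi> \<subseteq> ?S"
    unfolding \<pi>_def by (auto simp: set_pmf_eq pmf_gibbs[OF ne] split: if_splits)
  have neI: "set_pmf \<pi> \<inter> I \<noteq> {}"
  proof
    assume "set_pmf \<pi> \<inter> I = {}"
    then have "(\<Sum>x\<in>?S \<inter> I. pmf \<pi> x) = 0" by (intro sum.neutral) (auto simp: set_pmf_eq)
    then show False using bw(2) by simp
  qed
  have bd: "x \<in> D" if "x \<in> ?S \<inter> I" "y \<in> ?S - I" "pmf (Q x) y \<noteq> 0" for x y
  proof -
    have "x \<noteq> y" using that by auto
    then have h: "hamming_dist N x y = 2"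
      using Q(1) that unfolding nearest_neighbor_chain_def by auto
    have "{i. i < N \<and> y i \<noteq> x i} = {i. i < N \<and> x i \<noteq> y i}" by auto
    with h have h': "hamming_dist N y x = 2" unfolding hamming_dist_def by simp
    let ?x = "card (ones N v \<inter> ones N x)" and ?y = "card (ones N v \<inter> ones N y)"
    have le: "?y \<le> ?x + 1" "?x \<le> ?y + 1"
      using card_inter_neighbor_le[OF _ _ h] card_inter_neighbor_le[OF _ _ h'] that by auto
    have xS: "x \<in> ?S" and yS: "y \<in> ?S" using that by auto
    have "0 < real ?x / real N" "real ?x / real N < b"
      using that unfolding I_def by (simp_all add: overlap_eq[OF v xS])
    then have x: "0 < ?x" "real ?x < b * real N"
      using N by (simp_all add: zero_less_divide_iff divide_less_eq)
    have "\<not> (0 < real ?y / real N \<and> real ?y / real N < b)"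
      using that unfolding I_def by (simp add: overlap_eq[OF v yS])
    then have "?y = 0 \<or> b * real N \<le> real ?y"
      using N by (auto simp: zero_less_divide_iff divide_less_eq not_less)
    then show ?thesis using le x unfolding D_def by auto
  qed
  have "measure_pmf.expectation (cond_pmf \<pi> I) (\<lambda>x. measure (chain_law Q x) {\<xi>. hitting_time (- I) \<xi> \<le> enat T})
    \<le> real T * ((\<Sum>x\<in>?S \<inter> I \<inter> D. pmf \<pi> x) / (\<Sum>x\<in>?S \<inter> I. pmf \<pi> x))"
  proof (rule expectation_exit_le[OF finite_slice supp _ Q(2) bd neI])
    fix x assume "x \<in> ?S"
    then show "set_pmf (Q x) \<subseteq> ?S" using Q(1) by (auto simp: nearest_neighbor_chain_def)
  qed
  also have "\<dots> \<le> real T * (4 * exp (- ln 2 * \<epsilon> * real N) + exp (- real N))"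
    using bw by (intro mult_left_mono) (auto simp: divide_le_eq)
  finally show ?thesis .
qed


section \<open>Choice of the exponents and the good event for the noise\<close>

theorem theorem1p5:
  fixes \<alpha> C\<^sub>1 :: real
  assumes "\<alpha> < 2 - sqrt 2" and "C\<^sub>1 > 2"
  shows "\<exists>a b :: real \<Rightarrow> real \<Rightarrow> real.
    (\<forall>\<epsilon>>0. \<forall>\<^sub>F \<rho> in at_right 0. \<forall>lam.
       C\<^sub>1 * sqrt (1 / \<rho> * ln (1 / \<rho>)) < lam \<and> lam < \<rho> powr (- \<alpha>) \<longrightarrow> b \<rho> lam / \<rho> < \<epsilon>) \<and>
    (\<forall>\<^sub>F \<rho> in at_right 0. \<forall>lam.
       C\<^sub>1 * sqrt (1 / \<rho> * ln (1 / \<rho>)) < lam \<and> lam < \<rho> powr (- \<alpha>) \<longrightarrow>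
       0 \<le> a \<rho> lam \<and> a \<rho> lam < \<rho>\<^sup>2 \<and> \<rho>\<^sup>2 < b \<rho> lam \<and> b \<rho> lam \<le> \<rho> \<and>
       (\<forall>\<^sub>F \<beta> in at_top. \<exists>h>0. \<exists>c>0. \<exists>K. \<forall>\<^sub>F N in sequentially.
          \<forall>v\<in>slice N \<rho>. \<forall>(M :: 'w measure) W. gaussian_symmetric_matrix N M W \<longrightarrow>
            (\<exists>E\<in>sets M. measure M E \<ge> 1 - K * exp (- c * real N) \<and>
               (\<forall>\<omega>\<in>E.
                  let \<pi> = gibbs N \<rho> \<beta> (spiked_matrix N lam v (W \<omega>));
                      I = {x. overlap N v x \<in> {a \<rho> lam <..< b \<rho> lam}}
                  in \<forall>Q. nearest_neighbor_chain N \<rho> Q \<and> reversible_on (slice N \<rho>) \<pi> Q \<longrightarrow>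
                    (\<forall>T::nat\<ge>1.
                       measure_pmf.expectation (cond_pmf \<pi> I)
                         (\<lambda>x. measure (chain_law Q x) {\<xi>. hitting_time (- I) \<xi> \<le> enat T})
                       \<le> real T * exp (- c * h * real N))))))"
proof -
  define \<theta>\<^sub>0 where "\<theta>\<^sub>0 = 3 / 2 - sqrt (2 :: real)"
  have "sqrt 2 < (3 / 2 :: real)" by (intro real_less_lsqrt) (auto simp: power2_eq_square)
  then have "\<theta>\<^sub>0 > 0" by (simp add: \<theta>\<^sub>0_def)
  \<comment> \<open>Two midpoints: \<gamma> between max(\<alpha> - 1/2, 0) and
    \<open>\<theta>\<^sub>0\<close>, then \<theta> between \<gamma> and
    \<open>\<theta>\<^sub>0\<close>. The first interval is nonempty because \<alpha> < 2 - sqrt 2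
    says \<alpha> - 1/2 < 3/2 - sqrt 2.\<close>
  define \<gamma> where "\<gamma> = (max (\<alpha> - 1 / 2) 0 + \<theta>\<^sub>0) / 2"
  define \<theta> where "\<theta> = (\<gamma> + \<theta>\<^sub>0) / 2"
  have m: "max (\<alpha> - 1 / 2) 0 < \<theta>\<^sub>0" "max (\<alpha> - 1 / 2) 0 \<ge> 0" "max (\<alpha> - 1 / 2) 0 \<ge> \<alpha> - 1 / 2"
    using assms(1) \<open>\<theta>\<^sub>0 > 0\<close> by (auto simp: \<theta>\<^sub>0_def)
  have g2: "2 * \<gamma> = max (\<alpha> - 1 / 2) 0 + \<theta>\<^sub>0" by (simp add: \<gamma>_def)
  then have g12: "0 < \<gamma>" "\<gamma> < \<theta>\<^sub>0" using m(1,2) by linarith+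
  have g4: "\<alpha> < 1 / 2 + \<gamma>" using g2 m(1,3) by linarith
  have g: "0 < \<gamma>" "\<gamma> < \<theta>" "\<theta> < \<theta>\<^sub>0" "\<alpha> < 1 / 2 + \<gamma>"
    using g12 g4 by (simp_all add: \<theta>_def)
  then have th: "0 < \<theta>" "\<theta> < 3 / 2 - sqrt 2" by (auto simp: \<theta>\<^sub>0_def)
  have th10: "\<theta> < 1 / 10" by (rule theta_gap(2)[OF th])
  then have g10: "\<gamma> < 1 / 10" using g by simp
  show ?thesis
  \<comment> \<open>One window serves every admissible \<open>lam\<close>. Its left end is 0, and
    the window is open, so states disjoint from \<open>v\<close> lie outside it.\<close>
  proof (rule exI[of _ "\<lambda>_ _. 0"], rule exI[of _ "\<lambda>\<rho> _. \<rho> powr (1 + \<gamma>)"], intro conjI allI impI)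
    fix \<epsilon> :: real assume "\<epsilon> > 0"
    then have "\<forall>\<^sub>F \<rho> in at_right 0. \<rho> powr \<gamma> \<le> (\<epsilon> / 2) * \<rho> powr 0"
      using g by (intro eventually_at_right_0_powr_le) auto
    then show "\<forall>\<^sub>F \<rho> in at_right 0. \<forall>lam. C\<^sub>1 * sqrt (1 / \<rho> * ln (1 / \<rho>)) < lam \<and> lam < \<rho> powr (- \<alpha>) \<longrightarrow>
        \<rho> powr (1 + \<gamma>) / \<rho> < \<epsilon>"
      using eventually_small_ln_ge[of 0]
    proof eventually_elim
      case (elim \<rho>)
      then have "\<rho> powr (1 + \<gamma>) / \<rho> = \<rho> powr \<gamma>" by (simp add: powr_add)
      then show ?case using elim \<open>\<epsilon> > 0\<close> by simp
    qed
  next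
    have "\<forall>\<^sub>F \<rho> in at_right 0. \<rho> powr 1 \<le> (1 / 2) * \<rho> powr \<gamma>"
      using g10 by (intro eventually_at_right_0_powr_le) auto
    then show "\<forall>\<^sub>F \<rho> in at_right 0. \<forall>lam.
       C\<^sub>1 * sqrt (1 / \<rho> * ln (1 / \<rho>)) < lam \<and> lam < \<rho> powr (- \<alpha>) \<longrightarrow>
       0 \<le> (0::real) \<and> 0 < \<rho>\<^sup>2 \<and> \<rho>\<^sup>2 < \<rho> powr (1 + \<gamma>) \<and> \<rho> powr (1 + \<gamma>) \<le> \<rho> \<and>
       (\<forall>\<^sub>F \<beta> in at_top. \<exists>h>0. \<exists>c>0. \<exists>K. \<forall>\<^sub>F N in sequentially.
          \<forall>v\<in>slice N \<rho>. \<forall>(M :: 'w measure) W. gaussian_symmetric_matrix N M W \<longrightarrow>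
            (\<exists>E\<in>sets M. measure M E \<ge> 1 - K * exp (- c * real N) \<and>
               (\<forall>\<omega>\<in>E.
                  let \<pi> = gibbs N \<rho> \<beta> (spiked_matrix N lam v (W \<omega>));
                      I = {x. overlap N v x \<in> {0 <..< \<rho> powr (1 + \<gamma>)}}
                  in \<forall>Q. nearest_neighbor_chain N \<rho> Q \<and> reversible_on (slice N \<rho>) \<pi> Q \<longrightarrow>
                    (\<forall>T::nat\<ge>1.
                       measure_pmf.expectation (cond_pmf \<pi> I)
                         (\<lambda>x. measure (chain_law Q x) {\<xi>. hitting_time (- I) \<xi> \<le> enat T})
                       \<le> real T * exp (- c * h * real N)))))"
      using eventually_small_ln_ge[of 2] interior_max_lower_bound[OF th, where 'w='w] interior_family_card[OF g(1) g10]
        boundary_max_upper_bound[OF g(1) g10, where 'w='w] energy_gap[OF g(1,2) th10 g(4)]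
    proof (eventually_elim, intro allI impI, elim conjE)
      fix \<rho> lam :: real
      assume sm: "\<rho> powr 1 \<le> (1 / 2) * \<rho> powr \<gamma>" and rho: "0 < \<rho>" "\<rho> < 1 / 4" "2 \<le> ln (1 / \<rho>)"
      define b where "b = \<rho> powr (1 + \<gamma>)"
      define A where "A N n = 2 * real n * sqrt ((1 - 20 * \<rho> powr \<theta>) * ln (real (N choose n)) / real N) - \<rho> ^ 3 * real N - \<rho> powr (9 / 5) * real N" for N n
      define B where "B N n = 2 * real n * sqrt (ln (real (N choose n)) * (1 - \<rho> powr \<gamma> / 16) / real N)" for N n
      define g\<^sub>0 where "g\<^sub>0 = \<rho> powr (3 / 2 + \<gamma>) / 512"
      assume int: "\<exists>c>0. \<forall>\<^sub>F N in sequentially. \<forall>n. near_size \<rho> N n \<longrightarrow>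
          (\<forall>(M :: 'w measure) W \<S>. gaussian_symmetric_matrix N M W \<and> \<S> \<subseteq> subsets N n \<and> N choose n \<le> 2 * card \<S> \<longrightarrow>
            measure M {\<omega>\<in>space M. \<forall>X\<in>\<S>. energy (W \<omega>) X \<le>
              2 * real n * sqrt ((1 - 20 * \<rho> powr \<theta>) * ln (real (N choose n)) / real N) - \<rho> ^ 3 * real N - \<rho> powr (9 / 5) * real N}
            \<le> exp (- c * real N))"
        and fam: "\<forall>\<^sub>F N in sequentially. \<forall>n V. near_size \<rho> N n \<and> V \<in> subsets N n \<longrightarrow>
          N choose n \<le> 2 * card (interior_family N n V (\<rho> powr (1 + \<gamma>)))"
        and bdy: "\<forall>\<^sub>F N in sequentially. \<forall>n V j. near_size \<rho> N n \<and> V \<in> subsets N n \<and>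
            \<rho> powr (1 + \<gamma>) * real N - 1 \<le> real j \<and> j \<le> n \<longrightarrow>
          (\<forall>(M :: 'w measure) W. gaussian_symmetric_matrix N M W \<longrightarrow>
            measure M {\<omega>\<in>space M. \<exists>X\<in>level_set N n V j. energy (W \<omega>) X \<ge>
              2 * real n * sqrt (ln (real (N choose n)) * (1 - \<rho> powr \<gamma> / 16) / real N)}
            \<le> exp (- (\<rho> powr (1 + \<gamma>) / 32) * real N))"
        and gap: "\<forall>lam. lam < \<rho> powr (- \<alpha>) \<longrightarrow> (\<forall>\<^sub>F N in sequentially. \<forall>n. near_size \<rho> N n \<longrightarrow>
           2 * real n * sqrt (ln (real (N choose n)) * (1 - \<rho> powr \<gamma> / 16) / real N) + lam * (\<rho> powr (1 + \<gamma>))\<^sup>2 * real N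
             + \<rho> powr (3 / 2 + \<gamma>) / 512 * real N
           \<le> 2 * real n * sqrt ((1 - 20 * \<rho> powr \<theta>) * ln (real (N choose n)) / real N) - \<rho> ^ 3 * real N - \<rho> powr (9 / 5) * real N)"
        and lam: "C\<^sub>1 * sqrt (1 / \<rho> * ln (1 / \<rho>)) < lam" "lam < \<rho> powr (- \<alpha>)"
      have lam0: "lam \<ge> 0"
      proof -
        have "0 \<le> C\<^sub>1 * sqrt (1 / \<rho> * ln (1 / \<rho>))" using assms(2) rho by simp
        then show ?thesis using lam(1) by linarith
      qed
      have g0: "g\<^sub>0 > 0" using rho by (simp add: g\<^sub>0_def)
      have b_eq: "b = \<rho> * \<rho> powr \<gamma>" using rho by (simp add: b_def powr_add)
      have pg: "0 < \<rho> powr \<gamma>" using rho by simp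
      have pg1: "\<rho> powr \<gamma> < 1" using rho g by (intro powr_lt_one)
      have b1: "\<rho>\<^sup>2 < b"
      proof -
        have "\<rho> < \<rho> powr \<gamma>" using sm rho pg by simp
        then show ?thesis unfolding b_eq power2_eq_square using rho by (intro mult_strict_left_mono) auto
      qed
      have b2: "b \<le> \<rho>" unfolding b_eq using rho pg1 by (simp add: mult_left_le)
      have bpos: "b > 0" using rho by (simp add: b_def)
      obtain c1 where c1: "c1 > 0" and int: "\<forall>\<^sub>F N in sequentially. \<forall>n. near_size \<rho> N n \<longrightarrow>
          (\<forall>(M :: 'w measure) W \<S>. gaussian_symmetric_matrix N M W \<and> \<S> \<subseteq> subsets N n \<and> N choose n \<le> 2 * card \<S> \<longrightarrow>
            measure M {\<omega>\<in>space M. \<forall>X\<in>\<S>. energy (W \<omega>) X \<le> A N n} \<le> exp (- c1 * real N))"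
        using int unfolding A_def by blast
      have gap: "\<forall>\<^sub>F N in sequentially. \<forall>n. near_size \<rho> N n \<longrightarrow> B N n + lam * b\<^sup>2 * real N + g\<^sub>0 * real N \<le> A N n"
        using gap lam(2) unfolding A_def B_def g\<^sub>0_def b_def by blast
      have main: "\<forall>\<^sub>F \<beta> in at_top. \<exists>h>0. \<exists>c>0. \<exists>K. \<forall>\<^sub>F N in sequentially.
          \<forall>v\<in>slice N \<rho>. \<forall>(M :: 'w measure) W. gaussian_symmetric_matrix N M W \<longrightarrow>
            (\<exists>E\<in>sets M. measure M E \<ge> 1 - K * exp (- c * real N) \<and>
               (\<forall>\<omega>\<in>E.
                  let \<pi> = gibbs N \<rho> \<beta> (spiked_matrix N lam v (W \<omega>));
                      I = {x. overlap N v x \<in> {0 <..< b}}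
                  in \<forall>Q. nearest_neighbor_chain N \<rho> Q \<and> reversible_on (slice N \<rho>) \<pi> Q \<longrightarrow>
                    (\<forall>T::nat\<ge>1.
                       measure_pmf.expectation (cond_pmf \<pi> I)
                         (\<lambda>x. measure (chain_law Q x) {\<xi>. hitting_time (- I) \<xi> \<le> enat T})
                       \<le> real T * exp (- c * h * real N))))"
        \<comment> \<open>Besides \<beta> \<ge> 0, this turns the energy gap
          \<open>g\<^sub>0 * real N\<close> into an exponent of at least 2 N, which outweighs the
          number of boundary states.\<close>
        using eventually_ge_at_top[of "max 0 (2 / g\<^sub>0)"]
      proof eventually_elim
        case (elim \<beta>)
        then have "\<beta> \<ge> 0" "2 / g\<^sub>0 \<le> \<beta>" by simp_all
        then have \<beta>: "\<beta> \<ge> 0" "\<beta> * g\<^sub>0 \<ge> 2" using g0 by (simp_all only: pos_divide_le_eq)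
        define \<epsilon> where "\<epsilon> = \<rho>\<^sup>2 * exp (- \<beta> * 192 / \<rho>) / 64"
        have e0: "\<epsilon> > 0" using rho by (simp add: \<epsilon>_def)
        have eb: "\<epsilon> < b"
        proof -
          have "exp (- \<beta> * 192 / \<rho>) \<le> 1" using \<beta> rho by simp
          then have "\<rho>\<^sup>2 * exp (- \<beta> * 192 / \<rho>) \<le> \<rho>\<^sup>2 * 1" by (intro mult_left_mono) auto
          then have "\<epsilon> \<le> \<rho>\<^sup>2" unfolding \<epsilon>_def using zero_le_power2[of \<rho>] by linarith
          then show ?thesis using b1 by simp
        qed
        \<comment> \<open>A rate below all that occur: 1 for tameness, \<open>c1\<close> for the
          interior maximum, b/32 for the boundary maximum, and half of
          \<open>ln 2 * \<epsilon>\<close> for the left barrier. The halving leaves room for the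
          constants in the exit bound.\<close>
        define c where "c = min (min 1 c1) (min (b / 32) (ln 2 * \<epsilon> / 2))"
        have c': "c \<le> 1" "c \<le> c1" "c \<le> b / 32" "c \<le> ln 2 * \<epsilon> / 2"
          unfolding c_def by (simp_all only: min_le_iff_disj order.refl simp_thms)
        have "c > 0" using c1 bpos e0 by (simp add: c_def)
        with c' have c: "c > 0" "c \<le> 1" "c \<le> c1" "c \<le> b / 32" "2 * c \<le> ln 2 * \<epsilon>" by simp_all
        have "2 * c \<le> 1"
        proof -
          have "ln 2 \<le> (1::real)" using ln_le_minus_one[of "2::real"] by simp
          moreover have "\<epsilon> \<le> 1" using eb b2 rho by simp
          ultimately have "ln 2 * \<epsilon> \<le> 1 * 1" using e0 by (intro mult_mono) auto
          then show ?thesis using c(5) by simp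
        qed
        note c = c this
        have ec: "\<forall>\<^sub>F N in sequentially. 5 * exp (- c * real N) \<le> 1"
        proof -
          have "\<forall>\<^sub>F N in sequentially. (real N + 1) * exp (- c * real N) < 1 / 5"
            by (intro order_tendstoD(2)[OF linear_exp_tendsto_0] c) auto
          then show ?thesis
          proof eventually_elim
            case (elim N)
            have "1 * exp (- c * real N) \<le> (real N + 1) * exp (- c * real N)" by (intro mult_right_mono) auto
            then show ?case using elim by linarith
          qed
        qed
        have "\<forall>\<^sub>F N in sequentially. \<forall>v\<in>slice N \<rho>. \<forall>(M :: 'w measure) W. gaussian_symmetric_matrix N M W \<longrightarrow>
            (\<exists>E\<in>sets M. measure M E \<ge> 1 - 6 * exp (- c * real N) \<and>
               (\<forall>\<omega>\<in>E.
                  let \<pi> = gibbs N \<rho> \<beta> (spiked_matrix N lam v (W \<omega>));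
                      I = {x. overlap N v x \<in> {0 <..< b}}
                  in \<forall>Q. nearest_neighbor_chain N \<rho> Q \<and> reversible_on (slice N \<rho>) \<pi> Q \<longrightarrow>
                    (\<forall>T::nat\<ge>1.
                       measure_pmf.expectation (cond_pmf \<pi> I)
                         (\<lambda>x. measure (chain_law Q x) {\<xi>. hitting_time (- I) \<xi> \<le> enat T})
                       \<le> real T * exp (- c * 1 * real N))))"
          using int fam bdy gap ec eventually_real_ge[of "1 / \<rho>"] eventually_real_ge[of "1 / \<epsilon>"]
        proof (eventually_elim, intro ballI allI impI)
          case (elim N)
          fix v and M :: "'w measure" and W
          assume v: "v \<in> slice N \<rho>" and W: "gaussian_symmetric_matrix N M W"
          interpret prob_space M by (rule gaussian_prob_space[OF W])
          let ?V = "ones N v"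
          define n where "n = card ?V"
          have near: "near_size \<rho> N n" unfolding n_def by (rule near_size_card_ones[OF v])
          note nn = near_sizeD[OF near rho(1,2) elim(6)]
          have V: "?V \<in> subsets N n" using ones_subset by (auto simp: subsets_def n_def)
          have epsN: "\<epsilon> * real N \<ge> 1" using elim(7) e0 by (simp add: divide_le_eq mult.commute)
          define j where "j = nat (\<lceil>b * real N\<rceil> - 1)"
          have "b * real N > 0" using bpos nn by simp
          then have "\<lceil>b * real N\<rceil> \<ge> 1" by simp
          then have "real j = of_int \<lceil>b * real N\<rceil> - 1" by (simp add: j_def)
          then have j: "b * real N - 1 \<le> real j" "real j < b * real N" by linarith+
          have juniq: "i = j" if "b * real N - 1 \<le> real i" "real i < b * real N" for i
          proof -
            have "real i < real j + 1" "real j < real i + 1" using j that by linarith+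
            then show ?thesis by linarith
          qed
          define F where "F = interior_family N n ?V b"
          define bad1 where "bad1 = {\<omega>\<in>space M. \<forall>X\<in>F. energy (W \<omega>) X \<le> A N n}"
          define bad2 where "bad2 = {\<omega>\<in>space M. \<exists>X\<in>level_set N n ?V j. energy (W \<omega>) X \<ge> B N n}"
          define bad3 where "bad3 = {\<omega>\<in>space M. \<not> tame_matrix N (W \<omega>)}"
          have F: "F \<subseteq> subsets N n" "finite F" by (auto simp: F_def interior_family_def)
          have p1: "prob bad1 \<le> exp (- c * real N)"
          proof -
            have "N choose n \<le> 2 * card F"
              using elim(2)[rule_format, of n ?V] near V unfolding F_def b_def by simp
            then have "prob bad1 \<le> exp (- c1 * real N)"
              using elim(1)[rule_format, OF near, of M W F] W F unfolding bad1_def by simp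
            also have "\<dots> \<le> exp (- c * real N)" using c by (simp add: mult_right_mono)
            finally show ?thesis .
          qed
          have p2: "prob bad2 \<le> exp (- c * real N)"
          \<comment> \<open>If \<open>j\<close> exceeds \<open>n\<close>, the level set is empty and
            the bad event cannot occur.\<close>
          proof (cases "j \<le> n")
            case True
            then have "prob bad2 \<le> exp (- (b / 32) * real N)"
              using elim(3)[rule_format, of n ?V j M W] near V W j unfolding bad2_def B_def b_def by simp
            also have "\<dots> \<le> exp (- c * real N)" using mult_right_mono[OF c(4), of "real N"] by simp
            finally show ?thesis .
          next
            case False
            have "card (?V \<inter> X) \<le> n" for X unfolding n_def by (intro card_mono) auto
            then have "bad2 = {}" using False unfolding bad2_def level_set_def by auto
            then show ?thesis by simp
          qed
          have p3: "prob bad3 \<le> 4 * exp (- c * real N)"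
          proof -
            have "prob bad3 \<le> 4 * 4 ^ N * exp (- 9 * real N)"
              unfolding bad3_def by (rule tame_matrix_prob(2)[OF W nn(5)])
            also have "\<dots> \<le> 4 * exp (8 * real N) * exp (- 9 * real N)"
            proof (intro mult_right_mono mult_left_mono)
              have "(4::real) ^ N \<le> exp 8 ^ N" using exp_ge_add_one_self[of 8] by (intro power_mono) auto
              then show "(4::real) ^ N \<le> exp (8 * real N)" by (simp add: exp_of_nat_mult[symmetric] mult.commute)
            qed auto
            also have "\<dots> = 4 * exp (- 1 * real N)" by (simp add: exp_add[symmetric])
            also have "\<dots> \<le> 4 * exp (- c * real N)" using c(2) mult_right_mono[OF c(2), of "real N"] by simp
            finally show ?thesis .
          qed
          have em: "X \<in> subsets N n \<Longrightarrow> (\<lambda>\<omega>. energy (W \<omega>) X) \<in> borel_measurable M" for X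
            by (rule measurable_energy[OF W nn(5)]) (simp add: subsets_def)
          have s1: "bad1 \<in> events"
          proof -
            have "space M - bad1 = (\<Union>X\<in>F. {\<omega>\<in>space M. energy (W \<omega>) X > A N n})"
              unfolding bad1_def by (auto simp: not_le)
            also have "\<dots> \<in> events" using F em by (intro sets.finite_UN) (auto intro!: borel_measurable_less)
            finally have "space M - (space M - bad1) \<in> events" by (rule sets.compl_sets)
            moreover have "space M - (space M - bad1) = bad1" unfolding bad1_def by auto
            ultimately show ?thesis by simp
          qed
          have s2: "bad2 \<in> events"
          proof -
            have "bad2 = (\<Union>X\<in>level_set N n ?V j. {\<omega>\<in>space M. energy (W \<omega>) X \<ge> B N n})"
              unfolding bad2_def by auto
            also have "\<dots> \<in> events"
              using em by (intro sets.finite_UN) (auto intro!: borel_measurable_le simp: level_set_def)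
            finally show ?thesis .
          qed
          have s3: "bad3 \<in> events"
          proof -
            have "bad3 = space M - {\<omega>\<in>space M. tame_matrix N (W \<omega>)}" unfolding bad3_def by auto
            then show ?thesis using tame_matrix_prob(1)[OF W nn(5)] by simp
          qed
          \<comment> \<open>The good event does not refer to the chain, so on it the bound holds for
            all chains and all \<open>T\<close> at once. The three failure probabilities carry the
            constants 1, 1 and 4, which add up to 6.\<close>
          define E where "E = space M - (bad1 \<union> (bad2 \<union> bad3))"
          have Ee: "E \<in> events" unfolding E_def using s1 s2 s3 by auto
          have "prob (bad1 \<union> (bad2 \<union> bad3)) \<le> prob bad1 + (prob bad2 + prob bad3)"
            using s1 s2 s3 by (intro order.trans[OF measure_Un_le] add_left_mono measure_Un_le) auto
          then have PE: "prob E \<ge> 1 - 6 * exp (- c * real N)"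
            unfolding E_def using s1 s2 s3 p1 p2 p3 by (subst prob_compl) auto
          \<comment> \<open>Each term on the left has rate at least \<open>2 * c\<close>; one factor
            exp(- c N) absorbs the constant 4 + 1.\<close>
          have rate: "4 * exp (- ln 2 * \<epsilon> * real N) + exp (- real N) \<le> exp (- c * 1 * real N)"
          proof -
            have "exp (- ln 2 * \<epsilon> * real N) \<le> exp (- (2 * c) * real N)"
              using mult_right_mono[OF c(5), of "real N"] by simp
            moreover have "exp (- real N) \<le> exp (- (2 * c) * real N)"
              using mult_right_mono[OF c(6), of "real N"] by simp
            moreover have "exp (- (2 * c) * real N) = exp (- c * real N) * exp (- c * real N)"
              by (simp add: exp_add[symmetric])
            moreover have "(5 * exp (- c * real N)) * exp (- c * real N) \<le> 1 * exp (- c * real N)"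
              using elim(5) by (intro mult_right_mono) auto
            ultimately have "4 * exp (- ln 2 * \<epsilon> * real N) + exp (- real N) \<le> exp (- c * real N)" by linarith
            then show ?thesis by simp
          qed
          have "\<forall>\<omega>\<in>E. let \<pi> = gibbs N \<rho> \<beta> (spiked_matrix N lam v (W \<omega>)); I = {x. overlap N v x \<in> {0 <..< b}}
                  in \<forall>Q. nearest_neighbor_chain N \<rho> Q \<and> reversible_on (slice N \<rho>) \<pi> Q \<longrightarrow>
                    (\<forall>T::nat\<ge>1. measure_pmf.expectation (cond_pmf \<pi> I)
                         (\<lambda>x. measure (chain_law Q x) {\<xi>. hitting_time (- I) \<xi> \<le> enat T})
                       \<le> real T * exp (- c * 1 * real N))"
            unfolding Let_def
          proof (intro ballI allI impI, elim conjE)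
            fix \<omega> Q T
            assume om: "\<omega> \<in> E" and Q: "nearest_neighbor_chain N \<rho> Q"
              "reversible_on (slice N \<rho>) (gibbs N \<rho> \<beta> (spiked_matrix N lam v (W \<omega>))) Q"
            have oms: "\<omega> \<in> space M" "\<omega> \<notin> bad1" "\<omega> \<notin> bad2" "\<omega> \<notin> bad3" using om by (auto simp: E_def)
            then have tame: "tame_matrix N (W \<omega>)" by (simp add: bad3_def)
            obtain X0 where X0: "X0 \<in> F" "energy (W \<omega>) X0 \<ge> A N n"
              using oms unfolding bad1_def by (auto simp: not_le intro: less_imp_le)
            have outer: "energy (W \<omega>) X \<le> A N n - lam * b\<^sup>2 * real N - g\<^sub>0 * real N"
              if "b * real N - 1 \<le> real i" "real i < b * real N" "X \<in> level_set N n ?V i" for X i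
            proof -
              have "i = j" by (rule juniq[OF that(1,2)])
              then have "energy (W \<omega>) X < B N n" using oms that(3) unfolding bad2_def by (auto simp: not_le)
              then show ?thesis using elim(4) near by force
            qed
            have "measure_pmf.expectation (cond_pmf (gibbs N \<rho> \<beta> (spiked_matrix N lam v (W \<omega>))) {x. overlap N v x \<in> {0 <..< b}})
                (\<lambda>x. measure (chain_law Q x) {\<xi>. hitting_time (- {x. overlap N v x \<in> {0 <..< b}}) \<xi> \<le> enat T})
              \<le> real T * (4 * exp (- ln 2 * \<epsilon> * real N) + exp (- real N))"
            proof (rule exit_probability_le[OF v nn(5) tame _ lam0 \<beta> rho(1) _ _ \<epsilon>_def epsN eb _ _ _ Q])
              show "W \<omega> i k = W \<omega> k i" if "i < N" "k < N" for i k
                by (rule gaussian_sym[OF W oms(1) that])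
              show "\<rho> < 1" using rho by simp
              show "\<rho> / 2 * real N \<le> real (card ?V)" using nn(6) by (simp add: n_def)
              show "X0 \<in> interior_family N (card ?V) ?V b" using X0(1) by (simp add: F_def n_def)
              show "energy (W \<omega>) X0 \<ge> A N n" by (rule X0(2))
              show "energy (W \<omega>) X \<le> A N n - lam * b\<^sup>2 * real N - g\<^sub>0 * real N"
                if "b * real N - 1 \<le> real i" "real i < b * real N" "X \<in> level_set N (card ?V) ?V i" for X i
                using outer that by (simp add: n_def)
            qed
            also have "\<dots> \<le> real T * exp (- c * 1 * real N)" using rate by (intro mult_left_mono) auto
            finally show "measure_pmf.expectation (cond_pmf (gibbs N \<rho> \<beta> (spiked_matrix N lam v (W \<omega>))) {x. overlap N v x \<in> {0 <..< b}})
                (\<lambda>x. measure (chain_law Q x) {\<xi>. hitting_time (- {x. overlap N v x \<in> {0 <..< b}}) \<xi> \<le> enat T})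
              \<le> real T * exp (- c * 1 * real N)" .
          qed
          with Ee PE show "\<exists>E\<in>sets M. measure M E \<ge> 1 - 6 * exp (- c * real N) \<and>
               (\<forall>\<omega>\<in>E.
                  let \<pi> = gibbs N \<rho> \<beta> (spiked_matrix N lam v (W \<omega>));
                      I = {x. overlap N v x \<in> {0 <..< b}}
                  in \<forall>Q. nearest_neighbor_chain N \<rho> Q \<and> reversible_on (slice N \<rho>) \<pi> Q \<longrightarrow>
                    (\<forall>T::nat\<ge>1.
                       measure_pmf.expectation (cond_pmf \<pi> I)
                         (\<lambda>x. measure (chain_law Q x) {\<xi>. hitting_time (- I) \<xi> \<le> enat T})
                       \<le> real T * exp (- c * 1 * real N)))"
            by blast
        qed
        \<comment> \<open>The witnesses are \<open>h = 1\<close> and \<open>K = 6\<close>: the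
          height of the barrier is already accounted for in \<open>c\<close>.\<close>
        then show ?case using c(1) zero_less_one by blast
      qed
      show "0 \<le> (0::real) \<and> 0 < \<rho>\<^sup>2 \<and> \<rho>\<^sup>2 < \<rho> powr (1 + \<gamma>) \<and> \<rho> powr (1 + \<gamma>) \<le> \<rho> \<and>
       (\<forall>\<^sub>F \<beta> in at_top. \<exists>h>0. \<exists>c>0. \<exists>K. \<forall>\<^sub>F N in sequentially.
          \<forall>v\<in>slice N \<rho>. \<forall>(M :: 'w measure) W. gaussian_symmetric_matrix N M W \<longrightarrow>
            (\<exists>E\<in>sets M. measure M E \<ge> 1 - K * exp (- c * real N) \<and>
               (\<forall>\<omega>\<in>E.
                  let \<pi> = gibbs N \<rho> \<beta> (spiked_matrix N lam v (W \<omega>));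
                      I = {x. overlap N v x \<in> {0 <..< \<rho> powr (1 + \<gamma>)}}
                  in \<forall>Q. nearest_neighbor_chain N \<rho> Q \<and> reversible_on (slice N \<rho>) \<pi> Q \<longrightarrow>
                    (\<forall>T::nat\<ge>1.
                       measure_pmf.expectation (cond_pmf \<pi> I)
                         (\<lambda>x. measure (chain_law Q x) {\<xi>. hitting_time (- I) \<xi> \<le> enat T})
                       \<le> real T * exp (- c * h * real N)))))"
        using main b1 b2 rho(1) unfolding b_def by simp
    qed
  qed
qed

end
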